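(* Let $d\geq 1$, let $\Omega\subset\mathbb{R}^d$ be a bounded Lipschitz domain, and let $p>1$, $s\in(0,1)$ satisfy $sp=d$. Let $n_0\in\mathbb{N}$ be such that $n_0\geq p-1>n_0-1$, and let $u\in W^{s,p}_0(\Omega)$. Then for every $\alpha>0$ the function $$x\mapsto \Phi_{n_0}\left(\alpha\, X_d(u)(x)^{\frac{d}{d-s}}\right)\frac{1}{\delta_\Omega(x)^d}$$ belongs to $L^1(\Omega)$.
   Context: For a bounded Lipschitz domain $\Omega\subset\mathbb{R}^d$, $\delta_\Omega(x) := \min_{y\in\partial\Omega}|x-y|$ is the distance to the boundary, and $R:=\sup_{x\in\Omega}\delta_\Omega(x)$. For $p\in[1,\infty)$ and $s\in(0,1)$, the Gagliardo seminorm is $$[u]_{W^{s,p}(\Omega)} := \left(\int_\Omega\int_\Omega \frac{|u(x)-u(y)|^p}{|x-y|^{d+sp}}\,dx\,dy\right)^{1/p}.$$ $W^{s,p}(\Omega)$ is the space of $u\in L^p(\Omega)$ with $[u]_{W^{s,p}(\Omega)}<\infty$, with norm $\|u\|_{W^{s,p}(\Omega)} := \left([u]_{W^{s,p}(\Omega)}^p+\|u\|_{L^p(\Omega)}^p\right)^{1/p}$, and $W^{s,p}_0(\Omega)$ is the completion (closure) of $C_c^\infty(\Omega)$ with respect to this norm. The average of $u$ is $(u)_\Omega := \frac{1}{|\Omega|}\int_\Omega u(y)\,dy$. For $n_0\in\mathbb{N}$, $\Phi_{n_0}(t) := \exp(t)-\sum_{n=0}^{n_0-1}\frac{t^n}{n!}$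 for $t\in\mathbb{R}$. The function $X_d(u)$ on $\Omega$ is $$X_1(u)(x) := \frac{|u(x)-(u)_\Omega|}{\ln\left(\frac{2R}{\delta_\Omega(x)}\right)}\quad\text{if } d=1,\qquad X_d(u)(x) := |u(x)|\quad\text{if } d\geq 2.$$ *)

theory Defs
  imports "HOL-Analysis.Analysis"
begin

text \<open>
  Functions on \<open>\<Omega>\<close> are represented by total functions on the ambient Euclidean space;
  their values outside \<open>\<Omega>\<close> are irrelevant. Elements of \<open>L\<^sup>p(\<Omega>)\<close> are represented by
  Lebesgue measurable representatives rather than by equivalence classes.
\<close>

section \<open>Bounded Lipschitz domains and the distance to the boundary\<close>

text \<open>
  Near each boundary point, \<open>\<Omega>\<close> is the strict epigraph of a Lipschitz function after a rigid
  motion. Here \<open>e\<close> is the vertical unit vector, the graph function \<open>\<gamma>\<close> lives on the hyperplane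
  orthogonal to \<open>e\<close>, and \<open>x - (x \<bullet> e) *\<^sub>R e\<close> is the projection onto it. In dimension one that
  hyperplane is \<open>{0}\<close>, so \<open>\<gamma>\<close> is a constant and \<open>\<Omega>\<close> is locally a half-line.
\<close>

definition bounded_lipschitz_domain :: "'a::euclidean_space set \<Rightarrow> bool" where
  "bounded_lipschitz_domain \<Omega> \<longleftrightarrow>
     open \<Omega> \<and> connected \<Omega> \<and> \<Omega> \<noteq> {} \<and> bounded \<Omega> \<and>
     (\<forall>z\<in>frontier \<Omega>. \<exists>r>0. \<exists>e L \<gamma>. norm e = 1 \<and> L-lipschitz_on {w. w \<bullet> e = 0} \<gamma> \<and>
        \<Omega> \<inter> ball z r = {x \<in> ball z r. \<gamma> (x - (x \<bullet> e) *\<^sub>R e) < x \<bullet> e})"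

text \<open>For nonempty bounded open \<open>\<Omega>\<close> the frontier is nonempty and compact, so the infimum is
  attained.\<close>

definition bdry_dist :: "'a::euclidean_space set \<Rightarrow> 'a \<Rightarrow> real" where
  "bdry_dist \<Omega> x = infdist x (frontier \<Omega>)"

definition inradius :: "'a::euclidean_space set \<Rightarrow> real" where
  "inradius \<Omega> = (SUP x\<in>\<Omega>. bdry_dist \<Omega> x)"

section \<open>Test functions\<close>

text \<open>Continuous differentiability of order \<open>k\<close> on the whole space, by recursion through all
  directional derivatives.\<close>

primrec cont_diff :: "nat \<Rightarrow> ('a::euclidean_space \<Rightarrow> real) \<Rightarrow> bool" where
  "cont_diff 0 f \<longleftrightarrow> continuous_on UNIV f"
| "cont_diff (Suc k) f \<longleftrightarrow>
     (\<forall>x. f differentiable (at x)) \<and> (\<forall>v. cont_diff k (\<lambda>x. frechet_derivative f (at x) v))"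

definition test_functions :: "'a::euclidean_space set \<Rightarrow> ('a \<Rightarrow> real) set" where
  "test_functions \<Omega> =
     {\<phi>. (\<forall>k. cont_diff k \<phi>) \<and> compact (closure {x. \<phi> x \<noteq> 0}) \<and> closure {x. \<phi> x \<noteq> 0} \<subseteq> \<Omega>}"

section \<open>Fractional Sobolev spaces\<close>

text \<open>Real powers of extended nonnegative numbers, for positive exponents. Norms take values in
  \<^typ>\<open>ennreal\<close>, so that finiteness is meaningful.\<close>

definition ennpowr :: "ennreal \<Rightarrow> real \<Rightarrow> ennreal" where
  "ennpowr a r = (if a = \<infinity> then \<infinity> else ennreal (enn2real a powr r))"

definition Lp_norm :: "real \<Rightarrow> 'a::euclidean_space set \<Rightarrow> ('a \<Rightarrow> real) \<Rightarrow> ennreal" where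
  "Lp_norm p \<Omega> u = ennpowr (\<integral>\<^sup>+x. ennreal (\<bar>u x\<bar> powr p) \<partial>lebesgue_on \<Omega>) (1 / p)"

text \<open>On the diagonal the integrand evaluates to \<open>0 / 0 = 0\<close>; the diagonal is a null set.\<close>

definition gagliardo ::
    "real \<Rightarrow> real \<Rightarrow> 'a::euclidean_space set \<Rightarrow> ('a \<Rightarrow> real) \<Rightarrow> ennreal" where
  "gagliardo s p \<Omega> u =
     ennpowr (\<integral>\<^sup>+x. (\<integral>\<^sup>+y. ennreal (\<bar>u x - u y\<bar> powr p / norm (x - y) powr (real DIM('a) + s * p))
        \<partial>lebesgue_on \<Omega>) \<partial>lebesgue_on \<Omega>) (1 / p)"

definition sobolev_norm ::
    "real \<Rightarrow> real \<Rightarrow> 'a::euclidean_space set \<Rightarrow> ('a \<Rightarrow> real) \<Rightarrow> ennreal" where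
  "sobolev_norm s p \<Omega> u =
     ennpowr (ennpowr (gagliardo s p \<Omega> u) p + ennpowr (Lp_norm p \<Omega> u) p) (1 / p)"

definition sobolev :: "real \<Rightarrow> real \<Rightarrow> 'a::euclidean_space set \<Rightarrow> ('a \<Rightarrow> real) set" where
  "sobolev s p \<Omega> =
     {u \<in> borel_measurable (lebesgue_on \<Omega>). Lp_norm p \<Omega> u < \<infinity> \<and> gagliardo s p \<Omega> u < \<infinity>}"

definition sobolev0 :: "real \<Rightarrow> real \<Rightarrow> 'a::euclidean_space set \<Rightarrow> ('a \<Rightarrow> real) set" where
  "sobolev0 s p \<Omega> =
     {u \<in> sobolev s p \<Omega>. \<forall>\<epsilon>>0. \<exists>\<phi>\<in>test_functions \<Omega>. sobolev_norm s p \<Omega> (\<lambda>x. u x - \<phi> x) < \<epsilon>}"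

section \<open>The functions in the integrability statement\<close>

definition average :: "'a::euclidean_space set \<Rightarrow> ('a \<Rightarrow> real) \<Rightarrow> real" where
  "average \<Omega> u = 1 / measure lebesgue \<Omega> * (LINT y|lebesgue_on \<Omega>. u y)"

definition Phi :: "nat \<Rightarrow> real \<Rightarrow> real" where
  "Phi m t = exp t - (\<Sum>n<m. t ^ n / fact n)"

definition X :: "'a::euclidean_space set \<Rightarrow> ('a \<Rightarrow> real) \<Rightarrow> 'a \<Rightarrow> real" where
  "X \<Omega> u x =
     (if DIM('a) = 1 then \<bar>u x - average \<Omega> u\<bar> / ln (2 * inradius \<Omega> / bdry_dist \<Omega> x) else \<bar>u x\<bar>)"

end

theory Submission
  imports Defs
begin

text \<open>
  Write \<open>d\<close> for the dimension, \<open>\<delta>\<close> for the distance to the boundary and \<open>p' = p / (p - 1)\<close>; since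
  \<open>s p = d\<close>, this is the exponent \<open>d / (d - s)\<close>, and the Gagliardo kernel is
  \<open>|u x - u y|\<^sup>p / |x - y| ^ (2 d)\<close>. Call its double integral the energy and its integral in
  \<open>y\<close> alone the local energy \<open>g x\<close>.

  The heart of the proof is a pointwise estimate. Around \<open>x\<close> take the dyadic shells of radii
  \<open>\<delta> x / 2\<^sup>k\<close>. Consecutive averages of \<open>u\<close> over these shells differ by quantities whose \<open>p\<close>-th powers
  have sum at most a constant times the energy, because the shells are disjoint; by Jensen's inequality
  \<open>k\<close> steps therefore move the average by at most a multiple of \<open>k powr (1 / p')\<close> times the \<open>p\<close>-th root of the
  energy (\<open>chain_bound\<close>). The last average differs from \<open>u x\<close> by at most a multiple of the \<open>p\<close>-th root of
  \<open>(\<delta> x / 2\<^sup>k)\<^sup>d g x\<close> (\<open>tail_bound\<close>). Choosing \<open>k\<close> proportional to the \<open>p'\<close>-th power of the size of \<open>u x\<close>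
  makes the second error dominate, and then the factor \<open>exp (\<alpha> |u x| powr p')\<close> is absorbed by
  the gain \<open>1 / 2 ^ (k d)\<close>, provided that the energy is small (\<open>Phi_le_of_scales\<close>). This bounds the
  integrand by a multiple of \<open>X\<^sup>p / \<delta>\<^sup>d + g\<close> at every point. The function \<open>g\<close> integrates to the
  energy, so that everything reduces to a Hardy inequality: the integral of \<open>X\<^sup>p / \<delta>\<^sup>d\<close> is at most a
  multiple of the energy (\<open>trudinger_of_hardy\<close>). The condition \<open>n\<^sub>0 \<ge> p - 1\<close> enters because the lowest
  power in the series of \<open>Phi n\<^sub>0\<close>, evaluated at \<open>X powr p'\<close>, must have exponent at least \<open>p\<close> in \<open>X\<close>.

  For \<open>d \<ge> 2\<close> the Hardy inequality compares \<open>u x\<close> with its values at points that are closer to the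
  boundary by a large factor \<open>\<nu>\<close> (\<open>hardy_lipschitz\<close>). In a Lipschitz domain these points fill at least a
  proportion of order \<open>1 / \<nu>\<close> of a ball around \<open>x\<close> of radius \<open>2 \<delta> x\<close> (\<open>measure_outward_layer_ge\<close>), and the
  weight gains a factor \<open>1 / \<nu>\<^sup>d\<close>; as \<open>d > 1\<close>, the term with the values near the boundary can be
  absorbed. For \<open>d = 1\<close> there is no such gain. The domain is then an interval, and the logarithm
  in the definition of \<open>X\<close> counts the dyadic layers between \<open>x\<close> and the centre, so that the
  inequality follows from the classical discrete Hardy inequality for the differences of the averages over
  successive layers (\<open>log_hardy_interval\<close>).

  Finally, \<open>u\<close> is split into a test function \<open>\<phi>\<close> and a remainder of small energy. The function \<open>X\<close> of
  a test function is bounded, so that the Hardy inequality alone suffices for it; the remainder is a limit almost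
  everywhere of test functions with small energy, and Fatou's lemma transfers the bound to it.
\<close>

section \<open>Elementary inequalities\<close>

lemma Phi_sums:
  fixes t :: real
  shows "(\<lambda>n. t ^ (n + m) / fact (n + m)) sums Phi m t"
proof -
  have "(\<lambda>n. t ^ n / fact n) sums exp t"
    using exp_converges[of t] by (simp add: divide_inverse mult.commute)
  from sums_split_initial_segment[OF this, of m] show ?thesis
    by (simp add: Phi_def)
qed

lemma Phi_nonneg: "0 \<le> t \<Longrightarrow> 0 \<le> Phi m t"
  by (rule sums_le[OF _ sums_zero Phi_sums]) auto

lemma Phi_mono: "0 \<le> t \<Longrightarrow> t \<le> t' \<Longrightarrow> Phi m t \<le> Phi m t'"
  by (rule sums_le[OF _ Phi_sums Phi_sums]) (auto intro!: divide_right_mono power_mono)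

lemma continuous_on_Phi: "continuous_on UNIV (Phi m)"
  unfolding Phi_def by (intro continuous_intros) auto

lemma Phi_le_power_exp:
  assumes "0 \<le> t"
  shows "Phi m t \<le> t ^ m * exp t"
proof (rule sums_le[OF _ Phi_sums])
  show "(\<lambda>n. t ^ m * (t ^ n / fact n)) sums (t ^ m * exp t)"
    using sums_mult[OF exp_converges[of t], of "t ^ m"]
    by (simp add: divide_inverse mult.commute)
  fix n
  have "(fact n :: real) \<le> fact (n + m)" by (simp add: fact_mono)
  then have "t ^ (n + m) / fact (n + m) \<le> t ^ (n + m) / fact n"
    using assms by (intro divide_left_mono) auto
  then show "t ^ (n + m) / fact (n + m) \<le> t ^ m * (t ^ n / fact n)"
    by (simp add: power_add mult.commute)
qed

text \<open>
  The power \<open>p - 1\<close> is what the Hardy inequality can handle: at \<open>t = \<alpha> * X powr (p / (p - 1))\<close> it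
  becomes a multiple of \<open>X powr p\<close>. The excess of \<open>m\<close> over \<open>p - 1\<close> is less than \<open>1\<close>, so it costs at most one
  more factor \<open>exp t\<close>.
\<close>

lemma Phi_le_powr_exp:
  fixes p t :: real
  assumes "0 \<le> t" "1 < p" "real m \<ge> p - 1" "p - 1 > real m - 1"
  shows "Phi m t \<le> t powr (p - 1) * exp (2 * t)"
proof (cases "t = 0")
  case True
  have "m > 0" using assms by (cases m) auto
  then show ?thesis using Phi_le_power_exp[of t m] True by (simp add: zero_power)
next
  case False
  then have t: "t > 0" using assms by simp
  have "t ^ m = t powr (p - 1) * t powr (real m - (p - 1))"
    using t by (simp add: powr_realpow[symmetric] flip: powr_add)
  also have "t powr (real m - (p - 1)) \<le> exp t"
  proof (cases "t \<ge> 1")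
    case True
    have "t powr (real m - (p - 1)) \<le> t powr 1"
      using True assms by (intro powr_mono) auto
    also have "\<dots> \<le> exp t" using t exp_ge_add_one_self[of t] by (simp only: powr_one)
    finally show ?thesis .
  next
    case False
    have "t powr (real m - (p - 1)) \<le> 1"
      using False t assms by (simp add: powr_le1)
    then show ?thesis using t one_le_exp_iff[of t] by linarith
  qed
  finally have "t ^ m \<le> t powr (p - 1) * exp t" by (simp add: mult_left_mono)
  then have "t ^ m * exp t \<le> t powr (p - 1) * exp t * exp t"
    by (intro mult_right_mono) auto
  then show ?thesis using Phi_le_power_exp[OF assms(1), of m]
    by (simp add: mult.assoc mult_exp_exp)
qed

lemma powr_add_le:
  fixes a b p :: real
  assumes "0 \<le> a" "0 \<le> b" "0 \<le> p"
  shows "(a + b) powr p \<le> 2 powr p * (a powr p + b powr p)"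
proof -
  have "(a + b) powr p \<le> (2 * max a b) powr p"
    using assms by (intro powr_mono2) auto
  also have "\<dots> = 2 powr p * max a b powr p" using assms by (simp add: powr_mult)
  also have "max a b powr p \<le> a powr p + b powr p" by (auto simp: max_def)
  finally show ?thesis by simp
qed

text \<open>
  Both summands are at most the larger one, so no convexity of \<open>Phi m\<close> is involved; the price is the
  factor \<open>2 powr q\<close> inside.
\<close>

lemma Phi_add_le:
  fixes a b :: real
  assumes "0 \<le> a" "0 \<le> b" "0 \<le> q" "0 \<le> \<alpha>"
  shows "Phi m (\<alpha> * (a + b) powr q) \<le> Phi m (\<alpha> * 2 powr q * a powr q) + Phi m (\<alpha> * 2 powr q * b powr q)"
proof -
  have "(a + b) powr q \<le> (2 * max a b) powr q"
    using assms by (intro powr_mono2) auto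
  also have "\<dots> = 2 powr q * max a b powr q" using assms by (simp add: powr_mult)
  finally have "Phi m (\<alpha> * (a + b) powr q) \<le> Phi m (\<alpha> * 2 powr q * max a b powr q)"
    using assms by (intro Phi_mono) (auto simp: mult.assoc intro: mult_left_mono)
  also have "\<dots> \<le> Phi m (\<alpha> * 2 powr q * a powr q) + Phi m (\<alpha> * 2 powr q * b powr q)"
    using assms Phi_nonneg[of "\<alpha> * 2 powr q * a powr q" m] Phi_nonneg[of "\<alpha> * 2 powr q * b powr q" m]
    by (auto simp: max_def)
  finally show ?thesis .
qed

lemma powr_young:
  fixes p a b :: real
  assumes "1 < p" "0 \<le> a" "0 \<le> b"
  shows "a powr (p - 1) * b \<le> (p - 1) / p * a powr p + b powr p / p"
proof -
  have "a powr (p - 1) * b \<le> (a powr (p - 1)) powr (p / (p - 1)) / (p / (p - 1)) + b powr p / p"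
    using assms by (intro Youngs_inequality) (auto simp: field_simps)
  also have "(a powr (p - 1)) powr (p / (p - 1)) = a powr p" using assms by (simp add: powr_powr)
  finally show ?thesis using assms by (simp add: mult.commute)
qed

text \<open>
  Jensen's inequality for the mean \<open>a\<close> of the \<open>f j\<close>, from Young's inequality applied to
  \<open>a powr (p - 1) * f j\<close> and summed over \<open>j\<close>.
\<close>

lemma sum_powr_le:
  fixes f :: "nat \<Rightarrow> real"
  assumes "\<And>j. 0 \<le> f j" "1 < p" "0 < k"
  shows "(\<Sum>j<k. f j) powr p \<le> real k powr (p - 1) * (\<Sum>j<k. f j powr p)"
proof -
  define a where "a = (\<Sum>j<k. f j) / k"
  have a: "0 \<le> a" "(\<Sum>j<k. f j) = k * a" using assms by (auto simp: a_def sum_nonneg)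
  have "a powr (p - 1) * (k * a) = (\<Sum>j<k. a powr (p - 1) * f j)"
    unfolding a(2)[symmetric] by (simp add: sum_distrib_left)
  also have "\<dots> \<le> (\<Sum>j<k. (p - 1) / p * a powr p + f j powr p / p)"
    using assms a by (intro sum_mono powr_young) auto
  also have "\<dots> = k * ((p - 1) / p * a powr p) + (\<Sum>j<k. f j powr p) / p"
    by (simp add: sum.distrib sum_divide_distrib)
  also have "a powr (p - 1) * (k * a) = k * a powr p"
    using a assms by (cases "a = 0") (auto simp: powr_diff)
  finally have "k * a powr p \<le> (\<Sum>j<k. f j powr p)"
    using assms by (simp add: field_simps)
  then have "k powr (p - 1) * (k * a powr p) \<le> k powr (p - 1) * (\<Sum>j<k. f j powr p)"
    by (intro mult_left_mono) auto
  moreover have "k powr (p - 1) * (k * a powr p) = (k * a) powr p"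
    using a assms by (simp add: powr_diff powr_mult)
  ultimately show ?thesis by (simp add: a)
qed

definition set_average :: "'a::euclidean_space set \<Rightarrow> ('a \<Rightarrow> real) \<Rightarrow> real" where
  "set_average S u = (LINT y:S|lborel. u y) / measure lborel S"

lemma set_integrable_continuous:
  fixes u :: "'a::euclidean_space \<Rightarrow> real"
  assumes "continuous_on UNIV u" "bounded S" "S \<in> sets borel"
  shows "set_integrable lborel S u"
proof -
  have "compact (closure S)" using assms by (simp add: compact_closure)
  then have "set_integrable lborel (closure S) u"
    unfolding set_integrable_def
    by (intro borel_integrable_compact continuous_on_subset[OF assms(1)]) auto
  then show ?thesis
    by (rule set_integrable_subset) (use assms closure_subset in auto)
qed

text \<open>
  The same use of Young's inequality as for finite sums, with \<open>m = |set_average S u - c|\<close>: integrating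
  the bound for \<open>m powr (p - 1) * |u y - c|\<close> over \<open>S\<close> gives a multiple of \<open>m powr p\<close> on the right that the
  left side absorbs. For a null set both sides vanish.
\<close>

lemma jensen_average:
  fixes u :: "'a::euclidean_space \<Rightarrow> real"
  assumes u: "continuous_on UNIV u" and S: "bounded S" "S \<in> sets borel" and p: "1 < p"
  shows "ennreal (measure lborel S * \<bar>set_average S u - c\<bar> powr p)
     \<le> (\<integral>\<^sup>+y\<in>S. ennreal (\<bar>u y - c\<bar> powr p) \<partial>lborel)"
proof (cases "measure lborel S = 0")
  case True then show ?thesis by simp
next
  case False
  define V where "V = measure lborel S"
  have V: "V > 0" using False by (simp add: V_def zero_less_measure_iff)
  define m where "m = \<bar>set_average S u - c\<bar>"
  have fin: "emeasure lborel S < \<infinity>" using S(1) by (rule emeasure_bounded_finite)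
  have i1: "set_integrable lborel S (\<lambda>y. u y - c)"
    by (intro set_integrable_continuous continuous_intros u S)
  have i2: "set_integrable lborel S (\<lambda>y. \<bar>u y - c\<bar>)"
    by (intro set_integrable_continuous continuous_intros u S)
  have i3: "set_integrable lborel S (\<lambda>y. \<bar>u y - c\<bar> powr p)"
    using p by (intro set_integrable_continuous continuous_on_powr' continuous_intros u S) auto
  have i0: "set_integrable lborel S (\<lambda>y. K)" for K :: real
    by (intro set_integrable_continuous continuous_intros S)
  have const: "(LINT y:S|lborel. K) = V * K" for K :: real
    using S fin by (subst set_lebesgue_integral_def) (simp add: V_def)
  have "(LINT y:S|lborel. u y - c) = (LINT y:S|lborel. u y) - V * c"
    using set_integral_diff(2)[OF set_integrable_continuous[OF u S] i0[of c]] by (simp add: const)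
  also have "\<dots> = V * (set_average S u - c)"
    using V by (simp add: set_average_def V_def[symmetric] field_simps)
  finally have "V * m = \<bar>LINT y:S|lborel. u y - c\<bar>"
    using V by (simp add: m_def abs_mult)
  also have "\<dots> \<le> (LINT y:S|lborel. \<bar>u y - c\<bar>)"
    using set_integral_norm_bound[OF i1] by simp
  finally have "m powr (p - 1) * (V * m) \<le> m powr (p - 1) * (LINT y:S|lborel. \<bar>u y - c\<bar>)"
    by (intro mult_left_mono) auto
  also have "\<dots> = (LINT y:S|lborel. m powr (p - 1) * \<bar>u y - c\<bar>)"
    by simp
  also have "\<dots> \<le> (LINT y:S|lborel. (p - 1) / p * m powr p + \<bar>u y - c\<bar> powr p / p)"
    using p by (intro set_integral_mono powr_young set_integral_add set_integrable_mult_right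
       set_integrable_divide i0 i2 i3) (auto simp: m_def)
  also have "\<dots> = V * ((p - 1) / p * m powr p) + (LINT y:S|lborel. \<bar>u y - c\<bar> powr p) / p"
  proof -
    have "set_integrable lborel S (\<lambda>y. \<bar>u y - c\<bar> powr p / p)"
      by (intro set_integrable_divide i3)
    from set_integral_add(2)[OF i0[of "(p - 1) / p * m powr p"] this] show ?thesis
      by (simp only: const set_integral_divide_zero)
  qed
  finally have "m powr (p - 1) * (V * m)
     \<le> V * ((p - 1) / p * m powr p) + (LINT y:S|lborel. \<bar>u y - c\<bar> powr p) / p" .
  moreover have "m powr (p - 1) * (V * m) = V * m powr p"
    using p by (cases "m = 0") (auto simp: m_def powr_diff)
  ultimately have le: "V * m powr p
     \<le> V * ((p - 1) / p * m powr p) + (LINT y:S|lborel. \<bar>u y - c\<bar> powr p) / p" by simp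
  have "M \<le> J" if "M \<le> (p - 1) / p * M + J / p" for M J :: real
    using that p by (simp add: field_simps)
  from this[of "V * m powr p"] le
  have "V * m powr p \<le> (LINT y:S|lborel. \<bar>u y - c\<bar> powr p)"
    by (simp add: mult.left_commute)
  then have "ennreal (V * m powr p) \<le> ennreal (LINT y:S|lborel. \<bar>u y - c\<bar> powr p)"
    by (rule ennreal_leI)
  also have "\<dots> = (\<integral>\<^sup>+y\<in>S. ennreal (\<bar>u y - c\<bar> powr p) \<partial>lborel)"
  proof -
    have "(\<integral>\<^sup>+y\<in>S. ennreal (\<bar>u y - c\<bar> powr p) \<partial>lborel)
       = (\<integral>\<^sup>+y. ennreal (indicator S y *\<^sub>R \<bar>u y - c\<bar> powr p) \<partial>lborel)"
      by (intro nn_integral_cong) (auto simp: indicator_def)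
    also have "\<dots> = ennreal (LINT y:S|lborel. \<bar>u y - c\<bar> powr p)"
      using i3 unfolding set_integrable_def set_lebesgue_integral_def
      by (intro nn_integral_eq_integral) auto
    finally show ?thesis by simp
  qed
  finally show ?thesis by (simp add: V_def m_def)
qed

section \<open>Differences of averages and the Gagliardo energy\<close>

text \<open>
  The Gagliardo integrand in the critical case \<open>s p = d\<close>, where the exponent \<open>d + s p\<close> is an integer.
\<close>

definition diff_quot :: "real \<Rightarrow> ('a::euclidean_space \<Rightarrow> real) \<Rightarrow> 'a \<Rightarrow> 'a \<Rightarrow> real" where
  "diff_quot p u x y = \<bar>u x - u y\<bar> powr p / norm (x - y) ^ (2 * DIM('a))"

definition local_energy :: "real \<Rightarrow> 'a::euclidean_space set \<Rightarrow> ('a \<Rightarrow> real) \<Rightarrow> 'a \<Rightarrow> ennreal" where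
  "local_energy p \<Omega> u x = (\<integral>\<^sup>+y\<in>\<Omega>. ennreal (diff_quot p u x y) \<partial>lborel)"

definition energy :: "real \<Rightarrow> 'a::euclidean_space set \<Rightarrow> ('a \<Rightarrow> real) \<Rightarrow> ennreal" where
  "energy p \<Omega> u = (\<integral>\<^sup>+x\<in>\<Omega>. local_energy p \<Omega> u x \<partial>lborel)"

lemma continuous_borel_measurable [simp]:
  fixes u :: "'a::euclidean_space \<Rightarrow> real"
  shows "continuous_on UNIV u \<Longrightarrow> u \<in> borel_measurable borel"
  by (rule borel_measurable_continuous_onI)

lemma measurable_local_energy [measurable]:
  fixes u :: "'a::euclidean_space \<Rightarrow> real"
  assumes [measurable]: "u \<in> borel_measurable borel" "\<Omega> \<in> sets borel"
  shows "local_energy p \<Omega> u \<in> borel_measurable borel"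
  unfolding local_energy_def diff_quot_def by measurable

lemma powr_diff_le_diff_quot:
  fixes x y :: "'a::euclidean_space"
  assumes "norm (x - y) \<le> D" "0 < p"
  shows "\<bar>u x - u y\<bar> powr p \<le> D ^ (2 * DIM('a)) * diff_quot p u x y"
proof (cases "x = y")
  case False
  have "norm (x - y) ^ (2 * DIM('a)) \<le> D ^ (2 * DIM('a))"
    using assms by (intro power_mono) auto
  then have "norm (x - y) ^ (2 * DIM('a)) * diff_quot p u x y \<le> D ^ (2 * DIM('a)) * diff_quot p u x y"
    by (intro mult_right_mono) (auto simp: diff_quot_def)
  then show ?thesis using False by (simp add: diff_quot_def)
qed (use assms in \<open>auto simp: diff_quot_def\<close>)

text \<open>
  On a set of points at distance at most \<open>D\<close> from \<open>x\<close> the kernel costs only the factor \<open>D\<close> to the power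
  \<open>2 d\<close>; the rest is Jensen's inequality.
\<close>

lemma point_average_le:
  fixes u :: "'a::euclidean_space \<Rightarrow> real"
  assumes u: "continuous_on UNIV u" and S: "bounded S" "S \<in> sets borel" "S \<subseteq> \<Omega>" "\<Omega> \<in> sets borel"
    and p: "1 < p" and D: "\<And>y. y \<in> S \<Longrightarrow> norm (x - y) \<le> D" "0 \<le> D"
  shows "ennreal (measure lborel S * \<bar>u x - set_average S u\<bar> powr p)
     \<le> ennreal (D ^ (2 * DIM('a))) * local_energy p \<Omega> u x"
proof -
  have [measurable]: "u \<in> borel_measurable borel" "\<Omega> \<in> sets borel" using u S by auto
  have "ennreal (measure lborel S * \<bar>u x - set_average S u\<bar> powr p)
     \<le> (\<integral>\<^sup>+y\<in>S. ennreal (\<bar>u y - u x\<bar> powr p) \<partial>lborel)"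
    using jensen_average[OF u S(1,2) p, of "u x"] by (simp add: abs_minus_commute)
  also have "\<dots> \<le> (\<integral>\<^sup>+y. ennreal (D ^ (2 * DIM('a))) * (ennreal (diff_quot p u x y) * indicator \<Omega> y) \<partial>lborel)"
  proof (rule nn_integral_mono)
    fix y
    show "ennreal (\<bar>u y - u x\<bar> powr p) * indicator S y
       \<le> ennreal (D ^ (2 * DIM('a))) * (ennreal (diff_quot p u x y) * indicator \<Omega> y)"
      using powr_diff_le_diff_quot[of x y D p u] D S p
      by (auto simp: indicator_def abs_minus_commute simp flip: ennreal_mult' intro!: ennreal_leI)
  qed
  also have "\<dots> = ennreal (D ^ (2 * DIM('a))) * local_energy p \<Omega> u x"
    unfolding local_energy_def
    by (subst nn_integral_cmult) (auto simp: diff_quot_def)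
  finally show ?thesis .
qed

text \<open>
  Jensen's inequality twice: first with the average over \<open>T\<close> as the constant, then at each point of \<open>S\<close>.
\<close>

lemma two_averages_le:
  fixes u :: "'a::euclidean_space \<Rightarrow> real"
  assumes u: "continuous_on UNIV u" and S: "bounded S" "S \<in> sets borel"
    and T: "bounded T" "T \<in> sets borel" "T \<subseteq> \<Omega>" "\<Omega> \<in> sets borel"
    and p: "1 < p" and D: "\<And>y z. y \<in> S \<Longrightarrow> z \<in> T \<Longrightarrow> norm (y - z) \<le> D" "0 \<le> D"
  shows "ennreal (measure lborel S * measure lborel T * \<bar>set_average S u - set_average T u\<bar> powr p)
     \<le> ennreal (D ^ (2 * DIM('a))) * (\<integral>\<^sup>+y\<in>S. local_energy p \<Omega> u y \<partial>lborel)"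
proof -
  have [measurable]: "u \<in> borel_measurable borel" "\<Omega> \<in> sets borel" "S \<in> sets borel" using u S T by auto
  have "ennreal (measure lborel S * measure lborel T * \<bar>set_average S u - set_average T u\<bar> powr p)
     = ennreal (measure lborel T) * ennreal (measure lborel S * \<bar>set_average S u - set_average T u\<bar> powr p)"
    by (simp flip: ennreal_mult' add: mult_ac)
  also have "\<dots> \<le> ennreal (measure lborel T) * (\<integral>\<^sup>+y\<in>S. ennreal (\<bar>u y - set_average T u\<bar> powr p) \<partial>lborel)"
    by (intro mult_left_mono jensen_average u S p) auto
  also have "\<dots> = (\<integral>\<^sup>+y. ennreal (measure lborel T) * (ennreal (\<bar>u y - set_average T u\<bar> powr p) * indicator S y) \<partial>lborel)"
    by (intro nn_integral_cmult[symmetric]) auto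
  also have "\<dots> \<le> (\<integral>\<^sup>+y. ennreal (D ^ (2 * DIM('a))) * (local_energy p \<Omega> u y * indicator S y) \<partial>lborel)"
  proof (rule nn_integral_mono)
    fix y
    show "ennreal (measure lborel T) * (ennreal (\<bar>u y - set_average T u\<bar> powr p) * indicator S y)
       \<le> ennreal (D ^ (2 * DIM('a))) * (local_energy p \<Omega> u y * indicator S y)"
      using point_average_le[OF u T p, of y D] D
      by (cases "y \<in> S") (auto simp flip: ennreal_mult')
  qed
  also have "\<dots> = ennreal (D ^ (2 * DIM('a))) * (\<integral>\<^sup>+y\<in>S. local_energy p \<Omega> u y \<partial>lborel)"
    by (intro nn_integral_cmult) auto
  finally show ?thesis .
qed

text \<open>
  Disjoint shells rather than balls, so that the contributions of the different scales to the energy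
  do not overlap.
\<close>

definition shell :: "'a::euclidean_space \<Rightarrow> real \<Rightarrow> 'a set" where
  "shell x r = ball x r - ball x (r / 2)"

lemma shell_sets [measurable, simp]: "shell x r \<in> sets borel"
  by (simp add: shell_def)

lemma bounded_shell [simp]: "bounded (shell x r)"
  unfolding shell_def by (rule bounded_subset[OF bounded_ball[of x r]]) auto

lemma measure_shell_ge:
  fixes x :: "'a::euclidean_space"
  assumes "0 \<le> r"
  shows "unit_ball_vol (DIM('a)) / 2 * r ^ DIM('a) \<le> measure lborel (shell x r)"
proof -
  have "measure lborel (shell x r) = measure lborel (ball x r) - measure lborel (ball x (r / 2))"
    unfolding shell_def using assms emeasure_lborel_ball_finite[of x r]
    by (intro measure_Diff) auto
  also have "\<dots> = unit_ball_vol (DIM('a)) * (r ^ DIM('a) * (1 - (1/2) ^ DIM('a)))"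
    using assms by (simp add: content_ball power_divide field_simps)
  also have "(1/2) ^ DIM('a) \<le> (1/2 :: real) ^ 1"
    by (intro power_decreasing) auto
  then have "unit_ball_vol (DIM('a)) * (r ^ DIM('a) * (1 - (1/2) ^ DIM('a)))
      \<ge> unit_ball_vol (DIM('a)) * (r ^ DIM('a) * (1/2))"
    using assms by (intro mult_left_mono) auto
  finally show ?thesis by simp
qed

lemma disjoint_family_shells:
  fixes x :: "'a::euclidean_space"
  assumes "0 < r"
  shows "disjoint_family (\<lambda>j. shell x (r / 2 ^ j))"
proof -
  have "shell x (r / 2 ^ i) \<inter> shell x (r / 2 ^ j) = {}" if "i < j" for i j :: nat
  proof -
    have "r / 2 ^ j \<le> r / 2 ^ Suc i"
      using assms that by (intro divide_left_mono power_increasing) auto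
    then show ?thesis by (auto simp: shell_def)
  qed
  then show ?thesis unfolding disjoint_family_on_def
    by (metis Int_commute linorder_neqE_nat)
qed

text \<open>
  Clears a common positive factor, typically a product of measures of shells.
\<close>

lemma ennreal_scale_le:
  assumes "0 < K" "0 \<le> c" "ennreal (K * t) \<le> ennreal (K * c) * Z"
  shows "ennreal t \<le> ennreal c * Z"
proof -
  have "ennreal K * ennreal t \<le> ennreal K * (ennreal c * Z)"
    using assms by (simp add: ennreal_mult' mult.assoc)
  then show ?thesis
    using assms(1) by (subst (asm) ennreal_mult_le_mult_iff) auto
qed

text \<open>
  Disjointness makes the energies of the different scales add up to at most the total
  energy. This is the source of the exponent \<open>p'\<close>: without it each step would only be bounded by the
  energy, and \<open>k\<close> steps would cost \<open>k\<close> instead of \<open>k powr (1 / p')\<close>.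
\<close>

lemma disjoint_energy_sum_le:
  fixes u :: "'a::euclidean_space \<Rightarrow> real" and A :: "nat \<Rightarrow> 'a set"
  assumes u: "continuous_on UNIV u" and \<Omega>: "\<Omega> \<in> sets borel"
    and A: "disjoint_family A" "\<And>j. A j \<in> sets borel" "\<And>j. A j \<subseteq> \<Omega>"
  shows "(\<Sum>j<k. \<integral>\<^sup>+y\<in>A j. local_energy p \<Omega> u y \<partial>lborel) \<le> energy p \<Omega> u"
proof -
  have [measurable]: "u \<in> borel_measurable borel" "\<Omega> \<in> sets borel" "\<And>j. A j \<in> sets borel"
    using u \<Omega> A by auto
  have "(\<Sum>j<k. \<integral>\<^sup>+y\<in>A j. local_energy p \<Omega> u y \<partial>lborel)
      = (\<integral>\<^sup>+y. (\<Sum>j<k. local_energy p \<Omega> u y * indicator (A j) y) \<partial>lborel)"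
    by (subst nn_integral_sum) auto
  also have "\<dots> \<le> energy p \<Omega> u"
    unfolding energy_def
  proof (intro nn_integral_mono)
    fix y
    have "(\<Sum>j<k. indicator (A j) y :: ennreal) \<le> (\<Sum>j. indicator (A j) y)"
      by (intro sum_le_suminf) auto
    also have "\<dots> = indicator (\<Union>j. A j) y" using A(1) by (rule suminf_indicator)
    also have "\<dots> \<le> indicator \<Omega> y" using A(3) by (auto simp: indicator_def)
    finally show "(\<Sum>j<k. local_energy p \<Omega> u y * indicator (A j) y) \<le> local_energy p \<Omega> u y * indicator \<Omega> y"
      unfolding sum_distrib_left[symmetric] by (intro mult_left_mono) auto
  qed
  finally show ?thesis .
qed

text \<open>
  The \<open>p\<close>-th power of a step between consecutive shells is at most a multiple of the local energy integrated
  over one shell, with a constant that does not depend on the scale because \<open>s p = d\<close> is the scaling invariant case. The disjointness of the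
  shells and Jensen's inequality for sums do the rest.
\<close>

lemma chain_bound:
  fixes u :: "'a::euclidean_space \<Rightarrow> real" and x :: 'a
  defines "V \<equiv> unit_ball_vol (DIM('a))"
  assumes u: "continuous_on UNIV u" and \<Omega>: "\<Omega> \<in> sets borel" "ball x r \<subseteq> \<Omega>" and r: "0 < r"
    and p: "1 < p" and I: "energy p \<Omega> u \<le> ennreal I" "0 \<le> I"
  shows "\<bar>set_average (shell x r) u - set_average (shell x (r / 2 ^ k)) u\<bar> powr p
    \<le> real k powr (p - 1) * (4 * 8 ^ DIM('a) / V\<^sup>2 * I)"
proof (cases "k = 0")
  case False
  have [measurable]: "u \<in> borel_measurable borel" "\<Omega> \<in> sets borel" using u \<Omega> by auto
  have V: "V > 0" by (simp add: V_def)
  define A where "A j = shell x (r / 2 ^ j)" for j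
  define a where "a j = set_average (A j) u" for j
  define C where "C = 4 * 8 ^ DIM('a) / V\<^sup>2"
  have A: "A j \<subseteq> \<Omega>" "bounded (A j)" "A j \<in> sets borel" for j
  proof -
    have "r / 2 ^ j \<le> r / 1" using r by (intro divide_left_mono) auto
    then show "A j \<subseteq> \<Omega>" using \<Omega> by (auto simp: A_def shell_def)
  qed (auto simp: A_def)
  note [measurable] = A(3)
  have C0: "C \<ge> 0" by (simp add: C_def)
  have step: "ennreal (\<bar>a j - a (Suc j)\<bar> powr p)
      \<le> ennreal C * (\<integral>\<^sup>+y\<in>A j. local_energy p \<Omega> u y \<partial>lborel)" for j
  proof -
    define q where "q = r / 2 ^ j"
    have q: "q > 0" using r by (simp add: q_def)
    define J where "J = (\<integral>\<^sup>+y\<in>A j. local_energy p \<Omega> u y \<partial>lborel)"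
    define t where "t = \<bar>a j - a (Suc j)\<bar> powr p"
    define K where "K = V / 2 * q ^ DIM('a) * (V / 2 * (q / 2) ^ DIM('a))"
    have K: "K > 0" using V q by (simp add: K_def)
    have "ennreal (measure lborel (A j) * measure lborel (A (Suc j)) * t)
      \<le> ennreal ((2 * q) ^ (2 * DIM('a))) * J"
      unfolding t_def a_def J_def
    proof (intro two_averages_le u A \<Omega> p)
      fix y z assume "y \<in> A j" "z \<in> A (Suc j)"
      then have "dist x y < q" "dist x z < q / 2"
        by (auto simp: A_def shell_def q_def field_simps)
      then show "norm (y - z) \<le> 2 * q"
        using dist_triangle[of y z x] q by (simp add: dist_norm norm_minus_commute)
    qed (use q in auto)
    moreover have "K * t \<le> measure lborel (A j) * measure lborel (A (Suc j)) * t"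
      unfolding K_def A_def using q measure_shell_ge[of q x] measure_shell_ge[of "q/2" x]
      by (intro mult_right_mono mult_mono) (auto simp: V_def q_def t_def field_simps)
    ultimately have 1: "ennreal (K * t) \<le> ennreal ((2 * q) ^ (2 * DIM('a))) * J"
      using order_trans[OF ennreal_leI] by blast
    have e: "(2 * q) ^ (2 * DIM('a)) = K * C"
    proof -
      have "(2 * q) ^ (2 * DIM('a)) = 4 ^ DIM('a) * (q ^ DIM('a) * q ^ DIM('a))"
        by (simp add: power_mult power_mult_distrib power2_eq_square)
      moreover have "(8::real) ^ DIM('a) = 4 ^ DIM('a) * 2 ^ DIM('a)"
        by (simp flip: power_mult_distrib)
      moreover have "V / 2 * Q * (V / 2 * (Q / W)) * (4 * (F * W) / V\<^sup>2) = F * (Q * Q)"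
        if "W \<noteq> 0" for Q W F :: real
        using V that by (simp add: power2_eq_square)
      moreover note this[of "2 ^ DIM('a)" "q ^ DIM('a)" "4 ^ DIM('a)"]
      ultimately show ?thesis unfolding K_def C_def power_divide by simp
    qed
    show ?thesis
      using ennreal_scale_le[OF K C0 1[unfolded e]] by (simp add: t_def J_def)
  qed
  have "ennreal (\<Sum>j<k. \<bar>a j - a (Suc j)\<bar> powr p) = (\<Sum>j<k. ennreal (\<bar>a j - a (Suc j)\<bar> powr p))"
    by (simp add: sum_ennreal)
  also have "\<dots> \<le> (\<Sum>j<k. ennreal C * (\<integral>\<^sup>+y\<in>A j. local_energy p \<Omega> u y \<partial>lborel))"
    by (intro sum_mono step)
  also have "\<dots> \<le> ennreal C * energy p \<Omega> u"
    unfolding sum_distrib_left[symmetric] A_def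
    by (intro mult_left_mono disjoint_energy_sum_le u \<Omega> disjoint_family_shells r)
       (use A in \<open>auto simp: A_def\<close>)
  also have "\<dots> \<le> ennreal (C * I)"
    using I C0 by (simp add: ennreal_mult mult_left_mono)
  finally have sum: "(\<Sum>j<k. \<bar>a j - a (Suc j)\<bar> powr p) \<le> C * I"
    using I C0 by (subst (asm) ennreal_le_iff) auto
  have "a 0 - a k = (\<Sum>j<k. a j - a (Suc j))"
    by (simp add: sum_lessThan_telescope')
  then have "\<bar>a 0 - a k\<bar> \<le> (\<Sum>j<k. \<bar>a j - a (Suc j)\<bar>)" by simp
  then have "\<bar>a 0 - a k\<bar> powr p \<le> (\<Sum>j<k. \<bar>a j - a (Suc j)\<bar>) powr p"
    using p by (intro powr_mono2) auto
  also have "\<dots> \<le> real k powr (p - 1) * (\<Sum>j<k. \<bar>a j - a (Suc j)\<bar> powr p)"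
    using p False by (intro sum_powr_le) auto
  also have "\<dots> \<le> real k powr (p - 1) * (C * I)" using sum by (intro mult_left_mono) auto
  finally show ?thesis by (simp add: a_def A_def C_def)
qed (use p I in \<open>auto simp: zero_le_mult_iff\<close>)

lemma tail_bound:
  fixes u :: "'a::euclidean_space \<Rightarrow> real" and x :: 'a
  defines "V \<equiv> unit_ball_vol (DIM('a))"
  assumes u: "continuous_on UNIV u" and \<Omega>: "\<Omega> \<in> sets borel" "ball x r \<subseteq> \<Omega>" and r: "0 < r"
    and p: "1 < p"
  shows "ennreal (\<bar>u x - set_average (shell x r) u\<bar> powr p)
    \<le> ennreal (2 / V * r ^ DIM('a)) * local_energy p \<Omega> u x"
proof -
  have V: "V > 0" by (simp add: V_def)
  define K where "K = V / 2 * r ^ DIM('a)"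
  have K: "K > 0" using V r by (simp add: K_def)
  define t where "t = \<bar>u x - set_average (shell x r) u\<bar> powr p"
  have "ennreal (measure lborel (shell x r) * t) \<le> ennreal (r ^ (2 * DIM('a))) * local_energy p \<Omega> u x"
    unfolding t_def using \<Omega> r
    by (intro point_average_le u p) (auto simp: shell_def dist_norm)
  moreover have "K * t \<le> measure lborel (shell x r) * t"
    unfolding K_def t_def V_def using r by (intro mult_right_mono measure_shell_ge) auto
  ultimately have "ennreal (K * t) \<le> ennreal (r ^ (2 * DIM('a))) * local_energy p \<Omega> u x"
    using order_trans[OF ennreal_leI] by blast
  also have "r ^ (2 * DIM('a)) = K * (2 / V * r ^ DIM('a))"
    using V by (simp add: K_def power_mult power2_eq_square power_mult_distrib)
  finally have "ennreal (K * t) \<le> ennreal (K * (2 / V * r ^ DIM('a))) * local_energy p \<Omega> u x" .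
  from ennreal_scale_le[OF K _ this] show ?thesis
    using V r by (simp add: t_def)
qed

section \<open>The pointwise exponential bound\<close>

text \<open>
  For \<open>X \<le> 2 B\<close> the exponential is bounded. Otherwise choose \<open>k\<close> such that
  \<open>k + 1 < (X / (2 B)) powr p' \<le> k + 2\<close>. Then the first term of the decomposition at scale \<open>k\<close> is at most
  \<open>X / 2\<close>, so that \<open>X \<le> 2 T\<close>, and \<open>T powr p \<le> Y / 2 ^ k\<close>, while the smallness condition bounds the exponential by
  \<open>2 ^ (k + 2)\<close>: the two powers of \<open>2\<close> cancel.
\<close>

lemma Phi_le_of_scales:
  fixes X B Y \<alpha> p :: real
  assumes p: "1 < p" and m: "real m \<ge> p - 1" "p - 1 > real m - 1"
    and nn: "0 \<le> X" "0 < B" "0 \<le> Y" "0 \<le> \<alpha>"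
    and small: "2 * \<alpha> * (2 * B) powr (p / (p - 1)) \<le> ln 2"
    and scales: "\<And>k::nat. \<exists>T\<ge>0. X \<le> (real k + 1) powr ((p - 1) / p) * B + T \<and> T powr p \<le> Y / 2 ^ k"
  shows "Phi m (\<alpha> * X powr (p / (p - 1))) \<le> 4 * 2 powr p * \<alpha> powr (p - 1) * (X powr p + Y)"
proof -
  define q where "q = (X / (2 * B)) powr (p / (p - 1))"
  define t where "t = \<alpha> * X powr (p / (p - 1))"
  have q0: "q \<ge> 0" by (simp add: q_def)
  have Xq: "X powr (p / (p - 1)) = (2 * B) powr (p / (p - 1)) * q"
    using nn by (simp add: q_def powr_divide)
  have X: "X = 2 * B * q powr ((p - 1) / p)"
    using nn p by (simp add: q_def powr_powr)
  have tq: "2 * t \<le> ln 2 * q"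
    using mult_right_mono[OF small q0] by (simp add: t_def Xq mult_ac)
  have "Phi m t \<le> t powr (p - 1) * exp (2 * t)"
    using p m nn by (intro Phi_le_powr_exp) (auto simp: t_def)
  also have "t powr (p - 1) = \<alpha> powr (p - 1) * X powr p"
    using nn p by (simp add: t_def powr_mult powr_powr)
  also have "exp (2 * t) \<le> exp (ln 2 * q)" using tq by simp
  also have "exp (ln 2 * q) = 2 powr q" by (simp add: powr_def mult.commute)
  finally have Phi: "Phi m t \<le> \<alpha> powr (p - 1) * (X powr p * 2 powr q)"
    by (simp add: mult_left_mono mult.assoc)
  have "X powr p * 2 powr q \<le> 4 * 2 powr p * (X powr p + Y)"
  proof (cases "q \<le> 1")
    case True
    have "2 powr q \<le> 2 powr (1::real)" using True by (intro powr_mono) auto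
    also have "\<dots> \<le> 2 powr 2 * 2 powr p" unfolding powr_add[symmetric] using p by (intro powr_mono) auto
    finally have "X powr p * 2 powr q \<le> X powr p * (4 * 2 powr p)"
      by (intro mult_left_mono) auto
    also have "\<dots> \<le> (X powr p + Y) * (4 * 2 powr p)" using nn by (intro mult_right_mono) auto
    finally show ?thesis by (simp add: mult_ac)
  next
    case False
    define n where "n = nat \<lceil>q\<rceil>"
    have "\<lceil>q\<rceil> \<ge> 2" using False by linarith
    then obtain k where k: "n = k + 2" unfolding n_def
      by (metis add.commute le_Suc_ex nat_le_iff nat_numeral nat_mono)
    have nq: "q \<le> k + 2" "k + 1 < q"
    proof -
      have "real n = of_int \<lceil>q\<rceil>" using \<open>\<lceil>q\<rceil> \<ge> 2\<close> by (simp add: n_def)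
      then show "q \<le> k + 2" "k + 1 < q" using k by linarith+
    qed
    obtain T where T: "T \<ge> 0" "X \<le> (real k + 1) powr ((p - 1) / p) * B + T" "T powr p \<le> Y / 2 ^ k"
      using scales by blast
    have "(real k + 1) powr ((p - 1) / p) \<le> q powr ((p - 1) / p)"
      using nq p by (intro powr_mono2) auto
    then have "(real k + 1) powr ((p - 1) / p) * B \<le> X / 2"
      using nn by (subst X) (simp add: mult_ac)
    then have "X \<le> 2 * T" using T by linarith
    then have "X powr p \<le> (2 * T) powr p" using nn p by (intro powr_mono2) auto
    also have "\<dots> = 2 powr p * T powr p" using T by (simp add: powr_mult)
    also have "\<dots> \<le> 2 powr p * (Y / 2 ^ k)" using T by (intro mult_left_mono) auto
    finally have 1: "X powr p \<le> 2 powr p * (Y / 2 ^ k)" .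
    have "2 powr q \<le> 2 powr real (k + 2)" using nq by (intro powr_mono) auto
    also have "\<dots> = 4 * 2 ^ k" by (subst powr_realpow) auto
    finally have "X powr p * 2 powr q \<le> 2 powr p * (Y / 2 ^ k) * (4 * 2 ^ k)"
      using 1 nn by (intro mult_mono) auto
    also have "\<dots> = 4 * 2 powr p * Y" by simp
    also have "\<dots> \<le> 4 * 2 powr p * (X powr p + Y)" by (intro mult_left_mono) auto
    finally show ?thesis .
  qed
  from mult_left_mono[OF this, of "\<alpha> powr (p - 1)"] Phi
  show ?thesis by (simp add: t_def mult_ac)
qed

lemma bdry_dist_lipschitz: "bdry_dist \<Omega> x \<le> bdry_dist \<Omega> y + dist x y"
  by (simp add: bdry_dist_def infdist_triangle)

lemma bdry_dist_nonneg [simp]: "0 \<le> bdry_dist \<Omega> x"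
  by (simp add: bdry_dist_def infdist_nonneg)

lemma continuous_on_bdry_dist: "continuous_on A (bdry_dist \<Omega>)"
  unfolding bdry_dist_def by (intro continuous_intros)

lemma measurable_bdry_dist [measurable]: "bdry_dist \<Omega> \<in> borel_measurable borel"
  by (intro borel_measurable_continuous_onI continuous_on_bdry_dist)

lemma bdry_dist_pos:
  assumes "open \<Omega>" "frontier \<Omega> \<noteq> {}" "x \<in> \<Omega>"
  shows "0 < bdry_dist \<Omega> x"
proof -
  have "x \<notin> frontier \<Omega>" using assms by (auto simp: frontier_def interior_open)
  then show ?thesis unfolding bdry_dist_def
    using assms by (intro infdist_pos_not_in_closed) auto
qed

text \<open>
  Otherwise the ball, being connected, would meet the frontier.
\<close>

lemma ball_bdry_dist_subset:
  fixes \<Omega> :: "'a::euclidean_space set"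
  assumes "x \<in> \<Omega>"
  shows "ball x (bdry_dist \<Omega> x) \<subseteq> \<Omega>"
proof (rule ccontr)
  assume *: "\<not> ball x (bdry_dist \<Omega> x) \<subseteq> \<Omega>"
  then have "0 < bdry_dist \<Omega> x" by (cases "bdry_dist \<Omega> x = 0") (auto simp: less_le)
  then have "x \<in> ball x (bdry_dist \<Omega> x) \<inter> \<Omega>" using assms by simp
  then obtain z where "z \<in> ball x (bdry_dist \<Omega> x)" "z \<in> frontier \<Omega>"
    using connected_Int_frontier[of "ball x (bdry_dist \<Omega> x)" \<Omega>] * by fastforce
  then show False using infdist_le[of z "frontier \<Omega>" x] by (simp add: bdry_dist_def)
qed

text \<open>
  The Hardy integral also controls the average over the outermost shell: on that shell \<open>\<delta>\<close> and \<open>w\<close> are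
  comparable with their values at \<open>x\<close>, and the volume of the shell cancels the weight \<open>1 / \<delta>\<^sup>d\<close>. So the
  first average of the chain deviates from \<open>c\<close> by at most a multiple of \<open>w x\<close>, uniformly in \<open>x\<close>.
\<close>

lemma weighted_average_bound:
  fixes u :: "'a::euclidean_space \<Rightarrow> real" and x :: 'a
  defines "V \<equiv> unit_ball_vol (DIM('a))"
  assumes u: "continuous_on UNIV u" and \<Omega>: "open \<Omega>" "frontier \<Omega> \<noteq> {}" and x: "x \<in> \<Omega>"
    and p: "1 < p" and w: "\<And>y. y \<in> \<Omega> \<Longrightarrow> 0 < w y" "\<And>y. dist x y < bdry_dist \<Omega> x / 2 \<Longrightarrow> w y \<le> 2 * w x"
    and H: "(\<integral>\<^sup>+y\<in>\<Omega>. ennreal ((\<bar>u y - c\<bar> / w y) powr p / bdry_dist \<Omega> y ^ DIM('a)) \<partial>lborel) \<le> ennreal H" "0 \<le> H"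
    and wm [measurable]: "w \<in> borel_measurable borel"
  shows "(\<bar>set_average (shell x (bdry_dist \<Omega> x / 2)) u - c\<bar> / w x) powr p
     \<le> 2 * 4 ^ DIM('a) * 2 powr p / V * H"
proof -
  define \<delta> where "\<delta> = bdry_dist \<Omega> x"
  define A where "A = shell x (\<delta> / 2)"
  define a where "a = \<bar>set_average A u - c\<bar> powr p"
  define K where "K = (2 * w x) powr p * (2 * \<delta>) ^ DIM('a)"
  have \<delta>: "\<delta> > 0" using \<Omega> x bdry_dist_pos by (auto simp: \<delta>_def)
  have wx: "w x > 0" using w x by auto
  have V: "V > 0" by (simp add: V_def)
  have [measurable]: "u \<in> borel_measurable borel" "A \<in> sets borel" "\<Omega> \<in> sets borel"
    using u \<Omega> by (auto simp: A_def)
  have "ennreal (measure lborel A * a) \<le> (\<integral>\<^sup>+y\<in>A. ennreal (\<bar>u y - c\<bar> powr p) \<partial>lborel)"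
    unfolding a_def by (intro jensen_average u p) (auto simp: A_def)
  also have "\<dots> \<le> (\<integral>\<^sup>+y. ennreal K *
      (ennreal ((\<bar>u y - c\<bar> / w y) powr p / bdry_dist \<Omega> y ^ DIM('a)) * indicator \<Omega> y) \<partial>lborel)"
  proof (rule nn_integral_mono)
    fix y
    have "\<bar>u y - c\<bar> powr p \<le> K * ((\<bar>u y - c\<bar> / w y) powr p / bdry_dist \<Omega> y ^ DIM('a))" and "y \<in> \<Omega>" if "y \<in> A"
    proof -
      have d: "dist x y < \<delta> / 2" using that by (simp add: A_def shell_def)
      then show "y \<in> \<Omega>" using ball_bdry_dist_subset[OF x] \<delta> by (auto simp: \<delta>_def)
      then have pos: "bdry_dist \<Omega> y > 0" "w y > 0" using bdry_dist_pos \<Omega> w by auto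
      have "bdry_dist \<Omega> y \<le> 2 * \<delta>"
        using bdry_dist_lipschitz[of \<Omega> y x] d \<delta> by (simp add: \<delta>_def dist_commute)
      then have 1: "bdry_dist \<Omega> y ^ DIM('a) \<le> (2 * \<delta>) ^ DIM('a)" by (intro power_mono) auto
      have 2: "w y powr p \<le> (2 * w x) powr p" using w(2) d pos p by (intro powr_mono2) (auto simp: \<delta>_def)
      have "w y powr p * bdry_dist \<Omega> y ^ DIM('a) * ((\<bar>u y - c\<bar> / w y) powr p / bdry_dist \<Omega> y ^ DIM('a))
         \<le> K * ((\<bar>u y - c\<bar> / w y) powr p / bdry_dist \<Omega> y ^ DIM('a))"
        unfolding K_def using 1 2 by (intro mult_right_mono mult_mono) auto
      then show "\<bar>u y - c\<bar> powr p \<le> K * ((\<bar>u y - c\<bar> / w y) powr p / bdry_dist \<Omega> y ^ DIM('a))"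
        using pos by (simp add: powr_divide)
    qed
    then show "ennreal (\<bar>u y - c\<bar> powr p) * indicator A y \<le> ennreal K *
      (ennreal ((\<bar>u y - c\<bar> / w y) powr p / bdry_dist \<Omega> y ^ DIM('a)) * indicator \<Omega> y)"
      by (cases "y \<in> A") (auto simp flip: ennreal_mult'' intro!: ennreal_leI)
  qed
  also have "\<dots> = ennreal K * (\<integral>\<^sup>+y\<in>\<Omega>. ennreal ((\<bar>u y - c\<bar> / w y) powr p / bdry_dist \<Omega> y ^ DIM('a)) \<partial>lborel)"
    by (intro nn_integral_cmult) auto
  also have "\<dots> \<le> ennreal K * ennreal H" by (intro mult_left_mono H) auto
  also have "\<dots> = ennreal (K * H)" using H by (simp add: ennreal_mult'')
  finally have "measure lborel A * a \<le> K * H"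
    using H \<delta> wx by (subst (asm) ennreal_le_iff) (auto simp: K_def)
  moreover have "V / 2 * (\<delta> / 2) ^ DIM('a) * a \<le> measure lborel A * a"
    unfolding A_def V_def using \<delta> by (intro mult_right_mono measure_shell_ge) (auto simp: a_def)
  ultimately have le: "V / 2 * (\<delta> / 2) ^ DIM('a) * a \<le> K * H" by linarith
  have K: "K = 2 powr p * w x powr p * (4 ^ DIM('a) * (\<delta> / 2) ^ DIM('a))"
  proof -
    have "(2 * \<delta>) ^ DIM('a) = (4 * (\<delta> / 2)) ^ DIM('a)" by simp
    also have "\<dots> = 4 ^ DIM('a) * (\<delta> / 2) ^ DIM('a)" by (rule power_mult_distrib)
    finally show ?thesis using wx by (simp add: K_def powr_mult)
  qed
  have pos: "(\<delta> / 2) ^ DIM('a) > 0" "w x powr p > 0" using \<delta> wx by auto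
  have "a / W \<le> 2 * F * P / V * H" if "V / 2 * E * a \<le> P * W * (F * E) * H" "E > 0" "W > 0" for E W P F :: real
    using that V by (simp add: field_simps)
  from this[OF le[unfolded K] pos] show ?thesis
    using wx by (simp add: powr_divide a_def A_def \<delta>_def)
qed

text \<open>
  The decomposition at scale \<open>k\<close> consists of the distance of the first average from \<open>c\<close> (the hypothesis
  on \<open>A\<close>), the chain of \<open>k\<close> steps (the constant \<open>C\<close>), and the distance of \<open>u x\<close> from the last average,
  which plays the role of \<open>T\<close>.
\<close>

lemma pointwise_exponential_bound:
  fixes u :: "'a::euclidean_space \<Rightarrow> real" and x :: 'a and w :: "'a \<Rightarrow> real"
  defines "V \<equiv> unit_ball_vol (DIM('a))"
  assumes u: "continuous_on UNIV u" and \<Omega>: "open \<Omega>" "frontier \<Omega> \<noteq> {}" and x: "x \<in> \<Omega>"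
    and p: "1 < p" and m: "real m \<ge> p - 1" "p - 1 > real m - 1" and \<alpha>: "0 < \<alpha>"
    and w: "0 < w0" "w0 \<le> w x"
    and I: "energy p \<Omega> u \<le> ennreal I" "0 < I"
    and h: "(\<bar>set_average (shell x (bdry_dist \<Omega> x / 2)) u - c\<bar> / w x) powr p \<le> A * I" "0 \<le> A"
    and C: "4 * 8 ^ DIM('a) / V\<^sup>2 / w0 powr p = C"
    and small: "2 * \<alpha> * (2 * ((A * I) powr (1 / p) + (C * I) powr (1 / p))) powr (p / (p - 1)) \<le> ln 2"
  shows "ennreal (Phi m (\<alpha> * (\<bar>u x - c\<bar> / w x) powr (p / (p - 1))) / bdry_dist \<Omega> x ^ DIM('a))
    \<le> ennreal (4 * 2 powr p * \<alpha> powr (p - 1)) *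
       (ennreal ((\<bar>u x - c\<bar> / w x) powr p / bdry_dist \<Omega> x ^ DIM('a))
        + ennreal (2 / V / w0 powr p) * local_energy p \<Omega> u x)"
proof (cases "local_energy p \<Omega> u x = \<infinity>")
  case True
  have inf: "ennreal K * \<infinity> = \<infinity>" if "K > 0" for K
    using that by (simp add: ennreal_mult_eq_top_iff)
  have K2: "ennreal (2 / V / w0 powr p) * \<infinity> = \<infinity>"
    by (rule inf) (use w in \<open>auto simp: V_def intro!: divide_pos_pos\<close>)
  have K1: "ennreal (4 * 2 powr p * \<alpha> powr (p - 1)) * \<infinity> = \<infinity>"
    by (rule inf) (use \<alpha> in auto)
  show ?thesis unfolding True K2
    by (simp only: infinity_ennreal_def add_top_right_ennreal K1[unfolded infinity_ennreal_def] top_greatest)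
next
  case False
  define \<delta> where "\<delta> = bdry_dist \<Omega> x"
  define r where "r = \<delta> / 2"
  define a where "a k = set_average (shell x (r / 2 ^ k)) u" for k :: nat
  have \<delta>: "\<delta> > 0" using bdry_dist_pos[OF \<Omega> x] by (simp add: \<delta>_def)
  then have r: "r > 0" by (simp add: r_def)
  have V: "V > 0" by (simp add: V_def)
  have wx: "w x > 0" using w by linarith
  have C0: "C > 0" using V w by (simp add: C[symmetric])
  have \<Omega>b: "\<Omega> \<in> sets borel" using \<Omega> by auto
  have sub: "ball x (r / 2 ^ k) \<subseteq> \<Omega>" for k
  proof -
    have "r / 2 ^ k \<le> r / 1" using r by (intro divide_left_mono) auto
    then have "ball x (r / 2 ^ k) \<subseteq> ball x \<delta>" using r by (intro subset_ball) (simp add: r_def)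
    then show ?thesis using ball_bdry_dist_subset[OF x] by (simp add: \<delta>_def)
  qed
  define X where "X = \<bar>u x - c\<bar> / w x"
  define B where "B = (A * I) powr (1 / p) + (C * I) powr (1 / p)"
  have B: "B > 0" unfolding B_def using C0 I by (intro add_nonneg_pos) auto
  show ?thesis
  proof -
    obtain g where g: "local_energy p \<Omega> u x = ennreal g" "g \<ge> 0"
      using False by (cases "local_energy p \<Omega> u x") auto
    define Y where "Y = 2 / V / w0 powr p * r ^ DIM('a) * g"
    have "Phi m (\<alpha> * X powr (p / (p - 1))) \<le> 4 * 2 powr p * \<alpha> powr (p - 1) * (X powr p + Y)"
    proof (rule Phi_le_of_scales[OF p m _ B _ less_imp_le[OF \<alpha>]])
      show "2 * \<alpha> * (2 * B) powr (p / (p - 1)) \<le> ln 2" using small by (simp add: B_def)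
      show "0 \<le> X" using wx by (simp add: X_def)
      show "0 \<le> Y" using V r g by (simp add: Y_def)
      fix k :: nat
      define T where "T = \<bar>u x - a k\<bar> / w x"
      define h where "h = \<bar>a 0 - c\<bar> / w x"
      define b where "b = \<bar>a 0 - a k\<bar> / w x"
      have nn: "0 \<le> T" "0 \<le> h" "0 \<le> b" using wx by (auto simp: T_def h_def b_def)
      have "\<bar>u x - c\<bar> \<le> \<bar>a 0 - c\<bar> + \<bar>a 0 - a k\<bar> + \<bar>u x - a k\<bar>" by linarith
      then have X: "X \<le> h + b + T"
        unfolding X_def h_def b_def T_def add_divide_distrib[symmetric] using wx
        by (intro divide_right_mono) auto
      have root: "y \<le> z powr (1 / p)" if "y powr p \<le> z" "0 \<le> y" for y z :: real
        using powr_mono2[OF _ _ that(1), of "1 / p"] that p by (simp add: powr_powr)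
      have hb: "h \<le> (A * I) powr (1 / p)"
        using h(1) nn by (intro root) (auto simp: h_def a_def r_def \<delta>_def)
      have div: "(y / w x) powr p \<le> y powr p / w0 powr p" if "0 \<le> y" for y
        using that w wx p by (simp add: powr_divide) (intro divide_left_mono powr_mono2, auto)
      have "b powr p \<le> \<bar>a 0 - a k\<bar> powr p / w0 powr p" unfolding b_def by (intro div) auto
      also have "\<bar>a 0 - a k\<bar> powr p \<le> real k powr (p - 1) * (4 * 8 ^ DIM('a) / V\<^sup>2 * I)"
        using chain_bound[OF u \<Omega>b _ r p I(1), of x k] sub[of 0] I by (simp add: a_def V_def)
      finally have "b powr p \<le> real k powr (p - 1) * (C * I)"
        using w by (simp add: C[symmetric] divide_right_mono)
      also have "\<dots> = (real k powr ((p - 1) / p) * (C * I) powr (1 / p)) powr p"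
        using p C0 I by (simp add: powr_mult powr_powr)
      finally have "b powr p \<le> (real k powr ((p - 1) / p) * (C * I) powr (1 / p)) powr p" .
      from root[OF this nn(3)] have "b \<le> real k powr ((p - 1) / p) * (C * I) powr (1 / p)"
        using p by (simp add: powr_powr)
      also have "\<dots> \<le> (real k + 1) powr ((p - 1) / p) * (C * I) powr (1 / p)"
        using p by (intro mult_right_mono powr_mono2) auto
      finally have bb: "b \<le> (real k + 1) powr ((p - 1) / p) * (C * I) powr (1 / p)" .
      have "1 \<le> (real k + 1) powr ((p - 1) / p)" using p by (intro ge_one_powr_ge_zero) auto
      from mult_right_mono[OF this, of "(A * I) powr (1 / p)"] hb
      have "h \<le> (real k + 1) powr ((p - 1) / p) * (A * I) powr (1 / p)" by simp
      then have 1: "X \<le> (real k + 1) powr ((p - 1) / p) * B + T"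
        using X bb by (simp add: B_def algebra_simps)
      have "T powr p \<le> \<bar>u x - a k\<bar> powr p / w0 powr p" unfolding T_def by (intro div) auto
      also have "\<bar>u x - a k\<bar> powr p \<le> 2 / V * (r / 2 ^ k) ^ DIM('a) * g"
      proof -
        have "ennreal (\<bar>u x - a k\<bar> powr p) \<le> ennreal (2 / V * (r / 2 ^ k) ^ DIM('a)) * local_energy p \<Omega> u x"
          unfolding a_def V_def using r by (intro tail_bound u \<Omega>b sub p) auto
        also have "\<dots> = ennreal (2 / V * (r / 2 ^ k) ^ DIM('a) * g)"
          unfolding g(1) by (rule ennreal_mult''[symmetric, OF g(2)])
        finally show ?thesis using V r g by (subst (asm) ennreal_le_iff) auto
      qed
      also have "(r / 2 ^ k) ^ DIM('a) \<le> r ^ DIM('a) / 2 ^ k"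
      proof -
        have "(2::real) ^ k \<le> (2 ^ k) ^ DIM('a)"
          by (intro self_le_power) auto
        then show ?thesis using r unfolding power_divide by (intro divide_left_mono) auto
      qed
      finally have 2: "T powr p \<le> 2 / V * (r ^ DIM('a) / 2 ^ k) * g / w0 powr p"
        using V g w by (auto simp: divide_right_mono mult_left_mono mult_right_mono)
      then have "T powr p \<le> Y / 2 ^ k" by (simp add: Y_def mult_ac)
      then show "\<exists>T\<ge>0. X \<le> (real k + 1) powr ((p - 1) / p) * B + T \<and> T powr p \<le> Y / 2 ^ k"
        using 1 nn by blast
    qed
    then have "Phi m (\<alpha> * X powr (p / (p - 1))) / \<delta> ^ DIM('a)
       \<le> 4 * 2 powr p * \<alpha> powr (p - 1) * (X powr p + Y) / \<delta> ^ DIM('a)"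
      using \<delta> by (intro divide_right_mono) auto
    also have "\<dots> = 4 * 2 powr p * \<alpha> powr (p - 1) * (X powr p / \<delta> ^ DIM('a) + Y / \<delta> ^ DIM('a))"
      by (simp add: add_divide_distrib distrib_left)
    also have "Y / \<delta> ^ DIM('a) \<le> 2 / V / w0 powr p * g"
    proof -
      have "r ^ DIM('a) / \<delta> ^ DIM('a) = (1 / 2) ^ DIM('a)"
        using \<delta> by (simp add: r_def power_divide[symmetric])
      also have "\<dots> \<le> 1" by (intro power_le_one) auto
      finally have "2 / V / w0 powr p * g * (r ^ DIM('a) / \<delta> ^ DIM('a)) \<le> 2 / V / w0 powr p * g * 1"
        using V g w by (intro mult_left_mono) auto
      then show ?thesis by (simp add: Y_def mult_ac)
    qed
    finally have "Phi m (\<alpha> * X powr (p / (p - 1))) / \<delta> ^ DIM('a)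
       \<le> 4 * 2 powr p * \<alpha> powr (p - 1) * (X powr p / \<delta> ^ DIM('a) + 2 / V / w0 powr p * g)"
      by (simp add: mult_left_mono)
    moreover have "ennreal a \<le> ennreal K * (ennreal b + ennreal c)"
      if "a \<le> K * (b + c)" "0 \<le> K" "0 \<le> b" "0 \<le> c" for a K b c :: real
      using ennreal_leI[OF that(1)] that(2-)
      by (simp only: ennreal_plus ennreal_mult' add_nonneg_nonneg)
    ultimately have le: "ennreal (Phi m (\<alpha> * X powr (p / (p - 1))) / \<delta> ^ DIM('a))
      \<le> ennreal (4 * 2 powr p * \<alpha> powr (p - 1)) * (ennreal (X powr p / \<delta> ^ DIM('a)) + ennreal (2 / V / w0 powr p * g))"
      using g V \<delta> by simp
    have e: "ennreal (2 / V / w0 powr p) * local_energy p \<Omega> u x = ennreal (2 / V / w0 powr p * g)"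
      unfolding g(1) by (rule ennreal_mult''[symmetric, OF g(2)])
    show ?thesis unfolding e using le by (simp only: X_def \<delta>_def)
  qed
qed

text \<open>
  The same small bound \<open>I\<close> is imposed on the energy and, up to the Hardy constant, on the Hardy
  integral. It can be chosen before \<open>u\<close> and \<open>c\<close> because the smallness condition of the pointwise bound
  depends only on \<open>I\<close> and tends to \<open>0\<close> with it.
\<close>

lemma trudinger_of_hardy:
  fixes \<Omega> :: "'a::euclidean_space set" and w :: "'a \<Rightarrow> real"
  assumes \<Omega>: "open \<Omega>" "frontier \<Omega> \<noteq> {}"
    and p: "1 < p" and m: "real m \<ge> p - 1" "p - 1 > real m - 1" and \<alpha>: "0 < \<alpha>"
    and w: "0 < w0" "\<And>x. x \<in> \<Omega> \<Longrightarrow> w0 \<le> w x"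
       "\<And>x y. x \<in> \<Omega> \<Longrightarrow> dist x y < bdry_dist \<Omega> x / 2 \<Longrightarrow> w y \<le> 2 * w x"
    and wm [measurable]: "w \<in> borel_measurable borel"
    and H: "0 \<le> H"
  shows "\<exists>I>0. \<exists>C. \<forall>u c. continuous_on UNIV u \<longrightarrow> energy p \<Omega> u \<le> ennreal I \<longrightarrow>
     (\<integral>\<^sup>+x\<in>\<Omega>. ennreal ((\<bar>u x - c\<bar> / w x) powr p / bdry_dist \<Omega> x ^ DIM('a)) \<partial>lborel) \<le> ennreal (H * I) \<longrightarrow>
     (\<integral>\<^sup>+x\<in>\<Omega>. ennreal (Phi m (\<alpha> * (\<bar>u x - c\<bar> / w x) powr (p / (p - 1))) / bdry_dist \<Omega> x ^ DIM('a)) \<partial>lborel)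
       \<le> ennreal C"
proof -
  let ?T = "\<lambda>u c. \<integral>\<^sup>+x\<in>\<Omega>. ennreal (Phi m (\<alpha> * (\<bar>u x - c\<bar> / w x) powr (p / (p - 1))) / bdry_dist \<Omega> x ^ DIM('a)) \<partial>lborel"
  let ?H = "\<lambda>u c. \<integral>\<^sup>+x\<in>\<Omega>. ennreal ((\<bar>u x - c\<bar> / w x) powr p / bdry_dist \<Omega> x ^ DIM('a)) \<partial>lborel"
  define V where "V = unit_ball_vol (DIM('a))"
  define A where "A = 2 * 4 ^ DIM('a) * 2 powr p / V * H"
  define C where "C = 4 * 8 ^ DIM('a) / V\<^sup>2 / w0 powr p"
  define f where "f I = 2 * \<alpha> * (2 * ((A * I) powr (1 / p) + (C * I) powr (1 / p))) powr (p / (p - 1))" for I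
  have V: "V > 0" by (simp add: V_def)
  have A: "A \<ge> 0" using V H by (simp add: A_def)
  have C: "C > 0" using V w by (simp add: C_def)
  \<comment> \<open>\<open>f\<close> is the left side of the smallness condition, as a function of the energy bound.\<close>
  have "(f \<longlongrightarrow> f 0) (at_right 0)"
    unfolding f_def using p A C
    by (intro tendsto_intros tendsto_powr')
       (auto intro!: eventually_at_rightI[of _ 1] simp: add_nonneg_pos)
  then have "eventually (\<lambda>I. f I < ln 2) (at_right 0)"
    using p by (elim order_tendstoD(2)) (simp add: f_def)
  moreover have "eventually (\<lambda>I::real. I > 0) (at_right 0)" by (simp add: eventually_at_right_less)
  ultimately obtain I where I: "I > 0" "f I < ln 2"
    using eventually_happens[OF eventually_conj] trivial_limit_at_right_real by blast
  define K1 where "K1 = 4 * 2 powr p * \<alpha> powr (p - 1)"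
  define K2 where "K2 = 2 / V / w0 powr p"
  have K: "K1 \<ge> 0" "K2 \<ge> 0" using V by (auto simp: K1_def K2_def)
  show ?thesis
  proof (rule exI[of _ I], intro conjI exI[of _ "K1 * (H * I + K2 * I)"] allI impI I)
    fix u :: "'a \<Rightarrow> real" and c :: real
    assume u: "continuous_on UNIV u" and E: "energy p \<Omega> u \<le> ennreal I"
      and hardy: "?H u c \<le> ennreal (H * I)"
    have [measurable]: "u \<in> borel_measurable borel" "\<Omega> \<in> sets borel"
      using u \<Omega> by auto
    have "?T u c
      \<le> (\<integral>\<^sup>+x. ennreal K1 * (ennreal ((\<bar>u x - c\<bar> / w x) powr p / bdry_dist \<Omega> x ^ DIM('a)) * indicator \<Omega> x
           + ennreal K2 * (local_energy p \<Omega> u x * indicator \<Omega> x)) \<partial>lborel)"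
    proof (rule nn_integral_mono)
      fix x
      show "ennreal (Phi m (\<alpha> * (\<bar>u x - c\<bar> / w x) powr (p / (p - 1))) / bdry_dist \<Omega> x ^ DIM('a)) * indicator \<Omega> x
        \<le> ennreal K1 * (ennreal ((\<bar>u x - c\<bar> / w x) powr p / bdry_dist \<Omega> x ^ DIM('a)) * indicator \<Omega> x
           + ennreal K2 * (local_energy p \<Omega> u x * indicator \<Omega> x))"
      proof (cases "x \<in> \<Omega>")
        case True
        have "(\<bar>set_average (shell x (bdry_dist \<Omega> x / 2)) u - c\<bar> / w x) powr p
            \<le> 2 * 4 ^ DIM('a) * 2 powr p / unit_ball_vol (DIM('a)) * (H * I)"
          using w I H by (intro weighted_average_bound[OF u \<Omega> True p _ _ hardy])
            (auto intro: less_le_trans True)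
        then have h: "(\<bar>set_average (shell x (bdry_dist \<Omega> x / 2)) u - c\<bar> / w x) powr p \<le> A * I"
          by (simp add: A_def V_def)
        show ?thesis
          using pointwise_exponential_bound[where w = w and A = A and I = I and C = C, OF u \<Omega> True p m \<alpha> w(1) w(2)[OF True] E I(1) h A, folded V_def, OF C_def[symmetric]]
            I(2) True by (simp add: f_def K1_def K2_def V_def)
      qed auto
    qed
    also have "\<dots> = ennreal K1 * (?H u c
       + ennreal K2 * energy p \<Omega> u)"
      unfolding energy_def by (simp add: nn_integral_cmult nn_integral_add)
    also have "\<dots> \<le> ennreal K1 * (ennreal (H * I) + ennreal K2 * ennreal I)"
      by (intro mult_left_mono add_mono hardy E) auto
    also have "\<dots> = ennreal (K1 * (H * I + K2 * I))"
      using K H I by (simp add: ennreal_mult' ennreal_plus)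
    finally show "?T u c
       \<le> ennreal (K1 * (H * I + K2 * I))" .
  qed
qed

section \<open>Thickness of boundary layers of Lipschitz domains\<close>

text \<open>
  The height of \<open>y\<close> above the graph of \<open>\<gamma>\<close> is \<open>y \<bullet> e - \<gamma> (y - (y \<bullet> e) *\<^sub>R e)\<close>.
\<close>

lemma graph_height_shift:
  fixes e :: "'a::euclidean_space"
  assumes "norm e = 1"
  shows "(y - \<tau> *\<^sub>R e) \<bullet> e - \<gamma> ((y - \<tau> *\<^sub>R e) - ((y - \<tau> *\<^sub>R e) \<bullet> e) *\<^sub>R e)
       = y \<bullet> e - \<gamma> (y - (y \<bullet> e) *\<^sub>R e) - \<tau>"
proof -
  have ee: "e \<bullet> e = 1" using assms by (simp add: norm_eq_1)
  then have a: "(y - \<tau> *\<^sub>R e) \<bullet> e = y \<bullet> e - \<tau>" by (simp add: inner_diff_left)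
  have b: "(y - \<tau> *\<^sub>R e) - (y \<bullet> e - \<tau>) *\<^sub>R e = y - (y \<bullet> e) *\<^sub>R e"
    by (simp add: algebra_simps)
  show ?thesis unfolding a b by simp
qed

lemma graph_height_lipschitz:
  fixes e :: "'a::euclidean_space"
  assumes e: "norm e = 1" and L: "L-lipschitz_on {w. w \<bullet> e = 0} \<gamma>"
  shows "\<bar>(y \<bullet> e - \<gamma> (y - (y \<bullet> e) *\<^sub>R e)) - (w \<bullet> e - \<gamma> (w - (w \<bullet> e) *\<^sub>R e))\<bar> \<le> (1 + 2 * L) * dist y w"
proof -
  have ee: "e \<bullet> e = 1" using e by (simp add: norm_eq_1)
  have "\<bar>(y - w) \<bullet> e\<bar> \<le> norm (y - w) * norm e" by (rule Cauchy_Schwarz_ineq2)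
  then have 1: "\<bar>y \<bullet> e - w \<bullet> e\<bar> \<le> dist y w" using e by (simp add: inner_diff_left dist_norm)
  have "dist (\<gamma> (y - (y \<bullet> e) *\<^sub>R e)) (\<gamma> (w - (w \<bullet> e) *\<^sub>R e))
     \<le> L * dist (y - (y \<bullet> e) *\<^sub>R e) (w - (w \<bullet> e) *\<^sub>R e)"
    using ee by (intro lipschitz_onD[OF L]) (auto simp: inner_diff_left)
  also have "dist (y - (y \<bullet> e) *\<^sub>R e) (w - (w \<bullet> e) *\<^sub>R e) \<le> dist y w + \<bar>y \<bullet> e - w \<bullet> e\<bar>"
  proof -
    have eq: "(y - (y \<bullet> e) *\<^sub>R e) - (w - (w \<bullet> e) *\<^sub>R e) = (y - w) - (y \<bullet> e - w \<bullet> e) *\<^sub>R e"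
      by (simp add: algebra_simps)
    show ?thesis unfolding dist_norm eq
      using norm_triangle_ineq4[of "y - w" "(y \<bullet> e - w \<bullet> e) *\<^sub>R e"] e by simp
  qed
  also have "\<dots> \<le> 2 * dist y w" using 1 by simp
  finally have "\<bar>\<gamma> (y - (y \<bullet> e) *\<^sub>R e) - \<gamma> (w - (w \<bullet> e) *\<^sub>R e)\<bar> \<le> L * (2 * dist y w)"
    using lipschitz_on_nonneg[OF L] by (simp add: dist_real_def mult_left_mono)
  with 1 show ?thesis by (simp add: algebra_simps abs_if split: if_splits)
qed

lemma emeasure_lborel_translate:
  fixes G :: "'a::euclidean_space set"
  assumes "G \<in> sets borel"
  shows "(\<integral>\<^sup>+w. indicator G (w - v) \<partial>lborel) = emeasure lborel G"
proof -
  have "emeasure lborel G = (\<integral>\<^sup>+w. indicator G w \<partial>(distr lborel borel ((+) (- v))))"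
    using assms by (simp add: lborel_distr_plus)
  also have "\<dots> = (\<integral>\<^sup>+w. indicator G (- v + w) \<partial>lborel)"
    using assms by (intro nn_integral_distr) auto
  finally show ?thesis by simp
qed

text \<open>
  For \<open>\<rho> > 0\<close> this says that the layer of thickness \<open>\<eta>\<close> in the ball around \<open>z\<close> has volume at least
  \<open>c \<rho> ^ (d - 1) \<eta>\<close>; the factor \<open>\<rho>\<close> on both sides avoids the exponent \<open>d - 1\<close>.
\<close>

definition thick_boundary_at :: "'a::euclidean_space set \<Rightarrow> real \<Rightarrow> real \<Rightarrow> 'a \<Rightarrow> bool" where
  "thick_boundary_at \<Omega> c r z \<longleftrightarrow> (\<forall>\<rho> \<eta>. 0 < \<eta> \<longrightarrow> \<eta> \<le> \<rho> \<longrightarrow> \<rho> \<le> r \<longrightarrow>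
     c * \<rho> ^ DIM('a) * \<eta> \<le> \<rho> * measure lborel {y \<in> \<Omega> \<inter> ball z \<rho>. bdry_dist \<Omega> y < \<eta>})"

text \<open>
  Move each point \<open>w\<close> of a small ball around \<open>z\<close> vertically by all amounts that bring its height above
  the graph into the interval from \<open>0\<close> to \<open>\<eta> / 3\<close>. The resulting points lie in the layer. The amounts have total length
  \<open>\<eta> / 3\<close> for each \<open>w\<close> and are at most \<open>\<rho>\<close> in absolute value, so that Fubini's theorem and the translation
  invariance of the measure bound the volume of the layer from below.
\<close>

lemma boundary_layer_graph:
  fixes \<Omega> :: "'a::euclidean_space set" and e :: 'a
  assumes \<Omega>: "open \<Omega>" and r: "0 < r" and e: "norm e = 1" and L: "L-lipschitz_on {w. w \<bullet> e = 0} \<gamma>"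
    and graph: "\<Omega> \<inter> ball z0 r = {x \<in> ball z0 r. \<gamma> (x - (x \<bullet> e) *\<^sub>R e) < x \<bullet> e}"
  shows "\<exists>c>0. \<forall>z\<in>frontier \<Omega> \<inter> ball z0 (r / 2). thick_boundary_at \<Omega> c (r / 2) z"
proof -
  define t where "t y = y \<bullet> e - \<gamma> (y - (y \<bullet> e) *\<^sub>R e)" for y
  define M where "M = 1 + 2 * L"
  define \<kappa> where "\<kappa> = 1 / (3 * (1 + M))"
  define c where "c = unit_ball_vol (DIM('a)) * \<kappa> ^ DIM('a) / 6"
  have M: "M \<ge> 1" using lipschitz_on_nonneg[OF L] by (simp add: M_def)
  have \<kappa>: "\<kappa> > 0" "\<kappa> * (1 + M) = 1 / 3" using M by (auto simp: \<kappa>_def)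
  have shift: "t (y - \<tau> *\<^sub>R e) = t y - \<tau>" for y \<tau>
    using graph_height_shift[OF e] by (simp add: t_def)
  have lip: "\<bar>t y - t w\<bar> \<le> M * dist y w" for y w
    using graph_height_lipschitz[OF e L] by (simp add: t_def M_def)
  have "M-lipschitz_on UNIV t"
    using lip M by (intro lipschitz_onI) (auto simp: dist_real_def)
  then have cont: "continuous_on UNIV t" by (rule lipschitz_on_continuous_on)
  then have tm [measurable]: "t \<in> borel_measurable borel" by simp
  have inside: "y \<in> \<Omega> \<longleftrightarrow> t y > 0" if "y \<in> ball z0 r" for y
    using graph that unfolding t_def by (auto simp: set_eq_iff)
  have fr: "frontier \<Omega> = closure \<Omega> - \<Omega>" using \<Omega> by (simp add: frontier_def interior_open)
  have t0: "t z = 0" if z: "z \<in> frontier \<Omega>" "z \<in> ball z0 r" for z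
  proof (rule ccontr)
    assume "t z \<noteq> 0"
    then have "t z < 0" using inside[OF z(2)] z fr by auto
    define U where "U = {y. t y < 0} \<inter> ball z0 r"
    have "open U" unfolding U_def using cont by (intro open_Int open_Collect_less) auto
    moreover have "z \<in> U" using \<open>t z < 0\<close> z by (simp add: U_def)
    moreover have "U \<inter> \<Omega> = {}" using inside by (force simp: U_def)
    ultimately show False using z fr by (metis DiffD1 disjoint_iff open_Int_closure_eq_empty)
  qed
  have onfr: "y \<in> frontier \<Omega>" if y: "y \<in> ball z0 r" "t y = 0" for y
  proof -
    have "y \<in> closure \<Omega>"
    proof (subst closure_approachable, intro allI impI)
      fix \<epsilon> :: real assume \<epsilon>: "\<epsilon> > 0"
      define s where "s = min (\<epsilon> / 2) ((r - dist z0 y) / 2)"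
      have s: "0 < s" "s < \<epsilon>" "s < r - dist z0 y" using y \<epsilon> by (auto simp: s_def min_def field_simps)
      define y' where "y' = y - (- s) *\<^sub>R e"
      have d: "dist y' y = s" using e s by (simp add: y'_def dist_norm)
      then have "y' \<in> ball z0 r" using dist_triangle[of z0 y' y] s by (simp add: dist_commute)
      moreover have "t y' = s" unfolding y'_def shift using y by simp
      ultimately have "y' \<in> \<Omega>" using inside s by simp
      then show "\<exists>y'\<in>\<Omega>. dist y' y < \<epsilon>" using d s by auto
    qed
    then show ?thesis using fr inside y by auto
  qed
  show ?thesis
    unfolding thick_boundary_at_def
  proof (intro exI[of _ c] conjI ballI allI impI)
    show "c > 0" using \<kappa> by (simp add: c_def)
    fix z \<rho> \<eta> assume z: "z \<in> frontier \<Omega> \<inter> ball z0 (r / 2)" and \<eta>: "0 < \<eta>" "\<eta> \<le> \<rho>" and \<rho>: "\<rho> \<le> r / 2"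
    define G where "G = {y \<in> \<Omega> \<inter> ball z \<rho>. bdry_dist \<Omega> y < \<eta>}"
    have big: "y \<in> ball z0 r" if "dist z y < \<rho>" for y
      using that z \<rho> dist_triangle[of z0 y z] by simp
    have tz: "t z = 0" using t0 z r by auto
    \<comment> \<open>The constants \<open>\<kappa>\<close> and \<open>\<eta> / 3\<close> keep the moved point, and its vertical projection to the graph, inside the ball around \<open>z\<close>.\<close>
    have key: "w - \<tau> *\<^sub>R e \<in> G" "\<bar>\<tau>\<bar> \<le> \<rho>"
      if w: "w \<in> ball z (\<kappa> * \<rho>)" and \<tau>: "t w - \<eta> / 3 < \<tau>" "\<tau> < t w" for w \<tau>
    proof -
      have "\<bar>t w\<bar> \<le> M * dist w z" using lip[of w z] tz by simp
      also have "\<dots> \<le> M * (\<kappa> * \<rho>)" using w M by (intro mult_left_mono) (auto simp: dist_commute)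
      finally have tw: "\<bar>t w\<bar> \<le> M * (\<kappa> * \<rho>)" .
      have sum: "\<kappa> * \<rho> + M * (\<kappa> * \<rho>) = \<rho> / 3"
        using arg_cong[OF \<kappa>(2), of "\<lambda>x. x * \<rho>"] by (simp add: algebra_simps)
      have \<kappa>\<rho>: "\<kappa> * \<rho> > 0" using \<kappa> \<eta> by simp
      have abs\<tau>: "\<bar>\<tau>\<bar> \<le> M * (\<kappa> * \<rho>) + \<eta> / 3" using tw \<tau> by linarith
      then show "\<bar>\<tau>\<bar> \<le> \<rho>" using sum \<kappa>\<rho> \<eta> by linarith
      define y where "y = w - \<tau> *\<^sub>R e"
      have dyw: "dist w y = \<bar>\<tau>\<bar>" using e by (simp add: y_def dist_norm)
      have dzy: "dist z y < 2 * \<rho> / 3"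
        using dist_triangle[of z y w] dyw abs\<tau> w sum \<eta> by simp
      have ty: "t y = t w - \<tau>" by (simp add: y_def shift)
      have yb: "dist z y < \<rho>" using dzy \<eta> by linarith
      have "y \<in> \<Omega>" using inside[OF big[OF yb]] ty \<tau> by simp
      moreover have "bdry_dist \<Omega> y < \<eta>"
      proof -
        define y' where "y' = y - t y *\<^sub>R e"
        have d: "dist y y' = t y" using e ty \<tau> by (simp add: y'_def dist_norm)
        have "dist z y' < \<rho>" using dist_triangle[of z y' y] d dzy ty \<tau> \<eta> by simp
        moreover have "t y' = 0" by (simp add: y'_def shift)
        ultimately have "y' \<in> frontier \<Omega>" using onfr big by blast
        then have "bdry_dist \<Omega> y \<le> t y" using infdist_le d by (metis bdry_dist_def)
        then show ?thesis using ty \<tau> \<eta> by linarith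
      qed
      ultimately show "w - \<tau> *\<^sub>R e \<in> G" using yb by (simp add: G_def y_def)
    qed
    have Gb [measurable]: "G \<in> sets borel" unfolding G_def using \<Omega> by measurable
    have Gfin: "emeasure lborel G < \<infinity>"
      by (intro emeasure_bounded_finite bounded_subset[OF bounded_ball[of z \<rho>]]) (auto simp: G_def)
    have \<rho>0: "\<rho> > 0" using \<eta> by linarith
    have "ennreal (\<eta> / 3 * (unit_ball_vol (DIM('a)) * (\<kappa> * \<rho>) ^ DIM('a)))
        = ennreal (\<eta> / 3) * emeasure lborel (ball z (\<kappa> * \<rho>))"
      using \<kappa> \<rho>0 \<eta> by (simp add: emeasure_ball ennreal_mult'[symmetric])
    also have "\<dots> = (\<integral>\<^sup>+w. ennreal (\<eta> / 3) * indicator (ball z (\<kappa> * \<rho>)) w \<partial>lborel)"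
      by (simp add: nn_integral_cmult_indicator)
    also have "\<dots> = (\<integral>\<^sup>+w. (\<integral>\<^sup>+\<tau>. indicator {t w - \<eta> / 3<..<t w} \<tau> * indicator (ball z (\<kappa> * \<rho>)) w \<partial>lborel) \<partial>lborel)"
      using \<eta> by (intro nn_integral_cong) (simp add: nn_integral_multc)
    also have "\<dots> \<le> (\<integral>\<^sup>+w. (\<integral>\<^sup>+\<tau>. indicator {-\<rho>..\<rho>} \<tau> * indicator G (w - \<tau> *\<^sub>R e) \<partial>lborel) \<partial>lborel)"
    proof (intro nn_integral_mono)
      fix w \<tau>
      show "indicator {t w - \<eta> / 3<..<t w} \<tau> * indicator (ball z (\<kappa> * \<rho>)) w
         \<le> (indicator {-\<rho>..\<rho>} \<tau> * indicator G (w - \<tau> *\<^sub>R e) :: ennreal)"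
        using key[of w \<tau>] by (auto simp: indicator_def abs_le_iff)
    qed
    also have "\<dots> = (\<integral>\<^sup>+\<tau>. (\<integral>\<^sup>+w. indicator {-\<rho>..\<rho>} \<tau> * indicator G (w - \<tau> *\<^sub>R e) \<partial>lborel) \<partial>lborel)"
      by (intro lborel_pair.Fubini'[symmetric]) (unfold case_prod_beta, measurable)
    also have "\<dots> = (\<integral>\<^sup>+\<tau>. emeasure lborel G * indicator {-\<rho>..\<rho>} \<tau> \<partial>lborel)"
      by (intro nn_integral_cong) (simp add: nn_integral_cmult emeasure_lborel_translate mult.commute)
    also have "\<dots> = ennreal (measure lborel G) * ennreal (2 * \<rho>)"
      using Gfin \<rho>0 by (simp add: nn_integral_cmult emeasure_eq_ennreal_measure)
    finally have "\<eta> / 3 * (unit_ball_vol (DIM('a)) * (\<kappa> * \<rho>) ^ DIM('a)) \<le> measure lborel G * (2 * \<rho>)"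
      using \<rho>0 by (subst (asm) ennreal_mult'[symmetric]) auto
    then show "c * \<rho> ^ DIM('a) * \<eta> \<le> \<rho> * measure lborel {y \<in> \<Omega> \<inter> ball z \<rho>. bdry_dist \<Omega> y < \<eta>}"
      unfolding G_def[symmetric] by (simp add: c_def power_mult_distrib field_simps)
  qed
qed

text \<open>
  The constants of the local graphs become uniform by compactness of the frontier.
\<close>

lemma boundary_layer:
  fixes \<Omega> :: "'a::euclidean_space set"
  assumes \<Omega>: "bounded_lipschitz_domain \<Omega>"
  shows "\<exists>c>0. \<exists>r>0. \<forall>z\<in>frontier \<Omega>. thick_boundary_at \<Omega> c r z"
proof -
  have mono: "thick_boundary_at \<Omega> c r z" if "thick_boundary_at \<Omega> c' r' z" "c \<le> c'" "r \<le> r'" for c r c' r' :: real and z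
    unfolding thick_boundary_at_def
  proof (intro allI impI)
    fix \<rho> \<eta> :: real assume *: "0 < \<eta>" "\<eta> \<le> \<rho>" "\<rho> \<le> r"
    have "c * \<rho> ^ DIM('a) * \<eta> \<le> c' * \<rho> ^ DIM('a) * \<eta>"
      using * that by (intro mult_right_mono) auto
    also have "\<dots> \<le> \<rho> * measure lborel {y \<in> \<Omega> \<inter> ball z \<rho>. bdry_dist \<Omega> y < \<eta>}"
      using that(1) * \<open>r \<le> r'\<close> unfolding thick_boundary_at_def by auto
    finally show "c * \<rho> ^ DIM('a) * \<eta> \<le> \<rho> * measure lborel {y \<in> \<Omega> \<inter> ball z \<rho>. bdry_dist \<Omega> y < \<eta>}" .
  qed
  have "\<exists>c>0. \<exists>r>0. \<forall>z\<in>frontier \<Omega> \<inter> ball z0 r. thick_boundary_at \<Omega> c r z" if z0: "z0 \<in> frontier \<Omega>" for z0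
  proof -
    obtain r e L \<gamma> where r: "r > 0" "norm e = 1" "L-lipschitz_on {w. w \<bullet> e = 0} \<gamma>"
        "\<Omega> \<inter> ball z0 r = {x \<in> ball z0 r. \<gamma> (x - (x \<bullet> e) *\<^sub>R e) < x \<bullet> e}" and o: "open \<Omega>"
      using \<Omega> z0 unfolding bounded_lipschitz_domain_def by meson
    obtain c where "c > 0" "\<forall>z\<in>frontier \<Omega> \<inter> ball z0 (r / 2). thick_boundary_at \<Omega> c (r / 2) z"
      using boundary_layer_graph[OF o r] by blast
    then show ?thesis using r(1) by (intro exI[of _ c] conjI exI[of _ "r / 2"]) auto
  qed
  then obtain cc rr where cr: "\<And>z0. z0 \<in> frontier \<Omega> \<Longrightarrow> cc z0 > (0::real)"
      "\<And>z0. z0 \<in> frontier \<Omega> \<Longrightarrow> rr z0 > (0::real)"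
      "\<And>z0 z. z0 \<in> frontier \<Omega> \<Longrightarrow> z \<in> frontier \<Omega> \<inter> ball z0 (rr z0) \<Longrightarrow> thick_boundary_at \<Omega> (cc z0) (rr z0) z"
    by metis
  have "compact (frontier \<Omega>)"
    using \<Omega> by (intro compact_frontier_bounded) (simp add: bounded_lipschitz_domain_def)
  then obtain D where D: "D \<subseteq> frontier \<Omega>" "finite D" "frontier \<Omega> \<subseteq> (\<Union>z0\<in>D. ball z0 (rr z0))"
    by (rule compactE_image[where C = "frontier \<Omega>" and f = "\<lambda>z0. ball z0 (rr z0)"]) (use cr(2) in force)+
  define c where "c = Min (insert 1 (cc ` D))"
  define r where "r = Min (insert 1 (rr ` D))"
  have "c > 0" "r > 0" using D cr by (auto simp: c_def r_def)
  moreover have "thick_boundary_at \<Omega> c r z" if z: "z \<in> frontier \<Omega>" for z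
  proof -
    obtain z0 where z0: "z0 \<in> D" "z \<in> ball z0 (rr z0)" using D z by auto
    have "thick_boundary_at \<Omega> (cc z0) (rr z0) z" using z0 z D by (intro cr) auto
    moreover have "c \<le> cc z0" "r \<le> rr z0" using z0 D by (auto simp: c_def r_def intro: Min_le)
    ultimately show ?thesis by (rule mono)
  qed
  ultimately show ?thesis by blast
qed

lemma bounded_frontier_nonempty:
  fixes \<Omega> :: "'a::euclidean_space set"
  assumes "bounded \<Omega>" "\<Omega> \<noteq> {}"
  shows "frontier \<Omega> \<noteq> {}"
  using assms frontier_eq_empty not_bounded_UNIV by blast

lemma bdry_dist_bounded:
  fixes \<Omega> :: "'a::euclidean_space set"
  assumes "bounded \<Omega>" "\<Omega> \<noteq> {}"
  shows "\<exists>M>0. \<forall>x\<in>\<Omega>. bdry_dist \<Omega> x \<le> M"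
proof -
  obtain z where z: "z \<in> frontier \<Omega>" using bounded_frontier_nonempty[OF assms] by blast
  obtain M where M: "\<forall>x\<in>\<Omega>. dist z x \<le> M"
    using assms(1) bounded_any_center[of \<Omega> z] by auto
  then have "bdry_dist \<Omega> x \<le> max M 1" if "x \<in> \<Omega>" for x
    using infdist_le[OF z, of x] that by (auto simp: bdry_dist_def dist_commute intro: order_trans le_max_iff_disj[THEN iffD2])
  then show ?thesis by (intro exI[of _ "max M 1"]) auto
qed

lemma nearest_frontier_point:
  fixes \<Omega> :: "'a::euclidean_space set"
  assumes "frontier \<Omega> \<noteq> {}"
  shows "\<exists>z\<in>frontier \<Omega>. dist x z \<le> bdry_dist \<Omega> x"
proof -
  obtain z where z: "z \<in> frontier \<Omega>" "\<And>y. y \<in> frontier \<Omega> \<Longrightarrow> dist x z \<le> dist x y"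
    using distance_attains_inf[of "frontier \<Omega>" x] assms by auto
  have "dist x z \<le> (INF y\<in>frontier \<Omega>. dist x y)"
    using assms z by (intro cINF_greatest) auto
  then show ?thesis using z assms by (auto simp: bdry_dist_def infdist_notempty)
qed

definition outward_layer :: "'a::euclidean_space set \<Rightarrow> real \<Rightarrow> 'a \<Rightarrow> 'a set" where
  "outward_layer \<Omega> \<nu> x = {y \<in> \<Omega>. dist x y < 2 * bdry_dist \<Omega> x \<and> \<nu> * bdry_dist \<Omega> y < bdry_dist \<Omega> x}"

text \<open>
  Apply the lower bound for boundary layers at the frontier point nearest to \<open>x\<close>. The essential point is that
  the constant does not depend on \<open>\<nu>\<close>.
\<close>

lemma measure_outward_layer_ge:
  fixes \<Omega> :: "'a::euclidean_space set"
  assumes \<Omega>: "bounded_lipschitz_domain \<Omega>"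
  shows "\<exists>c>0. \<forall>\<nu>\<ge>1. \<forall>x\<in>\<Omega>. c * bdry_dist \<Omega> x ^ DIM('a) \<le> \<nu> * measure lborel (outward_layer \<Omega> \<nu> x)"
proof -
  have op: "open \<Omega>" and bd: "bounded \<Omega>" and ne: "\<Omega> \<noteq> {}"
    using \<Omega> by (auto simp: bounded_lipschitz_domain_def)
  note fne = bounded_frontier_nonempty[OF bd ne]
  obtain M where M: "M > 0" "\<And>x. x \<in> \<Omega> \<Longrightarrow> bdry_dist \<Omega> x \<le> M"
    using bdry_dist_bounded[OF bd ne] by blast
  obtain c r where c: "c > 0" and r: "r > 0" and layer: "\<And>z \<rho> \<eta>. z \<in> frontier \<Omega> \<Longrightarrow> 0 < \<eta> \<Longrightarrow> \<eta> \<le> \<rho> \<Longrightarrow> \<rho> \<le> r \<Longrightarrow>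
     c * \<rho> ^ DIM('a) * \<eta> \<le> \<rho> * measure lborel {y \<in> \<Omega> \<inter> ball z \<rho>. bdry_dist \<Omega> y < \<eta>}"
    using boundary_layer[OF \<Omega>] unfolding thick_boundary_at_def by blast
  \<comment> \<open>The factor \<open>\<kappa>\<close> brings the radius \<open>\<delta> x\<close> below \<open>r\<close>, also for \<open>x\<close> far from the boundary.\<close>
  define \<kappa> where "\<kappa> = min 1 (r / M)"
  have \<kappa>: "0 < \<kappa>" "\<kappa> \<le> 1" "\<kappa> * M \<le> r" using r M by (auto simp: \<kappa>_def min_def field_simps)
  show ?thesis
  proof (intro exI[of _ "c * \<kappa> ^ DIM('a)"] conjI allI impI ballI)
    show "0 < c * \<kappa> ^ DIM('a)" using c \<kappa> by simp
    fix \<nu> :: real and x assume \<nu>: "1 \<le> \<nu>" and x: "x \<in> \<Omega>"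
    define \<delta> where "\<delta> = bdry_dist \<Omega> x"
    have \<delta>: "0 < \<delta>" "\<delta> \<le> M" using bdry_dist_pos[OF op fne x] M x by (auto simp: \<delta>_def)
    obtain z where z: "z \<in> frontier \<Omega>" "dist x z \<le> \<delta>"
      unfolding \<delta>_def using nearest_frontier_point[OF fne] by blast
    define \<rho> where "\<rho> = \<kappa> * \<delta>"
    define A where "A = {y \<in> \<Omega> \<inter> ball z \<rho>. bdry_dist \<Omega> y < \<rho> / \<nu>}"
    have "\<kappa> * \<delta> \<le> \<kappa> * M" using \<kappa> \<delta> by (intro mult_left_mono) auto
    then have "\<rho> \<le> r" using \<kappa>(3) unfolding \<rho>_def by linarith
    then have \<rho>: "0 < \<rho>" "\<rho> \<le> r" "\<rho> \<le> \<delta>"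
      using \<kappa> \<delta> by (auto simp: \<rho>_def mult_left_le_one_le)
    have "\<rho> / \<nu> \<le> \<rho> / 1" using \<nu> \<rho> by (intro divide_left_mono) auto
    then have "c * \<rho> ^ DIM('a) * (\<rho> / \<nu>) \<le> \<rho> * measure lborel A"
      unfolding A_def using \<rho> \<nu> by (intro layer z) auto
    then have "\<rho> * (c * \<rho> ^ DIM('a)) \<le> \<rho> * (\<nu> * measure lborel A)"
      using \<nu> by (simp add: field_simps)
    then have "c * \<rho> ^ DIM('a) \<le> \<nu> * measure lborel A" using \<rho>(1) by (simp only: mult_le_cancel_left_pos)
    also have "measure lborel A \<le> measure lborel (outward_layer \<Omega> \<nu> x)"
    proof (rule measure_mono_fmeasurable)
      show "A \<subseteq> outward_layer \<Omega> \<nu> x"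
      proof
        fix y assume "y \<in> A"
        then have y: "y \<in> \<Omega>" "dist z y < \<rho>" "bdry_dist \<Omega> y < \<rho> / \<nu>" by (auto simp: A_def)
        have "dist x y < 2 * \<delta>" using dist_triangle[of x y z] z y \<rho> by simp
        moreover have "\<nu> * bdry_dist \<Omega> y < \<delta>" using y \<nu> \<rho> by (simp add: field_simps)
        ultimately show "y \<in> outward_layer \<Omega> \<nu> x" using y by (simp add: outward_layer_def \<delta>_def)
      qed
      show "A \<in> sets lborel" unfolding A_def using op by measurable
      show "outward_layer \<Omega> \<nu> x \<in> fmeasurable lborel"
        unfolding fmeasurable_def
      proof (intro CollectI conjI)
        show "outward_layer \<Omega> \<nu> x \<in> sets lborel"
          unfolding outward_layer_def using op by measurable
        show "emeasure lborel (outward_layer \<Omega> \<nu> x) < \<infinity>"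
          by (intro emeasure_bounded_finite bounded_subset[OF bd]) (auto simp: outward_layer_def)
      qed
    qed
    finally show "c * \<kappa> ^ DIM('a) * bdry_dist \<Omega> x ^ DIM('a) \<le> \<nu> * measure lborel (outward_layer \<Omega> \<nu> x)"
      using \<nu> by (simp add: \<rho>_def \<delta>_def power_mult_distrib mult_left_mono mult.assoc)
  qed
qed

text \<open>
  Where \<open>\<delta>\<close> lies between \<open>2 ^ k * m\<close> and twice this number, \<open>x\<close> lies in a ball around \<open>y\<close> of comparable
  radius; the volumes of these balls against the weight form a geometric series.
\<close>

lemma integral_above_height_le:
  fixes \<Omega> :: "'a::euclidean_space set" and y :: 'a
  assumes m: "0 < m"
  shows "(\<integral>\<^sup>+x. ennreal (1 / bdry_dist \<Omega> x ^ (2 * DIM('a))) *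
             indicator {x. m < bdry_dist \<Omega> x \<and> dist x y < 2 * bdry_dist \<Omega> x} x \<partial>lborel)
     \<le> ennreal (2 * 4 ^ DIM('a) * unit_ball_vol (DIM('a)) / m ^ DIM('a))"
proof -
  define V where "V = unit_ball_vol (DIM('a))"
  have V: "V > 0" by (simp add: V_def)
  have "(\<integral>\<^sup>+x. ennreal (1 / bdry_dist \<Omega> x ^ (2 * DIM('a))) *
             indicator {x. m < bdry_dist \<Omega> x \<and> dist x y < 2 * bdry_dist \<Omega> x} x \<partial>lborel)
     \<le> (\<integral>\<^sup>+x. (\<Sum>k. ennreal (1 / (2 ^ k * m) ^ (2 * DIM('a))) * indicator (ball y (4 * (2 ^ k * m))) x) \<partial>lborel)"
  proof (rule nn_integral_mono)
    fix x
    define \<delta> where "\<delta> = bdry_dist \<Omega> x"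
    define F where "F k = ennreal (1 / (2 ^ k * m) ^ (2 * DIM('a))) * (indicator (ball y (4 * (2 ^ k * m))) x :: ennreal)" for k :: nat
    have "ennreal (1 / \<delta> ^ (2 * DIM('a))) \<le> (\<Sum>k. F k)" if *: "m < \<delta>" "dist x y < 2 * \<delta>"
    proof -
      define k where "k = nat \<lfloor>log 2 (\<delta> / m)\<rfloor>"
      have l0: "log 2 (\<delta> / m) \<ge> 0" using * m by simp
      then have kb: "real k \<le> log 2 (\<delta> / m)" "log 2 (\<delta> / m) < real k + 1"
        by (auto simp: k_def)
      have "2 powr real k \<le> \<delta> / m" using kb * m by (simp add: le_log_iff)
      then have k1: "2 ^ k * m \<le> \<delta>" using m by (simp add: powr_realpow field_simps)
      have "\<delta> / m < 2 powr (real k + 1)" using kb * m by (simp add: log_less_iff)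
      then have k2: "\<delta> < 2 * (2 ^ k * m)" using m by (simp add: powr_add powr_realpow field_simps)
      have "ennreal (1 / \<delta> ^ (2 * DIM('a))) \<le> F k"
      proof -
        have "x \<in> ball y (4 * (2 ^ k * m))" using * k2 by (simp add: dist_commute)
        moreover have "1 / \<delta> ^ (2 * DIM('a)) \<le> 1 / (2 ^ k * m) ^ (2 * DIM('a))"
          using k1 m * by (intro divide_left_mono power_mono mult_pos_pos zero_less_power) auto
        ultimately show ?thesis by (simp add: F_def ennreal_leI)
      qed
      also have "\<dots> = (\<Sum>j\<in>{k}. F j)" by simp
      also have "\<dots> \<le> (\<Sum>k. F k)" by (intro sum_le_suminf) auto
      finally show ?thesis .
    qed
    then show "ennreal (1 / bdry_dist \<Omega> x ^ (2 * DIM('a))) *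
             indicator {x. m < bdry_dist \<Omega> x \<and> dist x y < 2 * bdry_dist \<Omega> x} x
       \<le> (\<Sum>k. ennreal (1 / (2 ^ k * m) ^ (2 * DIM('a))) * indicator (ball y (4 * (2 ^ k * m))) x)"
      unfolding F_def[symmetric]
      by (cases "m < \<delta> \<and> dist x y < 2 * \<delta>") (auto simp: \<delta>_def)
  qed
  also have "\<dots> = (\<Sum>k. ennreal (1 / (2 ^ k * m) ^ (2 * DIM('a))) * ennreal (V * (4 * (2 ^ k * m)) ^ DIM('a)))"
    proof -
    have ball: "(\<integral>\<^sup>+x\<in>ball y R. ennreal K \<partial>lborel) = ennreal K * ennreal (V * R ^ DIM('a))" if "0 \<le> R" for R K
      using that by (subst nn_integral_cmult_indicator) (auto simp: emeasure_ball V_def)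
    have meas: "(\<lambda>x. ennreal K * indicator (ball y R) x) \<in> borel_measurable lborel" for K R
      by (intro borel_measurable_times_ennreal borel_measurable_const borel_measurable_indicator) auto
    show ?thesis
      unfolding nn_integral_suminf[OF meas] using m by (intro suminf_cong ball) auto
  qed
  also have "\<dots> \<le> (\<Sum>k. ennreal (4 ^ DIM('a) * V / m ^ DIM('a) * (1 / 2) ^ k))"
  proof (intro suminf_le)
    fix k :: nat
    have "1 / (2 ^ k * m) ^ (2 * DIM('a)) * (V * (4 * (2 ^ k * m)) ^ DIM('a)) = V * 4 ^ DIM('a) / (2 ^ k * m) ^ DIM('a)"
    proof -
      have "1 / Q ^ (2 * n) * (V * (4 * Q) ^ n) = V * 4 ^ n / Q ^ n" if "Q > 0" for Q :: real and n
        using that by (simp add: mult_2 power_add power_mult_distrib)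
      from this[of "2 ^ k * m"] m show ?thesis by simp
    qed
    also have "\<dots> = 4 ^ DIM('a) * V / m ^ DIM('a) * (1 / (2 ^ k) ^ DIM('a))"
      by (simp add: power_mult_distrib mult_ac)
    also have "\<dots> \<le> 4 ^ DIM('a) * V / m ^ DIM('a) * (1 / 2 ^ k)"
      using V m self_le_power[of "2 ^ k :: real" "DIM('a)"] by (intro mult_left_mono divide_left_mono) auto
    finally show "ennreal (1 / (2 ^ k * m) ^ (2 * DIM('a))) * ennreal (V * (4 * (2 ^ k * m)) ^ DIM('a))
       \<le> ennreal (4 ^ DIM('a) * V / m ^ DIM('a) * (1 / 2) ^ k)"
      using V m by (subst ennreal_mult'[symmetric]) (auto intro!: ennreal_leI simp: power_divide)
  qed auto
  also have "\<dots> = ennreal (\<Sum>k. 4 ^ DIM('a) * V / m ^ DIM('a) * (1 / 2) ^ k)"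
    using V m by (intro suminf_ennreal2 summable_mult summable_geometric) auto
  also have "(\<Sum>k. 4 ^ DIM('a) * V / m ^ DIM('a) * (1 / 2) ^ k) = 2 * 4 ^ DIM('a) * V / m ^ DIM('a)"
    by (subst suminf_mult) (auto simp: suminf_geometric intro: summable_geometric)
  finally show ?thesis by (simp add: V_def)
qed

section \<open>The Hardy inequality in dimension at least two\<close>

text \<open>
  Continuity and compact support pass to differences at once, so that this class contains the
  differences of the approximating test functions.
\<close>

definition cont_compact_support :: "'a::euclidean_space set \<Rightarrow> ('a \<Rightarrow> real) set" where
  "cont_compact_support \<Omega> =
     {\<phi>. continuous_on UNIV \<phi> \<and> compact (closure {x. \<phi> x \<noteq> 0}) \<and> closure {x. \<phi> x \<noteq> 0} \<subseteq> \<Omega>}"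

text \<open>
  This finiteness permits the absorption in the Hardy inequality.
\<close>

lemma hardy_integral_finite:
  fixes \<Omega> :: "'a::euclidean_space set"
  assumes \<Omega>: "open \<Omega>" "frontier \<Omega> \<noteq> {}" and u: "u \<in> cont_compact_support \<Omega>" and p: "1 < p"
  shows "(\<integral>\<^sup>+x\<in>\<Omega>. ennreal (\<bar>u x\<bar> powr p / bdry_dist \<Omega> x ^ n) \<partial>lborel) < \<infinity>"
proof -
  define K where "K = closure {x. u x \<noteq> 0}"
  have K: "compact K" "K \<subseteq> \<Omega>" and cont: "continuous_on UNIV u"
    using u by (auto simp: cont_compact_support_def K_def)
  have out: "u x = 0" if "x \<notin> K" for x
    using that closure_subset[of "{x. u x \<noteq> 0}"] by (auto simp: K_def)
  define f where "f x = \<bar>u x\<bar> powr p / bdry_dist \<Omega> x ^ n" for x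
  have pos: "bdry_dist \<Omega> x \<noteq> 0" if "x \<in> K" for x
    using bdry_dist_pos[OF \<Omega>, of x] K that by auto
  have "continuous_on K f"
    unfolding f_def using p pos
    by (intro continuous_intros continuous_on_powr' continuous_on_bdry_dist continuous_on_subset[OF cont]) auto
  then have "compact (f ` K)" using K compact_continuous_image by blast
  then obtain B where B: "\<And>x. x \<in> K \<Longrightarrow> f x \<le> B"
    using compact_imp_bounded[of "f ` K"] by (auto simp: bounded_real) (metis abs_le_D1)
  have "(\<integral>\<^sup>+x\<in>\<Omega>. ennreal (f x) \<partial>lborel) \<le> (\<integral>\<^sup>+x. ennreal B * indicator K x \<partial>lborel)"
  proof (intro nn_integral_mono)
    fix x
    show "ennreal (f x) * indicator \<Omega> x \<le> ennreal B * indicator K x"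
      using B[of x] K out[of x] p by (cases "x \<in> K") (auto simp: f_def intro!: ennreal_leI)
  qed
  also have "\<dots> = ennreal B * emeasure lborel K"
    using K by (intro nn_integral_cmult_indicator) (simp add: compact_imp_closed)
  also have "\<dots> < \<infinity>"
    using emeasure_bounded_finite[OF compact_imp_bounded[OF K(1)]] by (simp add: ennreal_mult_less_top)
  finally show ?thesis by (simp add: f_def)
qed

text \<open>
  Average \<open>|u x| powr p \<le> 2 powr p * (|u x - u y| powr p + |u y| powr p)\<close> over the points \<open>y\<close> of the layer,
  and use \<open>|x - y| \<le> 2 \<delta> x\<close> in the first term.
\<close>

lemma hardy_step:
  fixes \<Omega> :: "'a::euclidean_space set" and u :: "'a \<Rightarrow> real"
  assumes \<Omega>: "open \<Omega>" "bounded \<Omega>" "\<Omega> \<noteq> {}" and u: "continuous_on UNIV u" and p: "1 < p" and \<nu>: "1 \<le> \<nu>" and x: "x \<in> \<Omega>"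
    and c: "0 < c" "c * bdry_dist \<Omega> x ^ DIM('a) \<le> \<nu> * measure lborel (outward_layer \<Omega> \<nu> x)"
  shows "ennreal (c / \<nu>) * ennreal (\<bar>u x\<bar> powr p / bdry_dist \<Omega> x ^ DIM('a))
     \<le> ennreal (2 powr p * 4 ^ DIM('a)) * local_energy p \<Omega> u x
       + ennreal (2 powr p) * (\<integral>\<^sup>+y\<in>outward_layer \<Omega> \<nu> x. ennreal (\<bar>u y\<bar> powr p * (1 / bdry_dist \<Omega> x ^ (2 * DIM('a)))) \<partial>lborel)"
proof -
  define \<delta> where "\<delta> = bdry_dist \<Omega> x"
  define E where "E = outward_layer \<Omega> \<nu> x"
  have \<delta>: "0 < \<delta>" using bdry_dist_pos[OF \<Omega>(1) bounded_frontier_nonempty[OF \<Omega>(2,3)] x] by (simp add: \<delta>_def)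
  have [measurable]: "u \<in> borel_measurable borel" "\<Omega> \<in> sets borel" using u \<Omega> by auto
  have Eb [measurable]: "E \<in> sets borel" unfolding E_def outward_layer_def by measurable
  have Efin: "emeasure lborel E < \<infinity>"
    unfolding E_def by (intro emeasure_bounded_finite bounded_subset[OF \<Omega>(2)]) (auto simp: outward_layer_def)
  have E\<Omega>: "E \<subseteq> \<Omega>" and Ed: "norm (x - y) \<le> 2 * \<delta>" if "y \<in> E" for y
    using that by (auto simp: E_def outward_layer_def dist_norm \<delta>_def)
  define a where "a = \<bar>u x\<bar> powr p / \<delta> ^ (2 * DIM('a))"
  have a: "a \<ge> 0" using \<delta> by (simp add: a_def)
  have "c / \<nu> * (\<bar>u x\<bar> powr p / \<delta> ^ DIM('a)) = a * (c * \<delta> ^ DIM('a) / \<nu>)"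
    using \<delta> by (simp add: a_def mult_2 power_add) (simp add: mult_ac)
  also have "c * \<delta> ^ DIM('a) / \<nu> \<le> measure lborel E"
    using c \<nu> by (simp add: E_def \<delta>_def field_simps)
  then have "a * (c * \<delta> ^ DIM('a) / \<nu>) \<le> a * measure lborel E" using a by (intro mult_left_mono)
  finally have "ennreal (c / \<nu> * (\<bar>u x\<bar> powr p / \<delta> ^ DIM('a))) \<le> ennreal (a * measure lborel E)"
    by (rule ennreal_leI)
  also have "\<dots> = (\<integral>\<^sup>+y. ennreal a * indicator E y \<partial>lborel)"
    using Efin a by (simp add: nn_integral_cmult_indicator emeasure_eq_ennreal_measure ennreal_mult')
  also have "\<dots> \<le> (\<integral>\<^sup>+y. ennreal (2 powr p * 4 ^ DIM('a)) * (ennreal (diff_quot p u x y) * indicator \<Omega> y)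
      + ennreal (2 powr p) * (ennreal (\<bar>u y\<bar> powr p * (1 / \<delta> ^ (2 * DIM('a)))) * indicator E y) \<partial>lborel)"
  proof (intro nn_integral_mono)
    fix y
    have "a \<le> 2 powr p * 4 ^ DIM('a) * diff_quot p u x y + 2 powr p * (\<bar>u y\<bar> powr p * (1 / \<delta> ^ (2 * DIM('a))))"
      if y: "y \<in> E"
    proof -
      have "\<bar>u x\<bar> powr p \<le> (\<bar>u x - u y\<bar> + \<bar>u y\<bar>) powr p" using p by (intro powr_mono2) auto
      also have "\<dots> \<le> 2 powr p * (\<bar>u x - u y\<bar> powr p + \<bar>u y\<bar> powr p)"
        using p by (intro powr_add_le) auto
      also have "\<bar>u x - u y\<bar> powr p \<le> (2 * \<delta>) ^ (2 * DIM('a)) * diff_quot p u x y"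
        using Ed[OF y] p by (intro powr_diff_le_diff_quot) auto
      also have "(2 * \<delta>) ^ (2 * DIM('a)) = 4 ^ DIM('a) * \<delta> ^ (2 * DIM('a))"
        by (simp add: power_mult_distrib power_mult)
      finally have "\<bar>u x\<bar> powr p \<le> 2 powr p * (4 ^ DIM('a) * \<delta> ^ (2 * DIM('a)) * diff_quot p u x y + \<bar>u y\<bar> powr p)"
        by simp
      then have "a \<le> 2 powr p * (4 ^ DIM('a) * \<delta> ^ (2 * DIM('a)) * diff_quot p u x y + \<bar>u y\<bar> powr p) / \<delta> ^ (2 * DIM('a))"
        unfolding a_def using \<delta> by (intro divide_right_mono) auto
      then show ?thesis using \<delta> by (simp add: add_divide_distrib distrib_left mult.assoc)
    qed
    then have le: "y \<in> E \<Longrightarrow> ennreal a \<le> ennreal (2 powr p * 4 ^ DIM('a) * diff_quot p u x y + 2 powr p * (\<bar>u y\<bar> powr p * (1 / \<delta> ^ (2 * DIM('a)))))"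
      by (intro ennreal_leI)
    have dq: "diff_quot p u x y \<ge> 0" by (simp add: diff_quot_def)
    show "ennreal a * indicator E y \<le> ennreal (2 powr p * 4 ^ DIM('a)) * (ennreal (diff_quot p u x y) * indicator \<Omega> y)
      + ennreal (2 powr p) * (ennreal (\<bar>u y\<bar> powr p * (1 / \<delta> ^ (2 * DIM('a)))) * indicator E y)"
    proof (cases "y \<in> E")
      case True
      have "ennreal (2 powr p * 4 ^ DIM('a) * diff_quot p u x y + 2 powr p * (\<bar>u y\<bar> powr p * (1 / \<delta> ^ (2 * DIM('a)))))
        = ennreal (2 powr p * 4 ^ DIM('a)) * ennreal (diff_quot p u x y) + ennreal (2 powr p) * ennreal (\<bar>u y\<bar> powr p * (1 / \<delta> ^ (2 * DIM('a))))"
      proof -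
        have lin: "ennreal (P * a + Q * b) = ennreal P * ennreal a + ennreal Q * ennreal b"
          if "0 \<le> P" "0 \<le> a" "0 \<le> Q" "0 \<le> b" for P a Q b
          using that by (simp add: ennreal_mult)
        show ?thesis by (rule lin) (use dq \<delta> in auto)
      qed
      then show ?thesis using le True E\<Omega> by (auto simp: subset_eq)
    qed simp
  qed
  also have "\<dots> = ennreal (2 powr p * 4 ^ DIM('a)) * local_energy p \<Omega> u x
     + ennreal (2 powr p) * (\<integral>\<^sup>+y\<in>E. ennreal (\<bar>u y\<bar> powr p * (1 / \<delta> ^ (2 * DIM('a)))) \<partial>lborel)"
    unfolding local_energy_def diff_quot_def
    by (subst nn_integral_add) (auto intro!: arg_cong2[where f = "(+)"] nn_integral_cmult)
  finally have "ennreal (c / \<nu> * (\<bar>u x\<bar> powr p / \<delta> ^ DIM('a)))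
     \<le> ennreal (2 powr p * 4 ^ DIM('a)) * local_energy p \<Omega> u x
     + ennreal (2 powr p) * (\<integral>\<^sup>+y\<in>E. ennreal (\<bar>u y\<bar> powr p * (1 / \<delta> ^ (2 * DIM('a)))) \<partial>lborel)" .
  moreover have "ennreal (c / \<nu>) * ennreal (\<bar>u x\<bar> powr p / \<delta> ^ DIM('a))
      = ennreal (c / \<nu> * (\<bar>u x\<bar> powr p / \<delta> ^ DIM('a)))"
    using c \<nu> by (intro ennreal_mult'[symmetric]) auto
  ultimately show ?thesis by (simp only: E_def \<delta>_def)
qed

text \<open>
  Integrate the estimate of \<open>hardy_step\<close> and exchange the integrals in the second term. It becomes a multiple of
  \<open>1 / \<nu> ^ d\<close> times the left side, whereas the left side carries the factor \<open>1 / \<nu>\<close>. As \<open>d \<ge> 2\<close>, a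
  large \<open>\<nu>\<close> allows the absorption.
\<close>

lemma hardy_lipschitz:
  fixes \<Omega> :: "'a::euclidean_space set"
  assumes \<Omega>: "bounded_lipschitz_domain \<Omega>" and d: "2 \<le> DIM('a)" and p: "1 < p"
  shows "\<exists>H\<ge>0. \<forall>u\<in>cont_compact_support \<Omega>.
     (\<integral>\<^sup>+x\<in>\<Omega>. ennreal (\<bar>u x\<bar> powr p / bdry_dist \<Omega> x ^ DIM('a)) \<partial>lborel) \<le> ennreal H * energy p \<Omega> u"
proof -
  have op: "open \<Omega>" and bd: "bounded \<Omega>" and ne: "\<Omega> \<noteq> {}"
    using \<Omega> by (auto simp: bounded_lipschitz_domain_def)
  note fne = bounded_frontier_nonempty[OF bd ne]
  obtain c where c: "c > 0" and layer: "\<And>\<nu> x. 1 \<le> \<nu> \<Longrightarrow> x \<in> \<Omega> \<Longrightarrow>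
      c * bdry_dist \<Omega> x ^ DIM('a) \<le> \<nu> * measure lborel (outward_layer \<Omega> \<nu> x)"
    using measure_outward_layer_ge[OF \<Omega>] by blast
  define C where "C = 2 * 4 ^ DIM('a) * unit_ball_vol (DIM('a))"
  have C: "C > 0" by (simp add: C_def)
  \<comment> \<open>Since \<open>d \<ge> 2\<close>, this choice makes the coefficient of the term to be absorbed at most half of \<open>c / \<nu>\<close>.\<close>
  define \<nu> where "\<nu> = max 1 (2 * 2 powr p * C / c)"
  have \<nu>: "1 \<le> \<nu>" "2 powr p * C * 2 \<le> \<nu> * c" using c by (auto simp: \<nu>_def max_def field_simps)
  define A where "A = 2 powr p * (4::real) ^ DIM('a)"
  define H where "H = 2 * \<nu> * A / c"
  show ?thesis
  proof (intro exI[of _ H] conjI ballI)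
    show "0 \<le> H" using \<nu> c by (simp add: H_def A_def)
    fix u assume u: "u \<in> cont_compact_support \<Omega>"
    have cont: "continuous_on UNIV u" using u by (simp add: cont_compact_support_def)
    have [measurable]: "u \<in> borel_measurable borel" "\<Omega> \<in> sets borel" using cont op by auto
    define N where "N = (\<integral>\<^sup>+x\<in>\<Omega>. ennreal (\<bar>u x\<bar> powr p / bdry_dist \<Omega> x ^ DIM('a)) \<partial>lborel)"
    define w where "w x y = ennreal (\<bar>u y\<bar> powr p * (1 / bdry_dist \<Omega> x ^ (2 * DIM('a)))) * (indicator (outward_layer \<Omega> \<nu> x) y * indicator \<Omega> x)" for x y
    have [measurable]: "(\<lambda>(x, y). w x y) \<in> borel_measurable (lborel \<Otimes>\<^sub>M lborel)"
      unfolding w_def outward_layer_def indicator_def by measurable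
    have "ennreal (c / \<nu>) * N = (\<integral>\<^sup>+x. ennreal (c / \<nu>) * (ennreal (\<bar>u x\<bar> powr p / bdry_dist \<Omega> x ^ DIM('a)) * indicator \<Omega> x) \<partial>lborel)"
      unfolding N_def by (intro nn_integral_cmult[symmetric]) measurable
    also have "\<dots> \<le> (\<integral>\<^sup>+x. ennreal A * (local_energy p \<Omega> u x * indicator \<Omega> x)
         + ennreal (2 powr p) * (\<integral>\<^sup>+y. w x y \<partial>lborel) \<partial>lborel)"
    proof (intro nn_integral_mono)
      fix x
      show "ennreal (c / \<nu>) * (ennreal (\<bar>u x\<bar> powr p / bdry_dist \<Omega> x ^ DIM('a)) * indicator \<Omega> x)
        \<le> ennreal A * (local_energy p \<Omega> u x * indicator \<Omega> x) + ennreal (2 powr p) * (\<integral>\<^sup>+y. w x y \<partial>lborel)"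
        using hardy_step[OF op bd ne cont p \<nu>(1) _ c layer[OF \<nu>(1)], of x]
        by (cases "x \<in> \<Omega>") (auto simp: A_def w_def)
    qed
    also have "\<dots> = ennreal A * energy p \<Omega> u + ennreal (2 powr p) * (\<integral>\<^sup>+x. (\<integral>\<^sup>+y. w x y \<partial>lborel) \<partial>lborel)"
      unfolding energy_def
      by (subst nn_integral_add) (auto intro!: arg_cong2[where f = "(+)"] nn_integral_cmult)
    also have "(\<integral>\<^sup>+x. (\<integral>\<^sup>+y. w x y \<partial>lborel) \<partial>lborel) = (\<integral>\<^sup>+y. (\<integral>\<^sup>+x. w x y \<partial>lborel) \<partial>lborel)"
      by (intro lborel_pair.Fubini'[symmetric]) measurable
    also have "\<dots> \<le> (\<integral>\<^sup>+y. ennreal (C / \<nu> ^ DIM('a)) * (ennreal (\<bar>u y\<bar> powr p / bdry_dist \<Omega> y ^ DIM('a)) * indicator \<Omega> y) \<partial>lborel)"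
    proof (intro nn_integral_mono)
      fix y
      show "(\<integral>\<^sup>+x. w x y \<partial>lborel) \<le> ennreal (C / \<nu> ^ DIM('a)) * (ennreal (\<bar>u y\<bar> powr p / bdry_dist \<Omega> y ^ DIM('a)) * indicator \<Omega> y)"
      proof (cases "y \<in> \<Omega>")
        case True
        define m where "m = \<nu> * bdry_dist \<Omega> y"
        have m: "m > 0" using bdry_dist_pos[OF op fne True] \<nu> by (simp add: m_def)
        have "(\<integral>\<^sup>+x. w x y \<partial>lborel) \<le> (\<integral>\<^sup>+x. ennreal (\<bar>u y\<bar> powr p) * (ennreal (1 / bdry_dist \<Omega> x ^ (2 * DIM('a))) *
             indicator {x. m < bdry_dist \<Omega> x \<and> dist x y < 2 * bdry_dist \<Omega> x} x) \<partial>lborel)"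
        proof (intro nn_integral_mono)
          fix x
          show "w x y \<le> ennreal (\<bar>u y\<bar> powr p) * (ennreal (1 / bdry_dist \<Omega> x ^ (2 * DIM('a))) *
             indicator {x. m < bdry_dist \<Omega> x \<and> dist x y < 2 * bdry_dist \<Omega> x} x)"
            unfolding w_def by (subst ennreal_mult) (auto simp: indicator_def outward_layer_def m_def)
        qed
        also have "\<dots> = ennreal (\<bar>u y\<bar> powr p) * (\<integral>\<^sup>+x. (ennreal (1 / bdry_dist \<Omega> x ^ (2 * DIM('a))) *
             indicator {x. m < bdry_dist \<Omega> x \<and> dist x y < 2 * bdry_dist \<Omega> x} x) \<partial>lborel)"
          by (intro nn_integral_cmult) measurable
        also have "\<dots> \<le> ennreal (\<bar>u y\<bar> powr p) * ennreal (C / m ^ DIM('a))"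
          unfolding C_def by (intro mult_left_mono integral_above_height_le m) auto
        also have "\<dots> = ennreal (C / \<nu> ^ DIM('a)) * ennreal (\<bar>u y\<bar> powr p / bdry_dist \<Omega> y ^ DIM('a))"
          using C \<nu> by (simp add: m_def power_mult_distrib mult_ac flip: ennreal_mult')
        finally show ?thesis using True by simp
      qed (simp add: w_def outward_layer_def)
    qed
    also have "\<dots> = ennreal (C / \<nu> ^ DIM('a)) * N"
      unfolding N_def by (intro nn_integral_cmult) measurable
    finally have main: "ennreal (c / \<nu>) * N \<le> ennreal A * energy p \<Omega> u + ennreal (2 powr p) * (ennreal (C / \<nu> ^ DIM('a)) * N)"
      by (simp add: add_left_mono mult_left_mono)
    \<comment> \<open>Without finiteness the term in \<open>N\<close> on the right could not be subtracted.\<close>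
    have Nfin: "N < \<infinity>" unfolding N_def by (rule hardy_integral_finite[OF op fne u p])
    then obtain n where n: "N = ennreal n" "n \<ge> 0" by (cases N) auto
    have A: "A > 0" by (simp add: A_def)
    have H: "H > 0" using \<nu> c A by (simp add: H_def)
    show "N \<le> ennreal H * energy p \<Omega> u"
    proof (cases "energy p \<Omega> u")
      case top
      then show ?thesis using H by (simp add: ennreal_mult_eq_top_iff)
    next
      case (real I)
      have drop: "a * n \<le> A * I + P * Q * n"
        if "ennreal a * ennreal n \<le> ennreal A * ennreal I + ennreal P * (ennreal Q * ennreal n)"
          "0 \<le> P" "0 \<le> Q" "0 \<le> a" for a P Q
      proof -
        have "ennreal (a * n) \<le> ennreal (A * I + P * (Q * n))"
          using that n real A by (simp only: ennreal_mult ennreal_plus mult_nonneg_nonneg less_imp_le)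
        then show ?thesis using that n real A by (subst (asm) ennreal_le_iff) (auto simp: mult.assoc)
      qed
      have le: "c / \<nu> * n \<le> A * I + 2 powr p * (C / \<nu> ^ DIM('a)) * n"
        using main[unfolded n(1) real(2)] c C \<nu> by (intro drop) auto
      have "2 powr p * (C / \<nu> ^ DIM('a)) \<le> 2 powr p * (C / \<nu>\<^sup>2)"
        using C \<nu> d by (intro mult_left_mono divide_left_mono power_increasing) auto
      also have "\<dots> \<le> c / \<nu> / 2"
        using \<nu> by (simp add: field_simps power2_eq_square)
      finally have "2 powr p * (C / \<nu> ^ DIM('a)) * n \<le> c / \<nu> / 2 * n" using n by (intro mult_right_mono)
      with le have "c / \<nu> * n / 2 \<le> A * I" by simp
      then have "n \<le> H * I" using c \<nu> by (simp add: H_def field_simps)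
      then show ?thesis using n real H by (simp add: ennreal_mult'[symmetric] ennreal_leI)
    qed
  qed
qed

section \<open>The discrete Hardy inequality and one-dimensional domains\<close>

text \<open>
  Elliott's proof. With the means \<open>x\<close> and \<open>y\<close> of the first \<open>N + 1\<close> and \<open>N\<close> terms and
  \<open>e = E N\<close>, the recursion \<open>(N + 1) x = N y + e\<close> is multiplied by \<open>x powr (p - 1)\<close>, and both products are
  estimated by Young's inequality; the terms in \<open>y\<close> and \<open>x\<close> then telescope, which explains the extra summand
  in the induction.
\<close>

lemma discrete_hardy:
  fixes E :: "nat \<Rightarrow> real"
  assumes E: "\<And>n. 0 \<le> E n" and p: "1 < p"
  shows "(\<Sum>n<N. ((\<Sum>j\<le>n. E j) / (real n + 1)) powr p) \<le> 2 powr p / (p - 1) * (\<Sum>n<N. E n powr p)"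
proof -
  define a where "a n = (\<Sum>j<n. E j) / real n" for n
  define C where "C = 2 powr (p - 1) / (p - 1)"
  have a0: "a n \<ge> 0" for n using E by (simp add: a_def sum_nonneg)
  have "(\<Sum>n<N. a (Suc n) powr p) / 2 + real N / (p - 1) * a N powr p \<le> C * (\<Sum>n<N. E n powr p)"
  proof (induction N)
    case (Suc N)
    define x y e where "x = a (Suc N)" and "y = a N" and "e = E N"
    have nn: "x \<ge> 0" "y \<ge> 0" "e \<ge> 0" using a0 E by (auto simp: x_def y_def e_def)
    have rec: "(real N + 1) * x = real N * y + e"
      by (auto simp: x_def y_def e_def a_def field_simps)
    have xx: "x powr (p - 1) * x = x powr p"
      using nn p by (cases "x = 0") (auto simp: powr_diff)
    have 1: "x powr (p - 1) * y \<le> (p - 1) / p * x powr p + y powr p / p"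
      using p nn by (intro powr_young) auto
    \<comment> \<open>The factor \<open>2\<close> halves the contribution of this product to \<open>x powr p\<close>, so that half of that term survives.\<close>
    have 2: "x powr (p - 1) * (2 * e) \<le> (p - 1) / p * x powr p + (2 * e) powr p / p"
      using p nn by (intro powr_young) auto
    have e2: "(2 * e) powr p = 2 * 2 powr (p - 1) * e powr p"
      using nn p by (simp add: powr_mult powr_diff)
    have "(real N + 1) * x powr p = x powr (p - 1) * ((real N + 1) * x)"
      by (simp add: xx[symmetric] mult_ac)
    also have "\<dots> = real N * (x powr (p - 1) * y) + x powr (p - 1) * (2 * e) / 2"
      by (simp add: rec distrib_left)
    also have "\<dots> \<le> real N * ((p - 1) / p * x powr p + y powr p / p)
        + ((p - 1) / p * x powr p + (2 * 2 powr (p - 1) * e powr p) / p) / 2"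
      using 1 2 e2 by (intro add_mono mult_left_mono divide_right_mono) auto
    finally have le: "(real N + 1) * x powr p \<le> real N * ((p - 1) / p * x powr p + y powr p / p)
        + ((p - 1) / p * x powr p + (2 * 2 powr (p - 1) * e powr p) / p) / 2" .
    have alg: "P / 2 + (n + 1) / (p - 1) * P \<le> n / (p - 1) * Q + t / (p - 1) * r"
      if "(n + 1) * P \<le> n * ((p - 1) / p * P + Q / p) + ((p - 1) / p * P + 2 * t * r / p) / 2" for n P Q t r
    proof -
      have "(n + 1) * P * p \<le> n * ((p - 1) * P + Q) + ((p - 1) * P + 2 * t * r) / 2"
      proof -
        have "(n * ((p - 1) / p * P + Q / p) + ((p - 1) / p * P + 2 * t * r / p) / 2) * p
          = n * ((p - 1) * P + Q) + ((p - 1) * P + 2 * t * r) / 2"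
          using p by (simp add: field_simps)
        then show ?thesis using mult_right_mono[OF that, of p] p by simp
      qed
      then have "P * (p - 1) / 2 + (n + 1) * P \<le> n * Q + t * r" by (simp add: field_simps)
      then have "(P * (p - 1) / 2 + (n + 1) * P) / (p - 1) \<le> (n * Q + t * r) / (p - 1)"
        using p by (intro divide_right_mono) auto
      moreover have "(P * (p - 1) / 2 + (n + 1) * P) / (p - 1) = P / 2 + (n + 1) / (p - 1) * P"
        using p by (simp add: field_simps)
      ultimately show ?thesis by (simp add: add_divide_distrib)
    qed
    have "x powr p / 2 + (real N + 1) / (p - 1) * x powr p \<le> real N / (p - 1) * y powr p + C * e powr p"
      unfolding C_def by (rule alg) (use le in \<open>simp add: mult.assoc\<close>)
    moreover have "real (Suc N) / (p - 1) * a (Suc N) powr p = (real N + 1) / (p - 1) * x powr p"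
      by (simp add: x_def add.commute)
    moreover have "(\<Sum>n<Suc N. a (Suc n) powr p) / 2 = (\<Sum>n<N. a (Suc n) powr p) / 2 + x powr p / 2"
      by (simp add: x_def add_divide_distrib)
    moreover have "C * (\<Sum>n<Suc N. E n powr p) = C * (\<Sum>n<N. E n powr p) + C * e powr p"
      by (simp add: e_def distrib_left)
    ultimately show ?case using Suc unfolding y_def by linarith
  qed simp
  moreover have "0 \<le> real N / (p - 1) * a N powr p" using p by auto
  ultimately have "(\<Sum>n<N. a (Suc n) powr p) \<le> 2 * C * (\<Sum>n<N. E n powr p)" by simp
  moreover have "2 * C = 2 powr p / (p - 1)" using p by (simp add: C_def powr_diff field_simps)
  ultimately show ?thesis by (simp add: a_def lessThan_Suc_atMost add.commute)
qed

lemma open_bounded_connected_real: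
  fixes J :: "real set"
  assumes "open J" "bounded J" "connected J" "J \<noteq> {}"
  shows "\<exists>l h. l < h \<and> J = {l<..<h}"
proof (intro exI conjI)
  have ba: "bdd_above J" "bdd_below J" using assms by (auto simp: bounded_imp_bdd_above bounded_imp_bdd_below)
  have gt: "Inf J < x" "x < Sup J" if x: "x \<in> J" for x
  proof -
    obtain r where r: "r > 0" "ball x r \<subseteq> J" using assms(1) x by (meson openE)
    then have "x - r / 2 \<in> J" "x + r / 2 \<in> J" by (auto simp: dist_real_def subset_eq)
    then show "Inf J < x" "x < Sup J"
      using cInf_lower[of "x - r/2" J] cSup_upper[of "x + r/2" J] ba r by auto
  qed
  obtain x where x: "x \<in> J" using assms by auto
  then show "Inf J < Sup J" using gt[OF x] by linarith
  show "J = {Inf J<..<Sup J}"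
  proof
    show "J \<subseteq> {Inf J<..<Sup J}" using gt by auto
    show "{Inf J<..<Sup J} \<subseteq> J"
    proof
      fix y assume y: "y \<in> {Inf J<..<Sup J}"
      obtain a where a: "a \<in> J" "a < y" using y ba assms by (auto simp: cInf_less_iff)
      obtain b where b: "b \<in> J" "y < b" using y ba assms by (auto simp: less_cSup_iff)
      show "y \<in> J"
        using assms(3) a b unfolding is_interval_connected_1[symmetric] is_interval_1
        by (meson less_imp_le)
    qed
  qed
qed

text \<open>
  The coordinate with respect to the only basis vector is an isometry onto the real line.
\<close>

lemma domain_dim1_ball:
  fixes \<Omega> :: "'a::euclidean_space set" and b :: 'a
  assumes d: "DIM('a) = 1" and \<Omega>: "open \<Omega>" "bounded \<Omega>" "connected \<Omega>" "\<Omega> \<noteq> {}"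
    and b: "Basis = {b}"
  shows "\<exists>m R. 0 < R \<and> \<Omega> = ball m R"
proof -
  have rep: "y = (y \<bullet> b) *\<^sub>R b" for y using euclidean_representation[of y] by (simp add: b)
  have bb: "b \<bullet> b = 1" "norm b = 1" using b by (auto intro: inner_same_Basis norm_Basis)
  define J where "J = (\<lambda>y. y \<bullet> b) ` \<Omega>"
  have mem: "y \<in> \<Omega> \<longleftrightarrow> y \<bullet> b \<in> J" for y
  proof
    assume "y \<bullet> b \<in> J"
    then obtain z where "z \<in> \<Omega>" "y \<bullet> b = z \<bullet> b" by (auto simp: J_def)
    then show "y \<in> \<Omega>" using rep[of y] rep[of z] by simp
  qed (simp add: J_def)
  have "J = (\<lambda>t. t *\<^sub>R b) -` \<Omega>"
  proof (intro set_eqI)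
    fix t show "t \<in> J \<longleftrightarrow> t \<in> (\<lambda>t. t *\<^sub>R b) -` \<Omega>" using mem[of "t *\<^sub>R b"] bb by simp
  qed
  moreover have "open ((\<lambda>t. t *\<^sub>R b) -` \<Omega>)"
    by (intro open_vimage \<Omega> continuous_intros)
  moreover have "connected J" unfolding J_def by (intro connected_continuous_image \<Omega> continuous_intros)
  moreover have "bounded J" unfolding J_def
    by (intro bounded_linear_image \<Omega> bounded_linear_inner_left)
  moreover have "J \<noteq> {}" using \<Omega> by (simp add: J_def)
  ultimately obtain l h where lh: "l < h" "J = {l<..<h}" using open_bounded_connected_real[of J] by auto
  define m where "m = ((l + h) / 2) *\<^sub>R b"
  have "dist m y = \<bar>(l + h) / 2 - y \<bullet> b\<bar>" for y
  proof -
    have "m - y = ((l + h) / 2 - y \<bullet> b) *\<^sub>R b" using rep[of y] by (simp add: m_def scaleR_diff_left)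
    then show ?thesis using bb by (simp add: dist_norm)
  qed
  then have "\<Omega> = ball m ((h - l) / 2)"
    using mem lh by (auto simp: abs_less_iff field_simps)
  then show ?thesis using lh by (intro exI[of _ m] exI[of _ "(h - l) / 2"]) auto
qed

section \<open>The logarithmic Hardy inequality on an interval\<close>

text \<open>
  One half of the interval around \<open>m\<close> of radius \<open>R\<close>, in the direction of the unit vector \<open>e\<close>. The other
  half is the same situation for \<open>- e\<close>.
\<close>

locale centered_interval =
  fixes m e :: "'a::euclidean_space" and R :: real
  assumes dim1: "DIM('a) = 1" and e: "norm e = 1" and R: "0 < R"
begin

text \<open>
  The layer of points at distance between \<open>R / 2 ^ (k + 1)\<close> and \<open>R / 2 ^ k\<close> from the end point
  in direction \<open>e\<close>; its length is \<open>R / 2 ^ (k + 1)\<close>.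
\<close>

definition Q :: "nat \<Rightarrow> 'a set" where
  "Q k = {y. (1 - 1 / 2 ^ k) * R \<le> (y - m) \<bullet> e \<and> (y - m) \<bullet> e < (1 - 1 / 2 ^ Suc k) * R}"

lemma norm_eq_abs_inner: "norm y = \<bar>y \<bullet> e\<bar>"
proof -
  obtain b where b: "Basis = {b::'a}" using dim1 by (auto simp: card_1_singleton_iff)
  have rep: "y = (y \<bullet> b) *\<^sub>R b" for y using euclidean_representation[of y] by (simp add: b)
  have nb: "norm b = 1" "b \<bullet> b = 1" using b by (auto intro: inner_same_Basis norm_Basis)
  have n: "norm y = \<bar>y \<bullet> b\<bar>" for y by (subst rep) (simp add: nb)
  have "y \<bullet> e = (y \<bullet> b) * (e \<bullet> b)" by (subst rep, subst (2) rep) (simp add: nb)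
  then show ?thesis using n[of e] e n[of y] by (simp add: abs_mult)
qed

lemma dist_eq_abs_inner: "dist y z = \<bar>(y - m) \<bullet> e - (z - m) \<bullet> e\<bar>"
  by (simp add: dist_norm norm_eq_abs_inner inner_diff_left)

lemma Q_sets [measurable, simp]: "Q k \<in> sets borel"
  unfolding Q_def by measurable

lemma Q_norm:
  assumes "y \<in> Q k"
  shows "dist m y = (y - m) \<bullet> e" "dist m y < R - R / 2 ^ Suc k" "R - R / 2 ^ k \<le> dist m y"
proof -
  have "0 \<le> (1 - 1 / 2 ^ k) * R" using R by (intro mult_nonneg_nonneg) auto
  then have "0 \<le> (y - m) \<bullet> e" using assms unfolding Q_def by auto
  then show "dist m y = (y - m) \<bullet> e" by (simp add: dist_eq_abs_inner)
  then show "dist m y < R - R / 2 ^ Suc k" "R - R / 2 ^ k \<le> dist m y"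
    using assms unfolding Q_def by (auto simp: algebra_simps)
qed

lemma Q_subset: "Q k \<subseteq> ball m R"
proof
  fix y assume "y \<in> Q k"
  from Q_norm(2)[OF this] have "dist m y < R - R / 2 ^ Suc k" .
  moreover have "R / 2 ^ Suc k > 0" using R by simp
  ultimately show "y \<in> ball m R" by simp
qed

lemma Q_bounded [simp]: "bounded (Q k)"
  using bounded_subset[OF bounded_ball Q_subset] .

lemma Q_dist:
  assumes "y \<in> Q k" "z \<in> Q k \<union> Q (Suc k)"
  shows "norm (y - z) \<le> R / 2 ^ k"
proof -
  have "R / 2 ^ Suc k > 0" "R / 2 ^ Suc (Suc k) > 0" "R / 2 ^ Suc k \<le> R / 2 ^ k"
    using R by (auto simp: field_simps)
  moreover have "R - R / 2 ^ k \<le> dist m z" "dist m z < R"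
    using assms(2) Q_norm[of z k] Q_norm[of z "Suc k"] calculation by auto
  moreover have "R - R / 2 ^ k \<le> dist m y" "dist m y < R"
    using Q_norm[OF assms(1)] calculation by auto
  moreover have "dist y z = \<bar>dist m y - dist m z\<bar>"
    using assms Q_norm(1)[of y k] Q_norm(1)[of z k] Q_norm(1)[of z "Suc k"] by (auto simp: dist_eq_abs_inner[of y z])
  ultimately show ?thesis by (simp add: dist_norm[symmetric])
qed

lemma Q_disjoint: "disjoint_family Q"
proof -
  have "Q i \<inter> Q j = {}" if "i < j" for i j
  proof -
    have "R / 2 ^ j \<le> R / 2 ^ Suc i"
      using R that by (intro divide_left_mono power_increasing) auto
    then show ?thesis using Q_norm(2)[of _ i] Q_norm(3)[of _ j] by fastforce
  qed
  then show ?thesis unfolding disjoint_family_on_def by (metis Int_commute linorder_neqE_nat)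
qed

lemma measure_Q: "measure lborel (Q k) = R / 2 ^ Suc k"
proof -
  define r where "r = R / 2 ^ Suc (Suc k)"
  define z where "z = m + (R - 3 * r) *\<^sub>R e"
  have r: "r > 0" "R / 2 ^ k = 4 * r" "R / 2 ^ Suc k = 2 * r" using R by (auto simp: r_def)
  have ee: "e \<bullet> e = 1" using e by (simp add: norm_eq_1)
  have d: "dist z y = \<bar>R - 3 * r - (y - m) \<bullet> e\<bar>" for y
    by (simp add: dist_eq_abs_inner z_def ee)
  have Q: "Q k = {y. R - 4 * r \<le> (y - m) \<bullet> e \<and> (y - m) \<bullet> e < R - 2 * r}"
  proof -
    have "(1 - 1 / 2 ^ k) * R = R - R / 2 ^ k" for k by (simp add: left_diff_distrib)
    then show ?thesis unfolding Q_def by (simp only: r)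
  qed
  \<comment> \<open>The layer lies between the open and the closed ball around its midpoint.\<close>
  have sub: "ball z r \<subseteq> Q k" "Q k \<subseteq> cball z r" unfolding Q by (auto simp: d)
  have "emeasure lborel (Q k) < \<infinity>" by (rule emeasure_bounded_finite) simp
  then have "measure lborel (ball z r) \<le> measure lborel (Q k)"
    by (intro measure_mono_fmeasurable sub) (auto simp: fmeasurable_def)
  moreover have "measure lborel (Q k) \<le> measure lborel (cball z r)"
    using emeasure_bounded_finite[OF bounded_cball[of z r]]
    by (intro measure_mono_fmeasurable sub) (auto simp: fmeasurable_def)
  ultimately have "measure lborel (Q k) = 2 * r"
    using r dim1 by (simp add: content_ball content_cball)
  then show ?thesis using r by simp
qed

lemma exists_Q:
  assumes "y \<in> ball m R" "0 \<le> (y - m) \<bullet> e"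
  shows "\<exists>k. y \<in> Q k"
proof -
  define t where "t = (y - m) \<bullet> e"
  have t: "0 \<le> t" "t < R" using assms by (auto simp: t_def dist_eq_abs_inner)
  define k where "k = nat \<lfloor>log 2 (R / (R - t))\<rfloor>"
  have "log 2 (R / (R - t)) \<ge> 0" using t by simp
  then have kb: "real k \<le> log 2 (R / (R - t))" "log 2 (R / (R - t)) < real k + 1"
    by (auto simp: k_def)
  have pos: "R / (R - t) > 0" using t R by simp
  have "2 powr real k \<le> R / (R - t)" using kb pos by (simp add: le_log_iff)
  then have "2 ^ k * (R - t) \<le> R" using t by (simp add: powr_realpow field_simps)
  then have 1: "R - t \<le> R / 2 ^ k" by (simp add: field_simps)
  have "R / (R - t) < 2 powr (real k + 1)" using kb pos by (simp add: log_less_iff)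
  then have "R < 2 ^ Suc k * (R - t)" using t by (simp add: powr_add powr_realpow field_simps)
  then have 2: "R / 2 ^ Suc k < R - t" by (simp add: field_simps)
  have "y \<in> Q k" unfolding Q_def using 1 2 by (simp add: left_diff_distrib t_def)
  then show ?thesis ..
qed

lemma bdry_dist_ge: "R - dist m y \<le> bdry_dist (ball m R) y"
proof -
  have "sphere m R \<noteq> {}" using e R by (intro ex_in_conv[THEN iffD1] exI[of _ "m + R *\<^sub>R e"]) (simp add: dist_norm)
  then have "R - dist m y \<le> (INF z\<in>sphere m R. dist y z)"
    using dist_triangle[of m _ y] by (intro cINF_greatest) (auto simp: algebra_simps)
  then show ?thesis using \<open>sphere m R \<noteq> {}\<close> R by (simp add: bdry_dist_def infdist_notempty)
qed

lemma bdry_dist_Q: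
  assumes "y \<in> Q k"
  shows "R / 2 ^ Suc k \<le> bdry_dist (ball m R) y" "bdry_dist (ball m R) y \<le> R / 2 ^ k"
proof -
  show "R / 2 ^ Suc k \<le> bdry_dist (ball m R) y"
    using bdry_dist_ge[of y] Q_norm[OF assms] by linarith
  define z where "z = m + R *\<^sub>R e"
  have ee: "e \<bullet> e = 1" using e by (simp add: norm_eq_1)
  have "z \<in> frontier (ball m R)" using R e by (simp add: z_def dist_norm)
  then have "bdry_dist (ball m R) y \<le> dist y z" unfolding bdry_dist_def by (rule infdist_le)
  also have "\<dots> = \<bar>(y - m) \<bullet> e - R\<bar>" by (simp add: dist_eq_abs_inner z_def ee)
  also have "\<dots> \<le> R / 2 ^ k"
  proof -
    have "R / 2 ^ Suc k > 0" using R by simp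
    then show ?thesis using Q_norm[OF assms] by linarith
  qed
  finally show "bdry_dist (ball m R) y \<le> R / 2 ^ k" .
qed

text \<open>
  The measures of the layers are comparable with their diameters, so that the scale cancels
  as for shells. The second estimate starts the chain at the average over the whole interval.
\<close>

lemma averages_step:
  assumes u: "continuous_on UNIV u" and p: "1 < p"
  shows "ennreal (\<bar>set_average (Q k) u - set_average (Q (Suc k)) u\<bar> powr p)
     \<le> 8 * (\<integral>\<^sup>+y\<in>Q k. local_energy p (ball m R) u y \<partial>lborel)"
    and "ennreal (\<bar>set_average (Q 0) u - set_average (ball m R) u\<bar> powr p)
     \<le> 8 * (\<integral>\<^sup>+y\<in>Q 0. local_energy p (ball m R) u y \<partial>lborel)"
proof -
  let ?J = "\<lambda>k. \<integral>\<^sup>+y\<in>Q k. local_energy p (ball m R) u y \<partial>lborel"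
  define q where "q = R / 2 ^ k"
  have q: "q > 0" using R by (simp add: q_def)
  have "ennreal (measure lborel (Q k) * measure lborel (Q (Suc k)) * \<bar>set_average (Q k) u - set_average (Q (Suc k)) u\<bar> powr p)
     \<le> ennreal (q ^ (2 * DIM('a))) * ?J k"
    unfolding q_def using R Q_dist Q_subset by (intro two_averages_le u p) auto
  moreover have "measure lborel (Q k) * measure lborel (Q (Suc k)) = q\<^sup>2 / 8" "q ^ (2 * DIM('a)) = q\<^sup>2 / 8 * 8"
    using dim1 by (auto simp: measure_Q q_def power2_eq_square)
  ultimately have "ennreal (q\<^sup>2 / 8 * \<bar>set_average (Q k) u - set_average (Q (Suc k)) u\<bar> powr p)
     \<le> ennreal (q\<^sup>2 / 8 * 8) * ?J k"
    by metis
  from ennreal_scale_le[OF _ _ this]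
  show "ennreal (\<bar>set_average (Q k) u - set_average (Q (Suc k)) u\<bar> powr p)
     \<le> 8 * ?J k"
    using q by simp
  have "ennreal (measure lborel (Q 0) * measure lborel (ball m R) * \<bar>set_average (Q 0) u - set_average (ball m R) u\<bar> powr p)
     \<le> ennreal ((2 * R) ^ (2 * DIM('a))) * ?J 0"
  proof (intro two_averages_le u p)
    fix y z assume "y \<in> Q 0" "z \<in> ball m R"
    then have "dist m y < R" "dist m z < R" using Q_subset[of 0] by auto
    then show "norm (y - z) \<le> 2 * R"
      using dist_triangle2[of y z m] by (simp add: dist_norm[symmetric] dist_commute)
  qed (use R in auto)
  moreover have "measure lborel (Q 0) * measure lborel (ball m R) = R\<^sup>2" "(2 * R) ^ (2 * DIM('a)) = R\<^sup>2 * 4"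
    using dim1 R by (auto simp: measure_Q content_ball power2_eq_square)
  ultimately have "ennreal (R\<^sup>2 * \<bar>set_average (Q 0) u - set_average (ball m R) u\<bar> powr p)
     \<le> ennreal (R\<^sup>2 * 4) * ?J 0"
    by metis
  from ennreal_scale_le[OF _ _ this]
  have "ennreal (\<bar>set_average (Q 0) u - set_average (ball m R) u\<bar> powr p)
     \<le> 4 * ?J 0"
    using R by simp
  also have "\<dots> \<le> 8 * ?J 0"
    by (intro mult_right_mono) auto
  finally show "ennreal (\<bar>set_average (Q 0) u - set_average (ball m R) u\<bar> powr p)
     \<le> 8 * ?J 0" .
qed

end

context centered_interval
begin

text \<open>
  On the \<open>k\<close>-th layer the logarithm is at least \<open>(k + 1) ln 2\<close>, and the integral of \<open>1 / \<delta>\<close> over the layer is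
  bounded. The deviation of \<open>u\<close> from its average over the layer is controlled by the energy of that layer. The
  deviation of this average from \<open>c\<close> is at most the sum of the differences \<open>E 0, ..., E k\<close>, and divided by
  \<open>k + 1\<close> it is handled by the discrete Hardy inequality.
\<close>

lemma log_hardy_half:
  assumes u: "continuous_on UNIV u" and p: "1 < p" and I: "energy p (ball m R) u \<le> ennreal I" "0 \<le> I"
    and \<rho>: "R \<le> \<rho>"
  shows "(\<integral>\<^sup>+y\<in>(\<Union>k. Q k). ennreal ((\<bar>u y - set_average (ball m R) u\<bar> / ln (2 * \<rho> / bdry_dist (ball m R) y)) powr p
       / bdry_dist (ball m R) y) \<partial>lborel)
    \<le> ennreal ((2 / ln 2) powr p * (4 + 16 * 2 powr p / (p - 1)) * I)"
proof -
  define \<Omega> where "\<Omega> = ball m R"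
  define c where "c = set_average \<Omega> u"
  define a where "a k = set_average (Q k) u" for k
  define J where "J k = (\<integral>\<^sup>+y\<in>Q k. local_energy p \<Omega> u y \<partial>lborel)" for k
  define g where "g k = enn2real (J k)" for k
  \<comment> \<open>\<open>E 0\<close> leads from the average over the interval to the first layer, \<open>E (Suc j)\<close> from layer \<open>j\<close> to layer \<open>Suc j\<close>.\<close>
  define E where "E n = (case n of 0 \<Rightarrow> \<bar>a 0 - c\<bar> | Suc j \<Rightarrow> \<bar>a j - a (Suc j)\<bar>)" for n
  define f where "f y = ennreal ((\<bar>u y - c\<bar> / ln (2 * \<rho> / bdry_dist \<Omega> y)) powr p / bdry_dist \<Omega> y)" for y
  have [measurable]: "u \<in> borel_measurable borel" "\<Omega> \<in> sets borel" using u by (auto simp: \<Omega>_def)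
  have fm [measurable]: "f \<in> borel_measurable borel" unfolding f_def by measurable
  have sumJ: "(\<Sum>k<N. J k) \<le> ennreal I" for N
    using disjoint_energy_sum_le[OF u _ Q_disjoint Q_sets Q_subset, where k = N and p = p] I(1)
    by (simp add: J_def \<Omega>_def)
  have J: "J k = ennreal (g k)" "0 \<le> g k" for k
  proof -
    have "J k \<le> (\<Sum>j<Suc k. J j)" by simp
    also have "\<dots> \<le> ennreal I" by (rule sumJ)
    finally have "J k < \<infinity>" using le_less_trans ennreal_less_top by fastforce
    then show "J k = ennreal (g k)" "0 \<le> g k" by (auto simp: g_def)
  qed
  have sumg: "(\<Sum>k<N. g k) \<le> I" for N
    using sumJ[of N] I(2) by (simp add: J sum_ennreal)
  have "E n \<ge> 0" for n by (auto simp: E_def split: nat.split)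
  have E0: "E 0 powr p \<le> 8 * g 0" and ES: "E (Suc k) powr p \<le> 8 * g k" for k
    using averages_step[OF u p] J
    by (simp_all add: E_def a_def c_def \<Omega>_def[symmetric] J_def[symmetric] ennreal_mult'[symmetric] flip: ennreal_numeral)
  have sumE: "(\<Sum>n<N. E n powr p) \<le> 16 * I" for N
  proof -
    have "(\<Sum>n<N. E n powr p) \<le> (\<Sum>n<Suc N. E n powr p)" by simp
    also have "\<dots> = E 0 powr p + (\<Sum>n<N. E (Suc n) powr p)" by (rule sum.lessThan_Suc_shift)
    also have "\<dots> \<le> 8 * g 0 + (\<Sum>n<N. 8 * g n)" by (intro add_mono sum_mono E0 ES)
    also have "\<dots> \<le> 8 * I + 8 * I"
      using sumg[of 1] sumg[of N] by (simp flip: sum_distrib_left)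
    finally show ?thesis by simp
  qed
  have chain: "\<bar>a k - c\<bar> \<le> (\<Sum>j\<le>k. E j)" for k
  proof (induction k)
    case (Suc k)
    have "\<bar>a (Suc k) - c\<bar> \<le> \<bar>a k - c\<bar> + E (Suc k)" by (simp add: E_def)
    then show ?case using Suc by simp
  qed (simp add: E_def)
  define B where "B k = (2 / ln 2) powr p * (4 * g k + ((\<Sum>j\<le>k. E j) / (real k + 1)) powr p)" for k
  have half: "(\<integral>\<^sup>+y\<in>Q k. f y \<partial>lborel) \<le> ennreal (B k)" for k
  proof -
    define q where "q = R / 2 ^ Suc k"
    define l where "l = (real k + 1) * ln 2"
    define K where "K = 2 powr p / (q * l powr p)"
    have q: "q > 0" using R by (simp add: q_def)
    have l: "l > 0" by (simp add: l_def)
    have K: "K > 0" using q l by (simp add: K_def)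
    have mQ: "measure lborel (Q k) = q" by (simp add: measure_Q q_def)
    have pt: "f y \<le> ennreal K * (ennreal (4 * q) * local_energy p \<Omega> u y + ennreal (\<bar>a k - c\<bar> powr p))"
      if y: "y \<in> Q k" for y
    proof -
      define \<delta> where "\<delta> = bdry_dist \<Omega> y"
      have \<delta>: "q \<le> \<delta>" "\<delta> \<le> 2 * q" using bdry_dist_Q[OF y] by (auto simp: \<delta>_def \<Omega>_def q_def)
      have d0: "\<delta> > 0" using \<delta> q by linarith
      have "2 ^ Suc k = 2 * R / (2 * q)" using R by (simp add: q_def)
      also have "\<dots> \<le> 2 * \<rho> / \<delta>" using \<rho> R \<delta> d0 q by (intro frac_le) auto
      finally have "ln (2 ^ Suc k) \<le> ln (2 * \<rho> / \<delta>)" by (simp add: ln_mono)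
      then have ll: "l \<le> ln (2 * \<rho> / \<delta>)" by (simp add: l_def ln_realpow add.commute del: power_Suc)
      have "(\<bar>u y - c\<bar> / ln (2 * \<rho> / \<delta>)) powr p / \<delta> \<le> (\<bar>u y - c\<bar> / l) powr p / q"
        using ll l \<delta> q p by (intro frac_le powr_mono2 divide_left_mono) auto
      also have "\<dots> = \<bar>u y - c\<bar> powr p / (q * l powr p)" using l by (simp add: powr_divide)
      also have "\<dots> \<le> 2 powr p * (\<bar>u y - a k\<bar> powr p + \<bar>a k - c\<bar> powr p) / (q * l powr p)"
      proof -
        have "\<bar>u y - c\<bar> powr p \<le> (\<bar>u y - a k\<bar> + \<bar>a k - c\<bar>) powr p" using p by (intro powr_mono2) auto
        also have "\<dots> \<le> 2 powr p * (\<bar>u y - a k\<bar> powr p + \<bar>a k - c\<bar> powr p)"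
          using p by (intro powr_add_le) auto
        finally show ?thesis using q l by (intro divide_right_mono) auto
      qed
      also have "\<dots> = K * (\<bar>u y - a k\<bar> powr p + \<bar>a k - c\<bar> powr p)" by (simp add: K_def)
      finally have "f y \<le> ennreal (K * (\<bar>u y - a k\<bar> powr p + \<bar>a k - c\<bar> powr p))"
        unfolding f_def \<delta>_def by (rule ennreal_leI)
      also have "\<dots> = ennreal K * (ennreal (\<bar>u y - a k\<bar> powr p) + ennreal (\<bar>a k - c\<bar> powr p))"
        using K by (simp add: ennreal_mult)
      also have "\<dots> \<le> ennreal K * (ennreal (4 * q) * local_energy p \<Omega> u y + ennreal (\<bar>a k - c\<bar> powr p))"
      proof (intro mult_left_mono add_right_mono)
        have "ennreal (measure lborel (Q k) * \<bar>u y - set_average (Q k) u\<bar> powr p)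
            \<le> ennreal ((2 * q) ^ (2 * DIM('a))) * local_energy p \<Omega> u y"
          using Q_dist[OF y] q Q_subset by (intro point_average_le u p) (auto simp: q_def \<Omega>_def)
        then have "ennreal (q * \<bar>u y - a k\<bar> powr p) \<le> ennreal ((2 * q) ^ (2 * DIM('a))) * local_energy p \<Omega> u y"
          unfolding mQ a_def .
        moreover have "(2 * q) ^ (2 * DIM('a)) = q * (4 * q)" using dim1 by (simp add: power2_eq_square)
        ultimately have "ennreal (q * \<bar>u y - a k\<bar> powr p) \<le> ennreal (q * (4 * q)) * local_energy p \<Omega> u y"
          by (simp only:)
        from ennreal_scale_le[OF q _ this]
        show "ennreal (\<bar>u y - a k\<bar> powr p) \<le> ennreal (4 * q) * local_energy p \<Omega> u y"
          using q by simp
      qed auto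
      finally show ?thesis .
    qed
    have "(\<integral>\<^sup>+y\<in>Q k. f y \<partial>lborel) \<le> (\<integral>\<^sup>+y. ennreal K * (ennreal (4 * q) * (local_energy p \<Omega> u y * indicator (Q k) y)
        + ennreal (\<bar>a k - c\<bar> powr p) * indicator (Q k) y) \<partial>lborel)"
      using pt by (intro nn_integral_mono) (auto simp: indicator_def)
    also have "\<dots> = ennreal K * (ennreal (4 * q) * J k + ennreal (\<bar>a k - c\<bar> powr p) * emeasure lborel (Q k))"
      unfolding J_def by (simp add: nn_integral_cmult nn_integral_add nn_integral_cmult_indicator)
    also have "emeasure lborel (Q k) = ennreal q"
      using emeasure_bounded_finite[OF Q_bounded, of k] mQ by (simp add: emeasure_eq_ennreal_measure)
    also have "ennreal K * (ennreal (4 * q) * J k + ennreal (\<bar>a k - c\<bar> powr p) * ennreal q)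
       = ennreal (K * (4 * q * g k + \<bar>a k - c\<bar> powr p * q))"
    proof -
      have lin: "ennreal K * (ennreal r * ennreal s + ennreal t * ennreal v) = ennreal (K * (r * s + t * v))"
        if "0 \<le> r" "0 \<le> s" "0 \<le> t" "0 \<le> v" for r s t v
        using that K by (simp add: ennreal_mult)
      show ?thesis unfolding J by (rule lin) (use q J in auto)
    qed
    also have "K * (4 * q * g k + \<bar>a k - c\<bar> powr p * q) = 2 powr p / l powr p * (4 * g k + \<bar>a k - c\<bar> powr p)"
    proof -
      have "K * q = 2 powr p / l powr p" using q by (simp add: K_def)
      moreover have "K * (4 * q * g k + \<bar>a k - c\<bar> powr p * q) = K * q * (4 * g k + \<bar>a k - c\<bar> powr p)"
        by (simp add: algebra_simps)
      ultimately show ?thesis by simp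
    qed
    also have "\<dots> \<le> B k"
    proof -
      have kp: "(real k + 1) powr p \<ge> 1" using p by (intro ge_one_powr_ge_zero) auto
      have "l powr p = (real k + 1) powr p * ln 2 powr p" unfolding l_def by (rule powr_mult)
      then have "2 powr p / l powr p * (4 * g k + \<bar>a k - c\<bar> powr p)
          = (2 / ln 2) powr p * ((4 * g k + \<bar>a k - c\<bar> powr p) / (real k + 1) powr p)"
        by (simp add: powr_divide)
      also have "\<dots> \<le> B k" unfolding B_def
      proof (intro mult_left_mono)
        have "4 * g k / (real k + 1) powr p \<le> 4 * g k / 1" using kp J by (intro divide_left_mono) auto
        moreover have "\<bar>a k - c\<bar> powr p / (real k + 1) powr p \<le> ((\<Sum>j\<le>k. E j) / (real k + 1)) powr p"
          unfolding powr_divide[symmetric]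
          using chain p by (intro powr_mono2 divide_right_mono) auto
        ultimately show "(4 * g k + \<bar>a k - c\<bar> powr p) / (real k + 1) powr p
            \<le> 4 * g k + ((\<Sum>j\<le>k. E j) / (real k + 1)) powr p"
          by (simp add: add_divide_distrib)
      qed auto
      finally show ?thesis .
    qed
    finally show ?thesis by (simp add: ennreal_leI)
  qed
  define H where "H = (2 / ln 2) powr p * (4 + 16 * 2 powr p / (p - 1)) * I"
  have sumB: "(\<Sum>k<N. B k) \<le> H" for N
  proof -
    have "(\<Sum>k<N. B k) = (2 / ln 2) powr p * (4 * (\<Sum>k<N. g k) + (\<Sum>k<N. ((\<Sum>j\<le>k. E j) / (real k + 1)) powr p))"
      by (simp add: B_def sum_distrib_left sum.distrib distrib_left)
    also have "\<dots> \<le> (2 / ln 2) powr p * (4 * I + 2 powr p / (p - 1) * (16 * I))"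
    proof (intro mult_left_mono add_mono)
      have "(\<Sum>k<N. ((\<Sum>j\<le>k. E j) / (real k + 1)) powr p) \<le> 2 powr p / (p - 1) * (\<Sum>n<N. E n powr p)"
        using \<open>\<And>n. E n \<ge> 0\<close> p by (rule discrete_hardy)
      also have "\<dots> \<le> 2 powr p / (p - 1) * (16 * I)" using sumE p by (intro mult_left_mono) auto
      finally show "(\<Sum>k<N. ((\<Sum>j\<le>k. E j) / (real k + 1)) powr p) \<le> 2 powr p / (p - 1) * (16 * I)" .
    qed (use sumg in auto)
    also have "\<dots> = H" by (simp add: H_def algebra_simps)
    finally show ?thesis .
  qed
  have "(\<integral>\<^sup>+y\<in>(\<Union>k. Q k). f y \<partial>lborel) = (\<Sum>k. \<integral>\<^sup>+y\<in>Q k. f y \<partial>lborel)"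
    by (intro nn_integral_disjoint_family Q_disjoint) auto
  also have "\<dots> \<le> (\<Sum>k. ennreal (B k))" by (intro suminf_le half) auto
  also have "\<dots> = (SUP N. \<Sum>k<N. ennreal (B k))" by (rule suminf_eq_SUP)
  also have "\<dots> \<le> ennreal H"
  proof (intro SUP_least)
    fix N
    have "B k \<ge> 0" for k using J by (simp add: B_def)
    then show "(\<Sum>k<N. ennreal (B k)) \<le> ennreal H" using sumB[of N] by (simp add: sum_ennreal ennreal_leI)
  qed
  finally show ?thesis by (simp add: H_def f_def c_def \<Omega>_def)
qed

end

lemma bdry_dist_le_inradius:
  fixes \<Omega> :: "'a::euclidean_space set"
  assumes "bounded \<Omega>" "x \<in> \<Omega>"
  shows "bdry_dist \<Omega> x \<le> inradius \<Omega>"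
proof -
  obtain M where "\<forall>x\<in>\<Omega>. bdry_dist \<Omega> x \<le> M"
    using bdry_dist_bounded[of \<Omega>] assms by auto
  then have "bdd_above (bdry_dist \<Omega> ` \<Omega>)" by (intro bdd_aboveI2[where M = M]) auto
  then show ?thesis unfolding inradius_def using assms by (intro cSUP_upper)
qed

lemma log_hardy_interval:
  fixes \<Omega> :: "'a::euclidean_space set"
  assumes d: "DIM('a) = 1" and \<Omega>: "open \<Omega>" "bounded \<Omega>" "connected \<Omega>" "\<Omega> \<noteq> {}" and p: "1 < p"
  shows "\<exists>H\<ge>0. \<forall>u. continuous_on UNIV u \<longrightarrow>
     (\<integral>\<^sup>+x\<in>\<Omega>. ennreal ((\<bar>u x - set_average \<Omega> u\<bar> / ln (2 * inradius \<Omega> / bdry_dist \<Omega> x)) powr p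
         / bdry_dist \<Omega> x ^ DIM('a)) \<partial>lborel) \<le> ennreal H * energy p \<Omega> u"
proof -
  obtain b where b: "Basis = {b::'a}" using d by (auto simp: card_1_singleton_iff)
  have nb: "norm b = 1" using b by (auto intro: norm_Basis)
  obtain m R where mR: "0 < R" "\<Omega> = ball m R" using domain_dim1_ball[OF d \<Omega> b] by blast
  interpret pos: centered_interval m b R by standard (use d nb mR in auto)
  interpret neg: centered_interval m "- b" R by standard (use d nb mR in auto)
  have \<rho>: "R \<le> inradius \<Omega>"
    using pos.bdry_dist_ge[of m] bdry_dist_le_inradius[OF \<Omega>(2), of m] mR by simp
  define H where "H = (2 / ln 2) powr p * (4 + 16 * 2 powr p / (p - 1))"
  have H: "H > 0" unfolding H_def using p by (intro mult_pos_pos add_pos_nonneg) auto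
  show ?thesis
  proof (intro exI[of _ "2 * H"] conjI allI impI)
    fix u :: "'a \<Rightarrow> real" assume u: "continuous_on UNIV u"
    define f where "f x = ennreal ((\<bar>u x - set_average \<Omega> u\<bar> / ln (2 * inradius \<Omega> / bdry_dist \<Omega> x)) powr p / bdry_dist \<Omega> x)" for x
    have [measurable]: "u \<in> borel_measurable borel" using u by simp
    have [measurable]: "f \<in> borel_measurable borel" unfolding f_def by measurable
    have "(\<integral>\<^sup>+x\<in>\<Omega>. f x \<partial>lborel) \<le> ennreal (2 * H) * energy p \<Omega> u"
    proof (cases "energy p \<Omega> u")
      case top
      then show ?thesis using H by (simp add: ennreal_mult_eq_top_iff)
    next
      case (real I)
      have cover: "x \<in> (\<Union>k. pos.Q k) \<or> x \<in> (\<Union>k. neg.Q k)" if "x \<in> \<Omega>" for x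
        using pos.exists_Q[of x] neg.exists_Q[of x] that mR by (cases "0 \<le> (x - m) \<bullet> b") auto
      have "(\<integral>\<^sup>+x\<in>\<Omega>. f x \<partial>lborel) \<le> (\<integral>\<^sup>+x. f x * indicator (\<Union>k. pos.Q k) x + f x * indicator (\<Union>k. neg.Q k) x \<partial>lborel)"
        using cover by (intro nn_integral_mono) (auto simp: indicator_def)
      also have "\<dots> = (\<integral>\<^sup>+x\<in>(\<Union>k. pos.Q k). f x \<partial>lborel) + (\<integral>\<^sup>+x\<in>(\<Union>k. neg.Q k). f x \<partial>lborel)"
        by (intro nn_integral_add) auto
      also have "\<dots> \<le> ennreal (H * I) + ennreal (H * I)"
        unfolding f_def H_def mR(2)
        by (intro add_mono pos.log_hardy_half neg.log_hardy_half u p) (use real \<rho> mR in auto)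
      also have "\<dots> = ennreal (2 * H) * energy p \<Omega> u"
        using real H by (simp add: ennreal_mult'[symmetric] ennreal_plus[symmetric] del: ennreal_plus)
      finally show ?thesis .
    qed
    then show "(\<integral>\<^sup>+x\<in>\<Omega>. ennreal ((\<bar>u x - set_average \<Omega> u\<bar> / ln (2 * inradius \<Omega> / bdry_dist \<Omega> x)) powr p
         / bdry_dist \<Omega> x ^ DIM('a)) \<partial>lborel) \<le> ennreal (2 * H) * energy p \<Omega> u"
      using d by (simp add: f_def)
  qed (use H in auto)
qed

section \<open>Approximation by test functions\<close>

lemma nn_integral_lebesgue_on:
  assumes "\<Omega> \<in> sets borel"
  shows "(\<integral>\<^sup>+x. f x \<partial>lebesgue_on \<Omega>) = (\<integral>\<^sup>+x\<in>\<Omega>. f x \<partial>lborel)"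
  using assms by (subst nn_integral_restrict_space) (auto simp: nn_integral_completion)

lemma borel_measurable_lebesgue_on [measurable (raw)]:
  "f \<in> borel_measurable borel \<Longrightarrow> f \<in> borel_measurable (lebesgue_on \<Omega>)"
  by (intro measurable_restrict_space1 measurable_completion) simp

text \<open>
  The energy with respect to the completed measure, needed for functions that are only Lebesgue measurable.
\<close>

definition lebesgue_energy :: "real \<Rightarrow> 'a::euclidean_space set \<Rightarrow> ('a \<Rightarrow> real) \<Rightarrow> ennreal" where
  "lebesgue_energy p \<Omega> v = (\<integral>\<^sup>+x. (\<integral>\<^sup>+y. ennreal (diff_quot p v x y) \<partial>lebesgue_on \<Omega>) \<partial>lebesgue_on \<Omega>)"

lemma lebesgue_energy_eq_energy:
  assumes "\<Omega> \<in> sets borel"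
  shows "lebesgue_energy p \<Omega> v = energy p \<Omega> v"
  by (simp add: lebesgue_energy_def energy_def local_energy_def nn_integral_lebesgue_on[OF assms])

lemma lebesgue_energy_diff_le:
  fixes \<Omega> :: "'a::euclidean_space set"
  assumes \<Omega>: "open \<Omega>" "bounded \<Omega>" and p: "1 < p"
    and a [measurable]: "a \<in> borel_measurable (lebesgue_on \<Omega>)" and b [measurable]: "b \<in> borel_measurable (lebesgue_on \<Omega>)"
  shows "lebesgue_energy p \<Omega> (\<lambda>x. a x - b x) \<le> ennreal (2 powr p) * (lebesgue_energy p \<Omega> a + lebesgue_energy p \<Omega> b)"
proof -
  define M where "M = lebesgue_on \<Omega>"
  have "\<Omega> \<in> lmeasurable" using \<Omega> by (intro bounded_set_imp_lmeasurable) auto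
  then interpret M: finite_measure M unfolding M_def by (rule finite_measure_lebesgue_on)
  have id: "(\<lambda>x. x) \<in> borel_measurable M" unfolding M_def by measurable
  note [measurable] = a[folded M_def] b[folded M_def]
  have meas [measurable]: "(\<lambda>(x, y). ennreal (diff_quot p v x y)) \<in> borel_measurable (M \<Otimes>\<^sub>M M)"
    if [measurable]: "v \<in> borel_measurable M" for v
  proof -
    have [measurable]: "fst \<in> borel_measurable (M \<Otimes>\<^sub>M M)" "snd \<in> borel_measurable (M \<Otimes>\<^sub>M M)"
      using measurable_compose[OF measurable_fst id] measurable_compose[OF measurable_snd id] by auto
    have [measurable]: "(\<lambda>z. v (fst z)) \<in> borel_measurable (M \<Otimes>\<^sub>M M)" "(\<lambda>z. v (snd z)) \<in> borel_measurable (M \<Otimes>\<^sub>M M)"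
      using measurable_compose[OF measurable_fst that] measurable_compose[OF measurable_snd that] by auto
    show ?thesis unfolding diff_quot_def case_prod_beta by measurable
  qed
  have pt: "ennreal (diff_quot p (\<lambda>x. a x - b x) x y) \<le> ennreal (2 powr p) * (ennreal (diff_quot p a x y) + ennreal (diff_quot p b x y))" for x y
  proof -
    have "\<bar>a x - b x - (a y - b y)\<bar> powr p \<le> (\<bar>a x - a y\<bar> + \<bar>b x - b y\<bar>) powr p"
      using p by (intro powr_mono2) auto
    also have "\<dots> \<le> 2 powr p * (\<bar>a x - a y\<bar> powr p + \<bar>b x - b y\<bar> powr p)" using p by (intro powr_add_le) auto
    finally have "diff_quot p (\<lambda>x. a x - b x) x y \<le> 2 powr p * (\<bar>a x - a y\<bar> powr p + \<bar>b x - b y\<bar> powr p) / norm (x - y) ^ (2 * DIM('a))"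
      unfolding diff_quot_def by (intro divide_right_mono) auto
    also have "\<dots> = 2 powr p * (diff_quot p a x y + diff_quot p b x y)"
      by (simp add: diff_quot_def add_divide_distrib distrib_left)
    finally have "ennreal (diff_quot p (\<lambda>x. a x - b x) x y) \<le> ennreal (2 powr p * (diff_quot p a x y + diff_quot p b x y))"
      by (rule ennreal_leI)
    also have "\<dots> = ennreal (2 powr p) * (ennreal (diff_quot p a x y) + ennreal (diff_quot p b x y))"
      by (simp add: ennreal_mult diff_quot_def)
    finally show ?thesis .
  qed
  have s1: "(\<lambda>y. ennreal (diff_quot p v x y)) \<in> borel_measurable M" if "x \<in> space M" "v \<in> borel_measurable M" for v x
    using measurable_Pair2[OF meas[OF that(2)] that(1)] by simp
  have s2: "(\<lambda>x. \<integral>\<^sup>+y. ennreal (diff_quot p v x y) \<partial>M) \<in> borel_measurable M" if "v \<in> borel_measurable M" for v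
    by (rule M.borel_measurable_nn_integral[OF meas[OF that]])
  have "lebesgue_energy p \<Omega> (\<lambda>x. a x - b x)
     \<le> (\<integral>\<^sup>+x. ennreal (2 powr p) * ((\<integral>\<^sup>+y. ennreal (diff_quot p a x y) \<partial>M) + (\<integral>\<^sup>+y. ennreal (diff_quot p b x y) \<partial>M)) \<partial>M)"
    unfolding lebesgue_energy_def M_def[symmetric]
  proof (intro nn_integral_mono)
    fix x assume x: "x \<in> space M"
    have "(\<integral>\<^sup>+y. ennreal (diff_quot p (\<lambda>x. a x - b x) x y) \<partial>M)
      \<le> (\<integral>\<^sup>+y. ennreal (2 powr p) * (ennreal (diff_quot p a x y) + ennreal (diff_quot p b x y)) \<partial>M)"
      by (intro nn_integral_mono pt)
    also have "\<dots> = ennreal (2 powr p) * ((\<integral>\<^sup>+y. ennreal (diff_quot p a x y) \<partial>M) + (\<integral>\<^sup>+y. ennreal (diff_quot p b x y) \<partial>M))"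
      using s1[OF x] a b by (simp add: nn_integral_cmult nn_integral_add M_def[symmetric])
    finally show "(\<integral>\<^sup>+y. ennreal (diff_quot p (\<lambda>x. a x - b x) x y) \<partial>M) \<le> \<dots>" .
  qed
  also have "\<dots> = ennreal (2 powr p) * (lebesgue_energy p \<Omega> a + lebesgue_energy p \<Omega> b)"
    unfolding lebesgue_energy_def M_def[symmetric]
    using s2 a b by (simp add: nn_integral_cmult nn_integral_add M_def[symmetric])
  finally show ?thesis .
qed

lemma ennpowr_inverse: "0 < p \<Longrightarrow> ennpowr (ennpowr a (1 / p)) p = a"
  by (cases a) (auto simp: ennpowr_def powr_powr)

lemma gagliardo_eq:
  fixes \<Omega> :: "'a::euclidean_space set"
  assumes "s * p = real DIM('a)"
  shows "gagliardo s p \<Omega> v = ennpowr (lebesgue_energy p \<Omega> v) (1 / p)"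
proof -
  have "norm (x - y) powr (real DIM('a) + s * p) = norm (x - y) ^ (2 * DIM('a))" for x y :: 'a
  proof (cases "x = y")
    case False
    then have "norm (x - y) powr real (2 * DIM('a)) = norm (x - y) ^ (2 * DIM('a))"
      by (intro powr_realpow) auto
    then show ?thesis using assms by simp
  qed simp
  then show ?thesis by (simp add: gagliardo_def lebesgue_energy_def diff_quot_def)
qed

lemma sobolev_norm_less_imp:
  fixes \<Omega> :: "'a::euclidean_space set"
  assumes sp: "s * p = real DIM('a)" and p: "1 < p" and less: "sobolev_norm s p \<Omega> v < ennreal \<epsilon>" and \<epsilon>: "0 < \<epsilon>"
  shows "lebesgue_energy p \<Omega> v \<le> ennreal (\<epsilon> powr p)"
    and "(\<integral>\<^sup>+x. ennreal (\<bar>v x\<bar> powr p) \<partial>lebesgue_on \<Omega>) \<le> ennreal (\<epsilon> powr p)"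
proof -
  define a where "a = lebesgue_energy p \<Omega> v + (\<integral>\<^sup>+x. ennreal (\<bar>v x\<bar> powr p) \<partial>lebesgue_on \<Omega>)"
  have "sobolev_norm s p \<Omega> v = ennpowr a (1 / p)"
    using p by (simp add: sobolev_norm_def gagliardo_eq[OF sp] Lp_norm_def ennpowr_inverse a_def)
  with less have less': "ennpowr a (1 / p) < ennreal \<epsilon>" by simp
  have "a \<le> ennreal (\<epsilon> powr p)"
  proof (cases a)
    case (real r)
    then have "r powr (1 / p) < \<epsilon>"
      using less' \<epsilon> by (simp add: ennpowr_def ennreal_less_iff)
    then have "(r powr (1 / p)) powr p \<le> \<epsilon> powr p" using p by (intro powr_mono2) auto
    then have "r \<le> \<epsilon> powr p" using real p by (simp add: powr_powr)
    then show ?thesis using real by (simp add: ennreal_leI)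
  next
    case top
    then show ?thesis using less' by (simp add: ennpowr_def)
  qed
  then show "lebesgue_energy p \<Omega> v \<le> ennreal (\<epsilon> powr p)"
    and "(\<integral>\<^sup>+x. ennreal (\<bar>v x\<bar> powr p) \<partial>lebesgue_on \<Omega>) \<le> ennreal (\<epsilon> powr p)"
    unfolding a_def using order_trans by (auto intro: order_trans[rotated])
qed

lemma test_functions_subset: "test_functions \<Omega> \<subseteq> cont_compact_support \<Omega>"
proof
  fix \<phi> assume \<phi>: "\<phi> \<in> test_functions \<Omega>"
  then have "cont_diff 0 \<phi>" by (auto simp: test_functions_def)
  then show "\<phi> \<in> cont_compact_support \<Omega>"
    using \<phi> by (auto simp: test_functions_def cont_compact_support_def)
qed

lemma cont_compact_support_diff:
  assumes "a \<in> cont_compact_support \<Omega>" "b \<in> cont_compact_support \<Omega>"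
  shows "(\<lambda>x. a x - b x) \<in> cont_compact_support \<Omega>"
proof -
  have "{x. a x - b x \<noteq> 0} \<subseteq> {x. a x \<noteq> 0} \<union> {x. b x \<noteq> 0}" by auto
  from closure_mono[OF this]
  have sub: "closure {x. a x - b x \<noteq> 0} \<subseteq> closure {x. a x \<noteq> 0} \<union> closure {x. b x \<noteq> 0}"
    by (simp only: closure_Un)
  have "compact (closure {x. a x \<noteq> 0} \<union> closure {x. b x \<noteq> 0})"
    using assms unfolding cont_compact_support_def by blast
  then have "compact (closure {x. a x - b x \<noteq> 0})"
    unfolding compact_eq_bounded_closed using bounded_subset[OF _ sub] by simp
  then show ?thesis
    using assms sub unfolding cont_compact_support_def by (auto intro!: continuous_intros)
qed

lemma cont_compact_support_bounded:
  assumes "a \<in> cont_compact_support \<Omega>"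
  shows "\<exists>B. \<forall>x. \<bar>a x\<bar> \<le> B"
proof -
  define K where "K = closure {x. a x \<noteq> 0}"
  have "compact (a ` K)"
    using assms unfolding cont_compact_support_def K_def
    by (auto intro!: compact_continuous_image intro: continuous_on_subset)
  then obtain B where B: "\<forall>x\<in>K. \<bar>a x\<bar> \<le> B" using compact_imp_bounded[of "a ` K"] by (auto simp: bounded_real)
  have "\<bar>a x\<bar> \<le> max B 0" for x
  proof (cases "x \<in> K")
    case False
    then have "a x = 0" using closure_subset[of "{x. a x \<noteq> 0}"] by (auto simp: K_def)
    then show ?thesis by simp
  qed (use B in \<open>auto simp: le_max_iff_disj\<close>)
  then show ?thesis by blast
qed

lemma average_eq_set_average:
  fixes u :: "'a::euclidean_space \<Rightarrow> real"
  assumes "continuous_on UNIV u" "\<Omega> \<in> sets borel"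
  shows "average \<Omega> u = set_average \<Omega> u"
proof -
  have [measurable]: "u \<in> borel_measurable borel" "\<Omega> \<in> sets borel" using assms by auto
  have "(LINT y|lebesgue_on \<Omega>. u y) = (LINT y|lebesgue. indicator \<Omega> y *\<^sub>R u y)"
    by (intro integral_restrict_space) auto
  also have "\<dots> = (LINT y|lborel. indicator \<Omega> y *\<^sub>R u y)"
    by (intro integral_completion) measurable
  finally show ?thesis by (simp add: average_def set_average_def set_lebesgue_integral_def)
qed

section \<open>Exponential integrability for test functions\<close>

text \<open>
  With \<open>center\<close> and \<open>weight\<close> both cases of the definition of \<open>X\<close> have the common form \<open>|u - c| / w\<close>.
\<close>

definition center :: "'a::euclidean_space set \<Rightarrow> ('a \<Rightarrow> real) \<Rightarrow> real" where
  "center \<Omega> u = (if DIM('a) = 1 then average \<Omega> u else 0)"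

definition weight :: "'a::euclidean_space set \<Rightarrow> 'a \<Rightarrow> real" where
  "weight \<Omega> x = (if DIM('a) = 1 then ln (2 * inradius \<Omega> / bdry_dist \<Omega> x) else 1)"

lemma X_eq: "X \<Omega> u x = \<bar>u x - center \<Omega> u\<bar> / weight \<Omega> x"
  by (simp add: X_def center_def weight_def)

lemma measurable_weight [measurable]: "weight \<Omega> \<in> borel_measurable borel"
  unfolding weight_def by measurable

context
  fixes \<Omega> :: "'a::euclidean_space set"
  assumes \<Omega>: "bounded_lipschitz_domain \<Omega>"
begin

lemma lipschitz_domain_basics: "open \<Omega>" "bounded \<Omega>" "connected \<Omega>" "\<Omega> \<noteq> {}" "frontier \<Omega> \<noteq> {}" "\<Omega> \<in> sets borel"
  using \<Omega> bounded_frontier_nonempty[of \<Omega>] by (auto simp: bounded_lipschitz_domain_def)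

lemma weight_ge:
  assumes "x \<in> \<Omega>"
  shows "ln 2 \<le> weight \<Omega> x"
proof -
  have pos: "0 < bdry_dist \<Omega> x" using bdry_dist_pos lipschitz_domain_basics assms by blast
  have "bdry_dist \<Omega> x \<le> inradius \<Omega>" using bdry_dist_le_inradius lipschitz_domain_basics assms by blast
  then have "2 \<le> 2 * inradius \<Omega> / bdry_dist \<Omega> x" using pos by (simp add: field_simps)
  then have "ln 2 \<le> ln (2 * inradius \<Omega> / bdry_dist \<Omega> x)" by (intro ln_mono) auto
  then show ?thesis using ln_2_less_1 by (simp add: weight_def)
qed

lemma weight_pos: "x \<in> \<Omega> \<Longrightarrow> 0 < weight \<Omega> x"
  using weight_ge[of x] ln_gt_zero[of "2::real"] by linarith

text \<open>
  For \<open>d = 1\<close>, halving \<open>\<delta>\<close> adds \<open>ln 2\<close> to the logarithm, which itself is at least \<open>ln 2\<close>.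
\<close>

lemma weight_le_twice:
  assumes x: "x \<in> \<Omega>" and y: "dist x y < bdry_dist \<Omega> x / 2"
  shows "weight \<Omega> y \<le> 2 * weight \<Omega> x"
proof (cases "DIM('a) = 1")
  case True
  have pos: "0 < bdry_dist \<Omega> x" using bdry_dist_pos lipschitz_domain_basics x by blast
  have half: "bdry_dist \<Omega> x / 2 \<le> bdry_dist \<Omega> y" using bdry_dist_lipschitz[of \<Omega> x y] y by simp
  have \<rho>: "0 < inradius \<Omega>" using bdry_dist_le_inradius[OF lipschitz_domain_basics(2) x] pos by linarith
  have "2 * inradius \<Omega> / bdry_dist \<Omega> y \<le> 2 * inradius \<Omega> / (bdry_dist \<Omega> x / 2)"
    using half pos \<rho> by (intro divide_left_mono mult_pos_pos) auto
  then have "ln (2 * inradius \<Omega> / bdry_dist \<Omega> y) \<le> ln (2 * (2 * inradius \<Omega> / bdry_dist \<Omega> x))"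
    using half pos \<rho> by (intro ln_mono) auto
  also have "\<dots> = ln 2 + ln (2 * inradius \<Omega> / bdry_dist \<Omega> x)"
    using pos \<rho> by (intro ln_mult_pos) auto
  finally show ?thesis using weight_ge[OF x] True by (simp add: weight_def)
qed (simp add: weight_def)

lemma hardy_X:
  assumes p: "1 < p"
  shows "\<exists>H\<ge>0. \<forall>\<phi>\<in>cont_compact_support \<Omega>.
    (\<integral>\<^sup>+x\<in>\<Omega>. ennreal (X \<Omega> \<phi> x powr p / bdry_dist \<Omega> x ^ DIM('a)) \<partial>lborel) \<le> ennreal H * energy p \<Omega> \<phi>"
proof (cases "DIM('a) = 1")
  case True
  obtain H where H: "0 \<le> H" "\<And>u. continuous_on UNIV u \<Longrightarrow>
     (\<integral>\<^sup>+x\<in>\<Omega>. ennreal ((\<bar>u x - set_average \<Omega> u\<bar> / ln (2 * inradius \<Omega> / bdry_dist \<Omega> x)) powr p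
         / bdry_dist \<Omega> x ^ DIM('a)) \<partial>lborel) \<le> ennreal H * energy p \<Omega> u"
    using log_hardy_interval[OF True lipschitz_domain_basics(1-4) p] by blast
  show ?thesis
  proof (intro exI[of _ H] conjI ballI H(1))
    fix \<phi> assume "\<phi> \<in> cont_compact_support \<Omega>"
    then have cont: "continuous_on UNIV \<phi>" by (simp add: cont_compact_support_def)
    have "X \<Omega> \<phi> x = \<bar>\<phi> x - set_average \<Omega> \<phi>\<bar> / ln (2 * inradius \<Omega> / bdry_dist \<Omega> x)" for x
      using True average_eq_set_average[OF cont lipschitz_domain_basics(6)] by (simp add: X_def)
    then show "(\<integral>\<^sup>+x\<in>\<Omega>. ennreal (X \<Omega> \<phi> x powr p / bdry_dist \<Omega> x ^ DIM('a)) \<partial>lborel) \<le> ennreal H * energy p \<Omega> \<phi>"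
      using H(2)[OF cont] by (simp only:)
  qed
next
  case False
  then have "2 \<le> DIM('a)" using DIM_positive[where 'a = 'a] by linarith
  then show ?thesis using hardy_lipschitz[OF \<Omega> _ p] False by (simp add: X_def)
qed

lemma trudinger_hardy_small_energy:
  assumes p: "1 < p" and m: "real n \<ge> p - 1" "p - 1 > real n - 1" and \<alpha>: "0 < \<alpha>"
  shows "\<exists>I>0. \<exists>C. \<forall>\<phi>\<in>cont_compact_support \<Omega>. energy p \<Omega> \<phi> \<le> ennreal I \<longrightarrow>
    (\<integral>\<^sup>+x\<in>\<Omega>. ennreal (Phi n (\<alpha> * X \<Omega> \<phi> x powr (p / (p - 1))) / bdry_dist \<Omega> x ^ DIM('a)) \<partial>lborel) \<le> ennreal C"
proof -
  obtain H where H: "0 \<le> H" "\<And>\<phi>. \<phi> \<in> cont_compact_support \<Omega> \<Longrightarrow>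
    (\<integral>\<^sup>+x\<in>\<Omega>. ennreal (X \<Omega> \<phi> x powr p / bdry_dist \<Omega> x ^ DIM('a)) \<partial>lborel) \<le> ennreal H * energy p \<Omega> \<phi>"
    using hardy_X[OF p] by blast
  have ln2: "(0::real) < ln 2" by simp
  obtain I C where I: "0 < I" "\<And>u c. continuous_on UNIV u \<Longrightarrow> energy p \<Omega> u \<le> ennreal I \<Longrightarrow>
     (\<integral>\<^sup>+x\<in>\<Omega>. ennreal ((\<bar>u x - c\<bar> / weight \<Omega> x) powr p / bdry_dist \<Omega> x ^ DIM('a)) \<partial>lborel) \<le> ennreal (H * I) \<Longrightarrow>
     (\<integral>\<^sup>+x\<in>\<Omega>. ennreal (Phi n (\<alpha> * (\<bar>u x - c\<bar> / weight \<Omega> x) powr (p / (p - 1))) / bdry_dist \<Omega> x ^ DIM('a)) \<partial>lborel)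
       \<le> ennreal C"
    using trudinger_of_hardy[OF lipschitz_domain_basics(1,5) p m \<alpha> ln2 weight_ge weight_le_twice measurable_weight H(1)] by blast
  show ?thesis
  proof (rule exI[of _ I], rule conjI[OF I(1)], rule exI[of _ C], intro ballI impI)
    fix \<phi> assume \<phi>: "\<phi> \<in> cont_compact_support \<Omega>" and E: "energy p \<Omega> \<phi> \<le> ennreal I"
    have "(\<integral>\<^sup>+x\<in>\<Omega>. ennreal (X \<Omega> \<phi> x powr p / bdry_dist \<Omega> x ^ DIM('a)) \<partial>lborel) \<le> ennreal H * ennreal I"
      using H(2)[OF \<phi>] E by (meson mult_left_mono order_trans zero_le)
    also have "\<dots> = ennreal (H * I)" using H I by (simp add: ennreal_mult')
    finally show "(\<integral>\<^sup>+x\<in>\<Omega>. ennreal (Phi n (\<alpha> * X \<Omega> \<phi> x powr (p / (p - 1))) / bdry_dist \<Omega> x ^ DIM('a)) \<partial>lborel) \<le> ennreal C"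
      unfolding X_eq using \<phi> E by (intro I(2)) (auto simp: cont_compact_support_def)
  qed
qed

text \<open>
  For a fixed \<open>\<phi>\<close> the function \<open>X\<close> is bounded, hence so is the exponential factor, and the Hardy
  inequality applies to an energy of any size.
\<close>

lemma exponential_integral_test_function:
  assumes p: "1 < p" and m: "real n \<ge> p - 1" "p - 1 > real n - 1" and \<alpha>: "0 < \<alpha>"
    and \<phi>: "\<phi> \<in> cont_compact_support \<Omega>" and E: "energy p \<Omega> \<phi> < \<infinity>"
  shows "(\<integral>\<^sup>+x\<in>\<Omega>. ennreal (Phi n (\<alpha> * X \<Omega> \<phi> x powr (p / (p - 1))) / bdry_dist \<Omega> x ^ DIM('a)) \<partial>lborel) < \<infinity>"
proof -
  let ?T = "\<integral>\<^sup>+x\<in>\<Omega>. ennreal (Phi n (\<alpha> * X \<Omega> \<phi> x powr (p / (p - 1))) / bdry_dist \<Omega> x ^ DIM('a)) \<partial>lborel"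
  let ?H = "\<integral>\<^sup>+x\<in>\<Omega>. ennreal (X \<Omega> \<phi> x powr p / bdry_dist \<Omega> x ^ DIM('a)) \<partial>lborel"
  obtain H where H: "0 \<le> H"
    "?H \<le> ennreal H * energy p \<Omega> \<phi>"
    using hardy_X[OF p] \<phi> by blast
  have [measurable]: "\<phi> \<in> borel_measurable borel" "\<Omega> \<in> sets borel"
    using \<phi> lipschitz_domain_basics by (auto simp: cont_compact_support_def)
  have Xm [measurable]: "X \<Omega> \<phi> \<in> borel_measurable borel" unfolding X_eq[abs_def] by measurable
  obtain B where B: "\<And>x. \<bar>\<phi> x\<bar> \<le> B" using cont_compact_support_bounded[OF \<phi>] by blast
  define D where "D = (B + \<bar>center \<Omega> \<phi>\<bar>) / ln 2"
  have XD: "0 \<le> X \<Omega> \<phi> x" "X \<Omega> \<phi> x \<le> D" if "x \<in> \<Omega>" for x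
  proof -
    show "0 \<le> X \<Omega> \<phi> x" using weight_pos[OF that] by (simp add: X_eq)
    have "\<bar>\<phi> x - center \<Omega> \<phi>\<bar> \<le> B + \<bar>center \<Omega> \<phi>\<bar>" using B[of x] by linarith
    then show "X \<Omega> \<phi> x \<le> D"
      unfolding X_eq D_def using weight_ge[OF that] by (intro frac_le) auto
  qed
  define K where "K = \<alpha> powr (p - 1) * exp (2 * (\<alpha> * D powr (p / (p - 1))))"
  have "?T
    \<le> (\<integral>\<^sup>+x. ennreal K * (ennreal (X \<Omega> \<phi> x powr p / bdry_dist \<Omega> x ^ DIM('a)) * indicator \<Omega> x) \<partial>lborel)"
  proof (intro nn_integral_mono)
    fix x
    show "ennreal (Phi n (\<alpha> * X \<Omega> \<phi> x powr (p / (p - 1))) / bdry_dist \<Omega> x ^ DIM('a)) * indicator \<Omega> x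
      \<le> ennreal K * (ennreal (X \<Omega> \<phi> x powr p / bdry_dist \<Omega> x ^ DIM('a)) * indicator \<Omega> x)"
    proof (cases "x \<in> \<Omega>")
      case True
      define t where "t = \<alpha> * X \<Omega> \<phi> x powr (p / (p - 1))"
      have t: "0 \<le> t" "t \<le> \<alpha> * D powr (p / (p - 1))"
        using XD[OF True] \<alpha> p by (auto simp: t_def intro!: mult_left_mono powr_mono2)
      have "Phi n t \<le> t powr (p - 1) * exp (2 * t)" using p m t by (intro Phi_le_powr_exp) auto
      also have "t powr (p - 1) = \<alpha> powr (p - 1) * X \<Omega> \<phi> x powr p"
        using \<alpha> p by (simp add: t_def powr_mult powr_powr)
      also have "\<alpha> powr (p - 1) * X \<Omega> \<phi> x powr p * exp (2 * t)
          \<le> \<alpha> powr (p - 1) * X \<Omega> \<phi> x powr p * exp (2 * (\<alpha> * D powr (p / (p - 1))))"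
        using t by (intro mult_left_mono) auto
      also have "\<dots> = K * X \<Omega> \<phi> x powr p" by (simp add: K_def)
      finally have "Phi n t / bdry_dist \<Omega> x ^ DIM('a) \<le> K * (X \<Omega> \<phi> x powr p / bdry_dist \<Omega> x ^ DIM('a))"
        by (simp add: divide_right_mono)
      then show ?thesis
        using True by (simp add: t_def K_def ennreal_leI flip: ennreal_mult'')
    qed simp
  qed
  also have "\<dots> = ennreal K * ?H"
    by (intro nn_integral_cmult) measurable
  also have "\<dots> \<le> ennreal K * (ennreal H * energy p \<Omega> \<phi>)" by (intro mult_left_mono H) auto
  also have "\<dots> < \<infinity>" using E by (simp add: ennreal_mult_less_top)
  finally show ?thesis .
qed

end

lemma sobolev0_approximation:
  fixes \<Omega> :: "'a::euclidean_space set"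
  assumes p: "1 < p" and sp: "s * p = real DIM('a)" and u: "u \<in> sobolev0 s p \<Omega>" and e: "0 < (e::real)"
  shows "\<exists>\<phi>\<in>cont_compact_support \<Omega>. lebesgue_energy p \<Omega> (\<lambda>x. u x - \<phi> x) \<le> ennreal e
     \<and> (\<integral>\<^sup>+x. ennreal (\<bar>u x - \<phi> x\<bar> powr p) \<partial>lebesgue_on \<Omega>) \<le> ennreal e"
proof -
  define \<epsilon> where "\<epsilon> = e powr (1 / p)"
  have \<epsilon>: "\<epsilon> > 0" "\<epsilon> powr p = e" using e p by (auto simp: \<epsilon>_def powr_powr)
  then obtain \<phi> where \<phi>: "\<phi> \<in> test_functions \<Omega>" "sobolev_norm s p \<Omega> (\<lambda>x. u x - \<phi> x) < ennreal \<epsilon>"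
    using u unfolding sobolev0_def by (auto dest: spec[of _ "ennreal \<epsilon>"])
  then show ?thesis
    using sobolev_norm_less_imp[OF sp p \<phi>(2) \<epsilon>(1)] \<epsilon> test_functions_subset by (intro bexI[of _ \<phi>]) auto
qed

section \<open>Passage to the limit\<close>

lemma integrable_lebesgue_on_of_Lp:
  fixes \<Omega> :: "'a::euclidean_space set"
  assumes \<Omega>: "open \<Omega>" "bounded \<Omega>" and p: "1 < p" and v [measurable]: "v \<in> borel_measurable (lebesgue_on \<Omega>)"
    and Lp: "(\<integral>\<^sup>+x. ennreal (\<bar>v x\<bar> powr p) \<partial>lebesgue_on \<Omega>) < \<infinity>"
  shows "integrable (lebesgue_on \<Omega>) v"
proof (rule integrableI_bounded)
  have "\<Omega> \<in> lmeasurable" using \<Omega> by (intro bounded_set_imp_lmeasurable) auto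
  then interpret M: finite_measure "lebesgue_on \<Omega>" by (rule finite_measure_lebesgue_on)
  have "(\<integral>\<^sup>+x. ennreal (norm (v x)) \<partial>lebesgue_on \<Omega>) \<le> (\<integral>\<^sup>+x. 1 + ennreal (\<bar>v x\<bar> powr p) \<partial>lebesgue_on \<Omega>)"
  proof (intro nn_integral_mono)
    fix x
    have "\<bar>v x\<bar> \<le> 1 + \<bar>v x\<bar> powr p"
    proof (cases "\<bar>v x\<bar> \<le> 1")
      case False
      then have "\<bar>v x\<bar> powr 1 \<le> \<bar>v x\<bar> powr p" using p by (intro powr_mono) auto
      then show ?thesis by simp
    qed (simp add: add_increasing2)
    then have "ennreal (norm (v x)) \<le> ennreal (1 + \<bar>v x\<bar> powr p)" by (intro ennreal_leI) simp
    then show "ennreal (norm (v x)) \<le> 1 + ennreal (\<bar>v x\<bar> powr p)" by (simp add: ennreal_plus)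
  qed
  also have "\<dots> = emeasure (lebesgue_on \<Omega>) (space (lebesgue_on \<Omega>)) + (\<integral>\<^sup>+x. ennreal (\<bar>v x\<bar> powr p) \<partial>lebesgue_on \<Omega>)"
    by (subst nn_integral_add) auto
  also have "\<dots> < \<infinity>" using Lp by (simp add: less_top[symmetric])
  finally show "(\<integral>\<^sup>+x. ennreal (norm (v x)) \<partial>lebesgue_on \<Omega>) < \<infinity>" .
qed (rule v)

text \<open>
  Integrate \<open>|v x| \<le> t + t powr (1 - p) * |v x| powr p\<close>, which holds separately for \<open>|v x| \<le> t\<close> and
  for \<open>|v x| > t\<close>.
\<close>

lemma average_abs_le:
  fixes \<Omega> :: "'a::euclidean_space set"
  assumes \<Omega>: "open \<Omega>" "bounded \<Omega>" "\<Omega> \<noteq> {}" and p: "1 < p" and v [measurable]: "v \<in> borel_measurable (lebesgue_on \<Omega>)"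
    and Lp: "(\<integral>\<^sup>+x. ennreal (\<bar>v x\<bar> powr p) \<partial>lebesgue_on \<Omega>) \<le> ennreal (t powr p)" and t: "0 < t"
  shows "\<bar>average \<Omega> v\<bar> \<le> t * (1 + 1 / measure lebesgue \<Omega>)"
proof -
  define V where "V = measure lebesgue \<Omega>"
  have lm: "\<Omega> \<in> lmeasurable" using \<Omega> by (intro bounded_set_imp_lmeasurable) auto
  then interpret M: finite_measure "lebesgue_on \<Omega>" by (rule finite_measure_lebesgue_on)
  have sp: "measure (lebesgue_on \<Omega>) \<Omega> = V"
    using lm by (simp add: V_def measure_restrict_space)
  have "V > 0"
    using open_not_negligible[OF \<Omega>(1,3)] negligible_iff_measure[of \<Omega>] lm
    by (simp add: V_def zero_less_measure_iff)
  have "integrable (lebesgue_on \<Omega>) v"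
    by (rule integrable_lebesgue_on_of_Lp[OF \<Omega>(1,2) p v le_less_trans[OF Lp]]) simp
  have pw: "\<bar>v x\<bar> \<le> t + t powr (1 - p) * \<bar>v x\<bar> powr p" for x
  proof (cases "\<bar>v x\<bar> \<le> t")
    case False
    then have "t powr (1 - p) * \<bar>v x\<bar> powr p = \<bar>v x\<bar> * (\<bar>v x\<bar> / t) powr (p - 1)"
      using t by (simp add: powr_divide powr_diff field_simps)
    moreover have "1 \<le> (\<bar>v x\<bar> / t) powr (p - 1)" using False t p by (intro ge_one_powr_ge_zero) auto
    then have "\<bar>v x\<bar> * 1 \<le> \<bar>v x\<bar> * (\<bar>v x\<bar> / t) powr (p - 1)" by (intro mult_left_mono) auto
    ultimately show ?thesis using t by linarith
  qed (simp add: add_increasing2)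
  have "ennreal \<bar>LINT y|lebesgue_on \<Omega>. v y\<bar> \<le> (\<integral>\<^sup>+x. ennreal (norm (v x)) \<partial>lebesgue_on \<Omega>)"
    using integral_norm_bound_ennreal[OF \<open>integrable (lebesgue_on \<Omega>) v\<close>] by simp
  also have "\<dots> \<le> (\<integral>\<^sup>+x. ennreal t + ennreal (t powr (1 - p)) * ennreal (\<bar>v x\<bar> powr p) \<partial>lebesgue_on \<Omega>)"
  proof (intro nn_integral_mono)
    fix x
    have "ennreal (norm (v x)) \<le> ennreal (t + t powr (1 - p) * \<bar>v x\<bar> powr p)" using pw[of x] by (intro ennreal_leI) simp
    then show "ennreal (norm (v x)) \<le> ennreal t + ennreal (t powr (1 - p)) * ennreal (\<bar>v x\<bar> powr p)"
      using t by (simp add: ennreal_plus ennreal_mult)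
  qed
  also have "\<dots> = ennreal t * ennreal V + ennreal (t powr (1 - p)) * (\<integral>\<^sup>+x. ennreal (\<bar>v x\<bar> powr p) \<partial>lebesgue_on \<Omega>)"
    by (subst nn_integral_add) (auto simp: nn_integral_cmult M.emeasure_eq_measure sp)
  also have "\<dots> \<le> ennreal t * ennreal V + ennreal (t powr (1 - p)) * ennreal (t powr p)"
    by (intro add_left_mono mult_left_mono Lp) auto
  also have "\<dots> = ennreal (t * V + t)"
    using t \<open>V > 0\<close> by (simp add: ennreal_mult'[symmetric] ennreal_plus[symmetric] powr_add[symmetric] del: ennreal_plus)
  finally have "\<bar>LINT y|lebesgue_on \<Omega>. v y\<bar> \<le> t * V + t"
    using t \<open>V > 0\<close> by (subst (asm) ennreal_le_iff) auto
  then have "\<bar>average \<Omega> v\<bar> \<le> (t * V + t) / V"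
    using \<open>V > 0\<close> by (simp add: average_def V_def abs_mult divide_right_mono)
  also have "\<dots> = t * (1 + 1 / V)" using \<open>V > 0\<close> by (simp add: field_simps)
  finally show ?thesis by (simp add: V_def)
qed

text \<open>
  Fast convergence in \<open>L\<^sup>p\<close> spares the extraction of a subsequence: the series of the
  \<open>p\<close>-th powers has a finite integral, hence converges almost everywhere.
\<close>

lemma AE_tendsto_of_summable_Lp:
  fixes v :: "nat \<Rightarrow> 'a \<Rightarrow> real"
  assumes v [measurable]: "\<And>k. v k \<in> borel_measurable M" and p: "0 < p"
    and Lp: "\<And>k. (\<integral>\<^sup>+x. ennreal (\<bar>v k x\<bar> powr p) \<partial>M) \<le> ennreal (e k)" and e: "summable e" "\<And>k. 0 \<le> e k"
  shows "AE x in M. (\<lambda>k. v k x) \<longlonglongrightarrow> 0"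
proof -
  have "(\<integral>\<^sup>+x. (\<Sum>k. ennreal (\<bar>v k x\<bar> powr p)) \<partial>M) = (\<Sum>k. \<integral>\<^sup>+x. ennreal (\<bar>v k x\<bar> powr p) \<partial>M)"
    by (intro nn_integral_suminf) measurable
  also have "\<dots> \<le> (\<Sum>k. ennreal (e k))" by (intro suminf_le Lp) auto
  also have "\<dots> = ennreal (\<Sum>k. e k)" using e by (intro suminf_ennreal2) auto
  finally have "(\<integral>\<^sup>+x. (\<Sum>k. ennreal (\<bar>v k x\<bar> powr p)) \<partial>M) \<noteq> \<infinity>"
    by (auto simp: top_unique)
  then have "AE x in M. (\<Sum>k. ennreal (\<bar>v k x\<bar> powr p)) \<noteq> \<infinity>"
    by (intro nn_integral_PInf_AE) measurable
  then show ?thesis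
  proof eventually_elim
    case (elim x)
    then have "summable (\<lambda>k. \<bar>v k x\<bar> powr p)"
      by (intro summable_suminf_not_top) auto
    then have "(\<lambda>k. \<bar>v k x\<bar> powr p) \<longlonglongrightarrow> 0" by (rule summable_LIMSEQ_zero)
    then have "(\<lambda>k. (\<bar>v k x\<bar> powr p) powr (1 / p)) \<longlonglongrightarrow> 0 powr (1 / p)"
      using p by (intro tendsto_powr') auto
    then have "(\<lambda>k. \<bar>v k x\<bar>) \<longlonglongrightarrow> 0" using p by (simp add: powr_powr)
    then show ?case by (simp add: tendsto_rabs_zero_iff)
  qed
qed

text \<open>
  The errors \<open>e k\<close> are chosen summable, so that the approximants \<open>\<phi> k\<close> converge almost everywhere,
  and so small that all differences \<open>\<phi> k - \<phi> 0\<close> have energy at most \<open>I\<close>, the threshold for the exponent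
  \<open>\<beta> = \<alpha> * 2 powr q\<close>. The factor \<open>2 powr q\<close> pays for splitting \<open>u\<close> into \<open>u - \<phi> 0\<close> and \<open>\<phi> 0\<close>.
\<close>

theorem corollary1p2:
  fixes \<Omega> :: "'a::euclidean_space set"
    and u :: "'a \<Rightarrow> real"
    and p s \<alpha> :: real
    and n\<^sub>0 :: nat
  assumes "bounded_lipschitz_domain \<Omega>"
    and "p > 1" and "0 < s" and "s < 1"
    and "s * p = real DIM('a)"
    and "real n\<^sub>0 \<ge> p - 1" and "p - 1 > real n\<^sub>0 - 1"
    and "u \<in> sobolev0 s p \<Omega>"
    and "\<alpha> > 0"
  shows "integrable (lebesgue_on \<Omega>)
           (\<lambda>x. Phi n\<^sub>0 (\<alpha> * X \<Omega> u x powr (real DIM('a) / (real DIM('a) - s)))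
                  * (1 / bdry_dist \<Omega> x ^ DIM('a)))"
proof -
  note \<Omega> = \<open>bounded_lipschitz_domain \<Omega>\<close> and p = \<open>p > 1\<close> and sp = \<open>s * p = real DIM('a)\<close>
    and n = \<open>real n\<^sub>0 \<ge> p - 1\<close> \<open>p - 1 > real n\<^sub>0 - 1\<close> and \<alpha> = \<open>\<alpha> > 0\<close> and u = \<open>u \<in> sobolev0 s p \<Omega>\<close>
  note D = lipschitz_domain_basics[OF \<Omega>]
  define q where "q = p / (p - 1)"
  have q0: "0 \<le> q" using p by (simp add: q_def)
  have q: "real DIM('a) / (real DIM('a) - s) = q"
  proof -
    have "s * p / (s * p - s) = q" using \<open>0 < s\<close> p by (simp add: q_def field_simps)
    then show ?thesis using sp by simp
  qed
  define \<beta> where "\<beta> = \<alpha> * 2 powr q"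
  have \<beta>: "0 < \<beta>" using \<alpha> by (simp add: \<beta>_def)
  define M where "M = lebesgue_on \<Omega>"
  have spM: "space M = \<Omega>" by (simp add: M_def)
  have um [measurable]: "u \<in> borel_measurable M" using u by (simp add: sobolev0_def sobolev_def M_def)
  have [measurable]: "bdry_dist \<Omega> \<in> borel_measurable M" "weight \<Omega> \<in> borel_measurable M"
    unfolding M_def by measurable
  have Phim [measurable]: "Phi n\<^sub>0 \<in> borel_measurable borel"
    using continuous_on_Phi by (rule borel_measurable_continuous_onI)
  have uE: "lebesgue_energy p \<Omega> u < \<infinity>" and uL: "(\<integral>\<^sup>+x. ennreal (\<bar>u x\<bar> powr p) \<partial>M) < \<infinity>"
    using u gagliardo_eq[OF sp, of \<Omega> u]
    by (auto simp: sobolev0_def sobolev_def Lp_norm_def ennpowr_def M_def less_top split: if_splits)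
  obtain I C where I: "0 < I" and C: "\<And>\<phi>. \<phi> \<in> cont_compact_support \<Omega> \<Longrightarrow> energy p \<Omega> \<phi> \<le> ennreal I \<Longrightarrow>
    (\<integral>\<^sup>+x\<in>\<Omega>. ennreal (Phi n\<^sub>0 (\<beta> * X \<Omega> \<phi> x powr q) / bdry_dist \<Omega> x ^ DIM('a)) \<partial>lborel) \<le> ennreal C"
    using trudinger_hardy_small_energy[OF \<Omega> p n \<beta>] unfolding q_def by blast
  define e where "e k = I / (2 * 2 powr p) * (1 / 2) ^ k" for k :: nat
  have e: "0 < e k" "2 powr p * e k \<le> I / 2" for k
  proof -
    show "0 < e k" using I by (simp add: e_def)
    have "(1 / 2 :: real) ^ k \<le> 1" by (intro power_le_one) auto
    then have "I / 2 * (1 / 2) ^ k \<le> I / 2 * 1" using I by (intro mult_left_mono) auto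
    then show "2 powr p * e k \<le> I / 2" by (simp add: e_def)
  qed
  have es: "summable e" unfolding e_def by (intro summable_mult summable_geometric) auto
  have "\<forall>k. \<exists>\<psi>. \<psi> \<in> cont_compact_support \<Omega>
     \<and> lebesgue_energy p \<Omega> (\<lambda>x. u x - \<psi> x) \<le> ennreal (e k)
     \<and> (\<integral>\<^sup>+x. ennreal (\<bar>u x - \<psi> x\<bar> powr p) \<partial>M) \<le> ennreal (e k)"
    using sobolev0_approximation[OF p sp u e(1)] unfolding M_def by blast
  from choice[OF this] obtain \<phi> where \<phi>: "\<And>k. \<phi> k \<in> cont_compact_support \<Omega>"
     "\<And>k. lebesgue_energy p \<Omega> (\<lambda>x. u x - \<phi> k x) \<le> ennreal (e k)"
     "\<And>k. (\<integral>\<^sup>+x. ennreal (\<bar>u x - \<phi> k x\<bar> powr p) \<partial>M) \<le> ennreal (e k)"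
    by blast
  have \<phi>b: "\<phi> k \<in> borel_measurable borel" for k using \<phi>(1)[of k] by (simp add: cont_compact_support_def)
  have \<phi>m [measurable]: "\<phi> k \<in> borel_measurable M" for k
    unfolding M_def by (rule borel_measurable_lebesgue_on[OF \<phi>b])
  have diffm: "(\<lambda>x. u x - \<phi> k x) \<in> borel_measurable (lebesgue_on \<Omega>)" for k
    using um \<phi>m[of k] unfolding M_def by measurable
  have intu: "integrable M u"
    unfolding M_def by (rule integrable_lebesgue_on_of_Lp[OF D(1,2) p um[unfolded M_def] uL[unfolded M_def]])
  have int\<phi>: "integrable M (\<phi> k)" for k
  proof -
    have "integrable M (\<lambda>x. u x - \<phi> k x)"
      unfolding M_def
      by (rule integrable_lebesgue_on_of_Lp[OF D(1,2) p diffm le_less_trans[OF \<phi>(3)[unfolded M_def]]]) simp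
    from Bochner_Integration.integrable_diff[OF intu this] show ?thesis by simp
  qed
  \<comment> \<open>For \<open>d = 1\<close> the centre is an average, which is linear only on integrable functions.\<close>
  have cdiff: "center \<Omega> (\<lambda>x. a x - b x) = center \<Omega> a - center \<Omega> b" if "integrable M a" "integrable M b" for a b
    using that by (simp add: center_def average_def M_def[symmetric] algebra_simps)
  have AEconv: "AE x in M. (\<lambda>k. \<phi> k x) \<longlonglongrightarrow> u x"
  proof -
    have "AE x in M. (\<lambda>k. u x - \<phi> k x) \<longlonglongrightarrow> 0"
      using p \<phi>(3) es e(1) by (intro AE_tendsto_of_summable_Lp[where p = p and e = e]) (auto intro: less_imp_le)
    then show ?thesis
    proof eventually_elim
      case (elim x)
      from tendsto_diff[OF tendsto_const[of "u x"] this] show ?case by simp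
    qed
  qed
  have cconv: "(\<lambda>k. center \<Omega> (\<phi> k)) \<longlonglongrightarrow> center \<Omega> u"
  proof -
    define K where "K = 1 + 1 / measure lebesgue \<Omega>"
    have "\<bar>center \<Omega> u - center \<Omega> (\<phi> k)\<bar> \<le> e k powr (1 / p) * K" for k
    proof (cases "DIM('a) = 1")
      case True
      have "\<bar>average \<Omega> (\<lambda>x. u x - \<phi> k x)\<bar> \<le> e k powr (1 / p) * K"
        unfolding K_def using \<phi>(3)[of k] e[of k] p
        by (intro average_abs_le[OF D(1,2,4) p diffm]) (auto simp: M_def powr_powr)
      then show ?thesis using cdiff[OF intu int\<phi>, of k] True by (simp add: center_def)
    qed (simp add: center_def K_def)
    then have b: "norm (center \<Omega> u - center \<Omega> (\<phi> k)) \<le> e k powr (1 / p) * K" for k by simp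
    have "(\<lambda>k. e k powr (1 / p)) \<longlonglongrightarrow> 0 powr (1 / p)"
      using p e(1) by (intro tendsto_powr' summable_LIMSEQ_zero es tendsto_const) (auto simp: less_imp_le)
    then have "(\<lambda>k. e k powr (1 / p) * K) \<longlonglongrightarrow> 0" by (auto intro: tendsto_mult_left_zero)
    then have "(\<lambda>k. center \<Omega> u - center \<Omega> (\<phi> k)) \<longlonglongrightarrow> 0"
      by (rule Lim_null_comparison[rotated]) (use b in auto)
    from tendsto_diff[OF tendsto_const[of "center \<Omega> u"] this] show ?thesis by simp
  qed
  define F where "F v x = ennreal (Phi n\<^sub>0 (\<beta> * X \<Omega> v x powr q) / bdry_dist \<Omega> x ^ DIM('a))" for v x
  define \<psi> where "\<psi> k x = \<phi> k x - \<phi> 0 x" for k x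
  define v where "v x = u x - \<phi> 0 x" for x
  have \<psi>: "\<psi> k \<in> cont_compact_support \<Omega>" for k
    unfolding \<psi>_def[abs_def] by (intro cont_compact_support_diff \<phi>)
  have \<psi>E: "energy p \<Omega> (\<psi> k) \<le> ennreal I" for k
  proof -
    have "energy p \<Omega> (\<psi> k) = lebesgue_energy p \<Omega> (\<lambda>x. (u x - \<phi> 0 x) - (u x - \<phi> k x))"
      by (simp add: lebesgue_energy_eq_energy[OF D(6)] \<psi>_def[abs_def])
    also have "\<dots> \<le> ennreal (2 powr p) * (lebesgue_energy p \<Omega> (\<lambda>x. u x - \<phi> 0 x) + lebesgue_energy p \<Omega> (\<lambda>x. u x - \<phi> k x))"
      by (intro lebesgue_energy_diff_le D p diffm)
    also have "\<dots> \<le> ennreal (2 powr p) * (ennreal (e 0) + ennreal (e k))"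
      by (intro mult_left_mono add_mono \<phi>) auto
    also have "\<dots> = ennreal (2 powr p * e 0 + 2 powr p * e k)"
      using e(1)[of 0] e(1)[of k] by (simp add: ennreal_mult ennreal_plus distrib_left)
    also have "\<dots> \<le> ennreal I" using e(2)[of 0] e(2)[of k] by (intro ennreal_leI) linarith
    finally show ?thesis .
  qed
  have Xm: "X \<Omega> w \<in> borel_measurable M" if [measurable]: "w \<in> borel_measurable M" for w
    unfolding X_eq[abs_def] by measurable
  have vm [measurable]: "v \<in> borel_measurable M" unfolding v_def[abs_def] by measurable
  have Fm [measurable]: "F w \<in> borel_measurable M" if "w \<in> borel_measurable M" for w
  proof -
    note [measurable] = Xm[OF that]
    show ?thesis unfolding F_def[abs_def] by measurable
  qed
  have Fconv: "AE x in M. (\<lambda>k. F (\<psi> k) x) \<longlonglongrightarrow> F v x"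
    using AEconv
  proof (rule AE_mp, intro AE_I2 impI)
    fix x assume x: "x \<in> space M" and conv: "(\<lambda>k. \<phi> k x) \<longlonglongrightarrow> u x"
    have wpos: "weight \<Omega> x \<noteq> 0" using weight_pos[OF \<Omega>, of x] x spM by auto
    have dpos: "bdry_dist \<Omega> x ^ DIM('a) \<noteq> 0" using bdry_dist_pos[OF D(1,5), of x] x spM by auto
    have X\<psi>: "X \<Omega> (\<psi> k) x = \<bar>\<phi> k x - \<phi> 0 x - (center \<Omega> (\<phi> k) - center \<Omega> (\<phi> 0))\<bar> / weight \<Omega> x" for k
      using cdiff[OF int\<phi> int\<phi>, of k 0] by (simp add: X_eq \<psi>_def[abs_def])
    have Xv: "X \<Omega> v x = \<bar>u x - \<phi> 0 x - (center \<Omega> u - center \<Omega> (\<phi> 0))\<bar> / weight \<Omega> x"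
      using cdiff[OF intu int\<phi>, of 0] by (simp add: X_eq v_def[abs_def])
    have X0: "0 \<le> X \<Omega> (\<psi> k) x" for k using weight_pos[OF \<Omega>, of x] x spM by (simp add: X_eq)
    have "(\<lambda>k. X \<Omega> (\<psi> k) x) \<longlonglongrightarrow> X \<Omega> v x"
      unfolding X\<psi> Xv by (intro tendsto_intros conv cconv wpos)
    then have "(\<lambda>k. X \<Omega> (\<psi> k) x powr q) \<longlonglongrightarrow> X \<Omega> v x powr q"
      by (rule tendsto_powr'[OF _ tendsto_const]) (use X0 p in \<open>auto simp: q_def\<close>)
    then have "(\<lambda>k. Phi n\<^sub>0 (\<beta> * X \<Omega> (\<psi> k) x powr q)) \<longlonglongrightarrow> Phi n\<^sub>0 (\<beta> * X \<Omega> v x powr q)"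
      by (intro continuous_on_tendsto_compose[OF continuous_on_Phi] tendsto_mult tendsto_const) auto
    then show "(\<lambda>k. F (\<psi> k) x) \<longlonglongrightarrow> F v x"
      unfolding F_def by (intro tendsto_ennrealI tendsto_divide tendsto_const dpos)
  qed
  have \<psi>m [measurable]: "\<psi> k \<in> borel_measurable M" for k unfolding \<psi>_def[abs_def] by measurable
  have "(\<integral>\<^sup>+x. F v x \<partial>M) = (\<integral>\<^sup>+x. liminf (\<lambda>k. F (\<psi> k) x) \<partial>M)"
    using Fconv by (intro nn_integral_cong_AE) (auto simp: lim_imp_Liminf elim!: eventually_mono)
  also have "\<dots> \<le> liminf (\<lambda>k. \<integral>\<^sup>+x. F (\<psi> k) x \<partial>M)"
    by (intro nn_integral_liminf Fm \<psi>m)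
  also have "\<dots> \<le> ennreal C"
  proof -
    have "(\<integral>\<^sup>+x. F (\<psi> k) x \<partial>M) \<le> ennreal C" for k
      using C[OF \<psi> \<psi>E, of k] by (simp add: M_def nn_integral_lebesgue_on[OF D(6)] F_def)
    then show ?thesis using Liminf_mono[of _ "\<lambda>_. ennreal C" sequentially] by (simp add: Liminf_const)
  qed
  finally have "(\<integral>\<^sup>+x. F v x \<partial>M) \<le> ennreal C" .
  then have Fv: "(\<integral>\<^sup>+x. F v x \<partial>M) < \<infinity>" by (rule le_less_trans) simp
  have F0: "(\<integral>\<^sup>+x. F (\<phi> 0) x \<partial>M) < \<infinity>"
  proof -
    have "energy p \<Omega> (\<phi> 0) = lebesgue_energy p \<Omega> (\<lambda>x. u x - (u x - \<phi> 0 x))"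
      by (simp add: lebesgue_energy_eq_energy[OF D(6)])
    also have "\<dots> \<le> ennreal (2 powr p) * (lebesgue_energy p \<Omega> u + lebesgue_energy p \<Omega> (\<lambda>x. u x - \<phi> 0 x))"
      by (intro lebesgue_energy_diff_le D p diffm um[unfolded M_def])
    also have "\<dots> < \<infinity>"
      using uE \<phi>(2)[of 0] by (auto simp: ennreal_mult_less_top intro: le_less_trans)
    finally show ?thesis
      using exponential_integral_test_function[OF \<Omega> p n \<beta> \<phi>(1)]
      by (simp add: M_def nn_integral_lebesgue_on[OF D(6)] F_def q_def)
  qed
  define f where "f x = Phi n\<^sub>0 (\<alpha> * X \<Omega> u x powr q) * (1 / bdry_dist \<Omega> x ^ DIM('a))" for x
  have "integrable M f"
  proof (rule integrableI_bounded)
    show "f \<in> borel_measurable M"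
    proof -
      note [measurable] = Xm[OF um]
      show ?thesis unfolding f_def[abs_def] by measurable
    qed
    have "(\<integral>\<^sup>+x. ennreal (norm (f x)) \<partial>M) \<le> (\<integral>\<^sup>+x. F v x + F (\<phi> 0) x \<partial>M)"
    proof (intro nn_integral_mono)
      fix x assume x: "x \<in> space M"
      have w: "weight \<Omega> x > 0" using weight_pos[OF \<Omega>, of x] x spM by auto
      have d: "bdry_dist \<Omega> x > 0" using bdry_dist_pos[OF D(1,5), of x] x spM by auto
      have X0: "0 \<le> X \<Omega> g x" for g using w by (simp add: X_eq)
      have "X \<Omega> u x \<le> X \<Omega> v x + X \<Omega> (\<phi> 0) x"
        unfolding X_eq add_divide_distrib[symmetric] using w cdiff[OF intu int\<phi>, of 0]
        by (intro divide_right_mono) (auto simp: v_def[abs_def])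
      then have "\<alpha> * X \<Omega> u x powr q \<le> \<alpha> * (X \<Omega> v x + X \<Omega> (\<phi> 0) x) powr q"
        using X0 q0 \<alpha> by (intro mult_left_mono powr_mono2) auto
      then have "Phi n\<^sub>0 (\<alpha> * X \<Omega> u x powr q) \<le> Phi n\<^sub>0 (\<alpha> * (X \<Omega> v x + X \<Omega> (\<phi> 0) x) powr q)"
        using \<alpha> by (intro Phi_mono) auto
      also have "\<dots> \<le> Phi n\<^sub>0 (\<beta> * X \<Omega> v x powr q) + Phi n\<^sub>0 (\<beta> * X \<Omega> (\<phi> 0) x powr q)"
        unfolding \<beta>_def using X0 q0 \<alpha> by (intro Phi_add_le) auto
      finally have le: "Phi n\<^sub>0 (\<alpha> * X \<Omega> u x powr q) / bdry_dist \<Omega> x ^ DIM('a)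
         \<le> Phi n\<^sub>0 (\<beta> * X \<Omega> v x powr q) / bdry_dist \<Omega> x ^ DIM('a)
          + Phi n\<^sub>0 (\<beta> * X \<Omega> (\<phi> 0) x powr q) / bdry_dist \<Omega> x ^ DIM('a)"
        using d by (simp add: divide_right_mono flip: add_divide_distrib)
      have "norm (f x) = Phi n\<^sub>0 (\<alpha> * X \<Omega> u x powr q) / bdry_dist \<Omega> x ^ DIM('a)"
        using Phi_nonneg[of "\<alpha> * X \<Omega> u x powr q" n\<^sub>0] \<alpha> d by (simp add: f_def)
      then have "ennreal (norm (f x)) \<le> ennreal (Phi n\<^sub>0 (\<beta> * X \<Omega> v x powr q) / bdry_dist \<Omega> x ^ DIM('a)
          + Phi n\<^sub>0 (\<beta> * X \<Omega> (\<phi> 0) x powr q) / bdry_dist \<Omega> x ^ DIM('a))"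
        using le by (intro ennreal_leI) simp
      also have "\<dots> = F v x + F (\<phi> 0) x"
        unfolding F_def using \<beta> d by (intro ennreal_plus divide_nonneg_pos Phi_nonneg) auto
      finally show "ennreal (norm (f x)) \<le> F v x + F (\<phi> 0) x" .
    qed
    also have "\<dots> = (\<integral>\<^sup>+x. F v x \<partial>M) + (\<integral>\<^sup>+x. F (\<phi> 0) x \<partial>M)"
      by (intro nn_integral_add Fm vm \<phi>m)
    also have "\<dots> < \<infinity>" using Fv F0 by simp
    finally show "(\<integral>\<^sup>+x. ennreal (norm (f x)) \<partial>M) < \<infinity>" .
  qed
  then show ?thesis by (simp add: M_def f_def[abs_def] q)
qed

end
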